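(* Let $Y=\{Y(x),x\ge0\}$ be a Lévy process with values in $\mathbb{R}^d$ and characteristic exponent $\psi$, and let $D=\{D(x),x\ge0\}$ be a subordinator with characteristic exponent $\sigma$, with $D(0)=0$, no drift and Lévy measure $\nu_D$ satisfying $\nu_D(0,\infty)=\infty$. Let $E_t=\inf\{x\ge0:D(x)>t\}$ and $X(t)=Y(E_t)$ for $t\ge0$. Suppose that $Z=\{(D(x),Y(x)),x\ge0\}$ is a Lévy process in $\mathbb{R}^{1+d}$ and that its characteristic exponent $\Phi$ satisfies $$K^{-1}\,{\rm Re}\left(\frac1{1+\sigma(\eta)+\psi(\xi)}\right)\le{\rm Re}\left(\frac1{1+\Phi(\eta,\xi)}\right)\le K\,{\rm Re}\left(\frac1{1+\sigma(\eta)+\psi(\xi)}\right)$$ for all $(\eta,\xi)\in\mathbb{R}^{1+d}$ with $|\eta|+\|\xi\|$ large, where $K\ge1$ is a constant. Then almost surely $$\dim_{\rm H}X([0,1])=\sup\left\{\gamma<d:\int_{\{\xi\in\mathbb{R}^d:\|\xi\|\ge1\}}{\rm Re}\left(\frac1{1+\psi(\xi)}\right)\frac{d\xi}{\|\xi\|^{d-\gamma}}<\infty\right\}$$ and $\dim_{\rm H}{\rm Gr}X([0,1])=\max\{1,\chi\}$ almost surely, where $$\chi=\sup\left\{\gamma<1+d:\int_{\{|\eta|+\|\xi\|\ge1\}}{\rm Re}\left(\frac1{1+\sigma(\eta)+\psi(\xi)}\right)\frac{d\eta\,d\xi}{(|\eta|+\|\xi\|)^{1+d-\gamma}}<\inf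ty\right\}.$$
   Context: $\dim_{\rm H}$ denotes Hausdorff dimension. $X([0,1])=\{X(t):t\in[0,1]\}$ is the range and ${\rm Gr}X([0,1])=\{(t,X(t)):t\in[0,1]\}$ is the graph. Characteristic exponents are defined by $\mathbb{E}(e^{i\langle\xi,Y(x)\rangle})=e^{-x\psi(\xi)}$, $\mathbb{E}(e^{i\eta D(x)})=e^{-x\sigma(\eta)}$ and $\mathbb{E}(e^{i\eta D(x)+i\langle\xi,Y(x)\rangle})=e^{-x\Phi(\eta,\xi)}$, and $\|\cdot\|$ is the Euclidean norm. In the suprema $\gamma$ ranges over real numbers (negative values allowed). Lévy processes start at $0$. *)

theory Defs
  imports "HOL-Probability.Probability"
begin

definition cadlag :: "(real \<Rightarrow> 'a::topological_space) \<Rightarrow> bool" where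
  "cadlag f \<longleftrightarrow>
     (\<forall>t\<ge>0. (f \<longlongrightarrow> f t) (at_right t)) \<and>
     (\<forall>t>0. \<exists>l. (f \<longlongrightarrow> l) (at_left t))"

text \<open>
  Processes are functions on all of \<^typ>\<open>real\<close>; only times \<open>x \<ge> 0\<close> are ever used.
  Stochastic continuity is not listed because it follows from stationarity of the increments
  and right-continuity of the paths.
\<close>

definition levy_process :: "'w measure \<Rightarrow> (real \<Rightarrow> 'w \<Rightarrow> 'a::euclidean_space) \<Rightarrow> bool" where
  "levy_process M Y \<longleftrightarrow>
     (\<forall>x\<ge>0. Y x \<in> borel_measurable M) \<and>
     (AE \<omega> in M. Y 0 \<omega> = 0) \<and>
     (\<forall>n (x :: nat \<Rightarrow> real). 0 \<le> x 0 \<and> (\<forall>i<n. x i < x (Suc i)) \<longrightarrow>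
        prob_space.indep_vars M (\<lambda>_. borel) (\<lambda>i \<omega>. Y (x (Suc i)) \<omega> - Y (x i) \<omega>) {..<n}) \<and>
     (\<forall>x\<ge>0. \<forall>h\<ge>0. distr M borel (\<lambda>\<omega>. Y (x + h) \<omega> - Y x \<omega>) = distr M borel (Y h)) \<and>
     (AE \<omega> in M. cadlag (\<lambda>x. Y x \<omega>))"

text \<open>
  Requiring the identity at every time \<open>x \<ge> 0\<close> determines \<open>\<psi>\<close> uniquely (no choice of a
  branch of the logarithm remains).
\<close>

definition has_char_exponent ::
    "'w measure \<Rightarrow> (real \<Rightarrow> 'w \<Rightarrow> 'a::euclidean_space) \<Rightarrow> ('a \<Rightarrow> complex) \<Rightarrow> bool" where
  "has_char_exponent M Y \<psi> \<longleftrightarrow>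
     (\<forall>x\<ge>0. \<forall>\<xi>. (\<integral>\<omega>. exp (\<i> * complex_of_real (\<xi> \<bullet> Y x \<omega>)) \<partial>M)
                    = exp (- complex_of_real x * \<psi> \<xi>))"

definition subordinator :: "'w measure \<Rightarrow> (real \<Rightarrow> 'w \<Rightarrow> real) \<Rightarrow> bool" where
  "subordinator M D \<longleftrightarrow> levy_process M D \<and> (AE \<omega> in M. mono_on {0..} (\<lambda>x. D x \<omega>))"

text \<open>
  The Levy--Khintchine representation of the characteristic exponent \<open>\<sigma>\<close> of a subordinator,
  with drift \<open>b\<close> and Levy measure \<open>\<nu>\<close>. The measure \<open>\<nu>\<close> lives on the whole line
  and gives no mass to \<open>(-\<infinity>,0]\<close>.
\<close>

definition has_drift_and_levy_measure ::
    "(real \<Rightarrow> complex) \<Rightarrow> real \<Rightarrow> real measure \<Rightarrow> bool" where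
  "has_drift_and_levy_measure \<sigma> b \<nu> \<longleftrightarrow>
     0 \<le> b \<and> sets \<nu> = sets borel \<and> emeasure \<nu> {..0} = 0 \<and>
     (\<integral>\<^sup>+u. ennreal (min 1 u) \<partial>\<nu>) < \<infinity> \<and>
     (\<forall>\<eta>. \<sigma> \<eta> = - \<i> * complex_of_real (b * \<eta>)
                   + (\<integral>u. 1 - exp (\<i> * complex_of_real (\<eta> * u)) \<partial>\<nu>))"

definition inverse_process :: "(real \<Rightarrow> 'w \<Rightarrow> real) \<Rightarrow> real \<Rightarrow> 'w \<Rightarrow> real" where
  "inverse_process D t \<omega> = Inf {x. 0 \<le> x \<and> t < D x \<omega>}"

definition time_changed ::
    "(real \<Rightarrow> 'w \<Rightarrow> 'a) \<Rightarrow> (real \<Rightarrow> 'w \<Rightarrow> real) \<Rightarrow> real \<Rightarrow> 'w \<Rightarrow> 'a" where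
  "time_changed Y D t \<omega> = Y (inverse_process D t \<omega>) \<omega>"

text \<open>
  The case \<open>s = 0\<close> is separate because \<^term>\<open>0 powr 0 = (0::real)\<close>, whereas a one-point
  set must have weight 1. The covering sets are required to be bounded because
  \<^const>\<open>diameter\<close> is meaningless otherwise.
\<close>

definition hausdorff_weight :: "real \<Rightarrow> 'a::metric_space set \<Rightarrow> ennreal" where
  "hausdorff_weight s U =
     (if U = {} then 0 else if s = 0 then 1 else ennreal (diameter U powr s))"

definition hausdorff_content :: "real \<Rightarrow> real \<Rightarrow> 'a::metric_space set \<Rightarrow> ennreal" where
  "hausdorff_content \<delta> s A =
     (INF U \<in> {U :: nat \<Rightarrow> 'a set. (\<forall>i. bounded (U i) \<and> diameter (U i) \<le> \<delta>) \<and> A \<subseteq> (\<Union>i. U i)}.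
        \<Sum>i. hausdorff_weight s (U i))"

definition hausdorff_measure :: "real \<Rightarrow> 'a::metric_space set \<Rightarrow> ennreal" where
  "hausdorff_measure s A = (SUP \<delta>\<in>{0<..}. hausdorff_content \<delta> s A)"

definition hausdorff_dim :: "'a::metric_space set \<Rightarrow> ereal" where
  "hausdorff_dim A = Inf (ereal ` {s. 0 \<le> s \<and> hausdorff_measure s A = 0})"

end

theory Submission
  imports Defs
begin

text \<open>
  Let \<open>U\<close> be the 1-potential measure of a Levy process with exponent \<open>\<Psi>\<close> in dimension \<open>n\<close>. Its
  Fourier transform is \<open>1 / (1 + \<Psi>)\<close>, and the real part of that is positive. Writing a Riesz kernel
  as a mixture of Gaussians turns, by Tonelli and for \<open>0 < \<gamma> < n\<close>, the condition on
  \<open>Re (1 / (1 + \<Psi>))\<close> into finiteness of the integral of \<open>\<parallel>x\<parallel> powr - \<gamma>\<close> against \<open>U\<close>.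

  If this integral is finite, the occupation measure has finite \<open>\<gamma>\<close>-energy, so the range has
  dimension at least \<open>\<gamma>\<close>. If it is infinite, then \<open>U(ball 0 r) / r powr \<gamma>'\<close> is unbounded as
  \<open>r \<rightarrow> 0\<close> for every \<open>\<gamma>' > \<gamma>\<close>. The expected number of cubes of side \<open>r\<close> visited up to a fixed time
  is at most a constant over \<open>U(ball 0 r)\<close>, so the range has dimension at most \<open>\<gamma>'\<close>.

  An infinite Levy measure makes \<open>D\<close> strictly increasing, hence \<open>E\<close> maps \<open>{0..1}\<close> onto \<open>{0..E 1}\<close>
  and \<open>X\<close> has the same range there as \<open>Y\<close> on \<open>{0..E 1}\<close>. The graph of \<open>X\<close> is contained in the
  range of \<open>(D, Y)\<close> together with countably many segments, contains an initial piece of that range,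
  and projects onto \<open>{0..1}\<close>.
\<close>

section \<open>Hausdorff measures\<close>

text \<open>A Riesz kernel has only a distributional Fourier transform, whereas each Gaussian and
  the potential are probability measures, for which Parseval is plain Fubini; the passage to the
  kernel then involves nonnegative integrands only. Keeping kernels as Gaussian mixtures also takes
  the place of polar coordinates.

  A counting bound of this kind classically rests on the strong Markov property at hitting times.
  Here cells are watched on finite dyadic grids, where a first visit is an event of finitely many
  independent increments; right-continuity and closed cells recover the remaining times.

  The time \<open>E 1\<close> at which the range is cut is random and depends on the path, so the
  dimension of the range has to be known for all \<open>T\<close> outside a single null set. The
  dimension for \<open>(D, Y)\<close> comes out in terms of its own exponent \<open>\<Phi>\<close>,
  and the comparison hypothesis serves to rewrite it through \<open>\<sigma>\<close> and
  \<open>\<psi>\<close>. That an infinite Levy measure forces strict increase is seen by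
  contradiction: a positive probability of no movement would bound the real part of
  \<open>\<sigma>\<close>, and then the Levy measure would be finite.\<close>

lemma diameter_leI:
  fixes S :: "'a::metric_space set"
  assumes "S \<noteq> {}" "\<And>x y. x \<in> S \<Longrightarrow> y \<in> S \<Longrightarrow> dist x y \<le> d"
  shows "diameter S \<le> d"
  using assms by (auto simp: diameter_def intro!: cSUP_least)

lemma hausdorff_weight_antimono_exponent:
  assumes "0 \<le> s" "s \<le> t" "bounded A" "diameter A \<le> 1"
  shows "hausdorff_weight t A \<le> hausdorff_weight s A"
proof (cases "A = {} \<or> t = 0")
  case True
  then show ?thesis using assms by (auto simp: hausdorff_weight_def)
next
  case False
  have d: "0 \<le> diameter A" using assms by (simp add: diameter_ge_0)
  have "diameter A powr t \<le> diameter A powr s" using d assms by (intro powr_mono') auto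
  \<comment> \<open>This covers \<open>s = 0\<close>, where the weight of \<open>A\<close> is 1
    rather than a power.\<close>
  moreover have "diameter A powr t \<le> 1" using powr_mono2[of t "diameter A" 1] False d assms by auto
  ultimately show ?thesis using False by (auto simp: hausdorff_weight_def ennreal_leI)
qed

lemma hausdorff_content_le:
  assumes "\<And>i. bounded (U i)" "\<And>i. diameter (U i) \<le> \<delta>" "A \<subseteq> (\<Union>i. U i)"
  shows "hausdorff_content \<delta> s A \<le> (\<Sum>i. hausdorff_weight s (U i))"
  unfolding hausdorff_content_def using assms by (intro INF_lower) auto

lemma hausdorff_content_less_cover:
  assumes "hausdorff_content \<delta> s A < e"
  obtains U where "\<And>i::nat. bounded (U i)" "\<And>i. diameter (U i) \<le> \<delta>" "A \<subseteq> (\<Union>i. U i)"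
    "(\<Sum>i. hausdorff_weight s (U i)) < e"
  using assms unfolding hausdorff_content_def INF_less_iff by auto

lemma hausdorff_content_antimono_exponent:
  assumes "0 \<le> s" "s \<le> t" "\<delta> \<le> 1"
  shows "hausdorff_content \<delta> t (A::'a::metric_space set) \<le> hausdorff_content \<delta> s A"
  unfolding hausdorff_content_def
proof (rule INF_mono)
  fix U :: "nat \<Rightarrow> 'a set"
  assume U: "U \<in> {U. (\<forall>i. bounded (U i) \<and> diameter (U i) \<le> \<delta>) \<and> A \<subseteq> (\<Union>i. U i)}"
  then have "diameter (U i) \<le> 1" for i using assms(3) by (auto intro: order_trans)
  with U show "\<exists>V\<in>{U. (\<forall>i. bounded (U i) \<and> diameter (U i) \<le> \<delta>) \<and> A \<subseteq> (\<Union>i. U i)}.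
      (\<Sum>i. hausdorff_weight t (V i)) \<le> (\<Sum>i. hausdorff_weight s (U i))"
    using assms by (intro bexI[of _ U] suminf_le hausdorff_weight_antimono_exponent) auto
qed

lemma hausdorff_content_antimono_scale:
  assumes "\<delta> \<le> \<delta>'"
  shows "hausdorff_content \<delta>' s A \<le> hausdorff_content \<delta> s A"
  unfolding hausdorff_content_def using assms
  by (intro INF_superset_mono) (auto intro: order_trans)

lemma hausdorff_content_subset:
  assumes "A \<subseteq> B"
  shows "hausdorff_content \<delta> s A \<le> hausdorff_content \<delta> s B"
  unfolding hausdorff_content_def using assms by (intro INF_superset_mono) auto

lemma hausdorff_null_iff:
  "hausdorff_measure s A = 0 \<longleftrightarrow> (\<forall>\<delta>>0. hausdorff_content \<delta> s A = 0)"
  unfolding hausdorff_measure_def bot_ennreal[symmetric] SUP_bot_conv by auto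

lemma hausdorff_null_subset:
  "A \<subseteq> B \<Longrightarrow> hausdorff_measure s B = 0 \<Longrightarrow> hausdorff_measure s A = 0"
  using hausdorff_content_subset[of A B]
  by (auto simp: hausdorff_null_iff) (metis le_zero_eq)

lemma hausdorff_null_antimono_exponent:
  assumes "0 \<le> s" "s \<le> t" "hausdorff_measure s A = 0"
  shows "hausdorff_measure t A = 0"
  unfolding hausdorff_null_iff
proof (intro allI impI)
  fix \<delta> :: real assume "\<delta> > 0"
  \<comment> \<open>Exponents can be compared only for diameters at most 1, so the scale is lowered
    first; lowering it can only increase the content.\<close>
  have "hausdorff_content \<delta> t A \<le> hausdorff_content (min \<delta> 1) t A"
    by (intro hausdorff_content_antimono_scale) auto
  also have "\<dots> \<le> hausdorff_content (min \<delta> 1) s A"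
    using assms by (intro hausdorff_content_antimono_exponent) auto
  also have "\<dots> = 0" using assms \<open>\<delta> > 0\<close> by (auto simp: hausdorff_null_iff)
  finally show "hausdorff_content \<delta> t A = 0" by simp
qed

lemma hausdorff_null_UN:
  assumes "\<And>i::nat. hausdorff_measure s (A i) = 0"
  shows "hausdorff_measure s (\<Union>i. A i) = 0"
  unfolding hausdorff_null_iff
proof (intro allI impI)
  fix \<delta> :: real assume "\<delta> > 0"
  have "hausdorff_content \<delta> s (\<Union>i. A i) \<le> 0 + ennreal e" if "e > 0" for e
  proof -
    have "\<exists>U. (\<forall>j::nat. bounded (U j) \<and> diameter (U j) \<le> \<delta>) \<and> A i \<subseteq> (\<Union>j. U j) \<and>
      (\<Sum>j. hausdorff_weight s (U j)) \<le> ennreal (e * (1/2)^Suc i)" for i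
    proof -
      have "hausdorff_content \<delta> s (A i) < ennreal (e * (1/2)^Suc i)"
        using assms[of i] \<open>\<delta> > 0\<close> that by (auto simp: hausdorff_null_iff ennreal_zero_less_mult_iff)
      from hausdorff_content_less_cover[OF this] show ?thesis
        by (metis less_imp_le)
    qed
    then obtain U where U: "\<And>i j::nat. bounded (U i j)" "\<And>i j. diameter (U i j) \<le> \<delta>"
      "\<And>i. A i \<subseteq> (\<Union>j. U i j)"
      "\<And>i. (\<Sum>j. hausdorff_weight s (U i j)) \<le> ennreal (e * (1/2)^Suc i)"
      by metis
    let ?V = "\<lambda>k. case prod_decode k of (i, j) \<Rightarrow> U i j"
    have "hausdorff_content \<delta> s (\<Union>i. A i) \<le> (\<Sum>k. hausdorff_weight s (?V k))"
    proof (intro hausdorff_content_le)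
      show "(\<Union>i. A i) \<subseteq> (\<Union>k. ?V k)"
      proof safe
        fix x i assume "x \<in> A i"
        then obtain j where "x \<in> U i j" using U(3) by blast
        then show "x \<in> (\<Union>k. ?V k)" by (intro UN_I[of "prod_encode (i,j)"]) auto
      qed
    qed (use U in \<open>auto split: prod.split\<close>)
    also have "\<dots> = (\<Sum>i. \<Sum>j. hausdorff_weight s (U i j))"
      using suminf_ennreal_2dimen[of "\<lambda>i. \<Sum>j. hausdorff_weight s (U i j)" "\<lambda>(i,j). hausdorff_weight s (U i j)"]
      by (simp add: comp_def split_beta)
    also have "\<dots> \<le> (\<Sum>i. ennreal (e * (1/2)^Suc i))"
      by (intro suminf_le U) auto
    also have "\<dots> = ennreal e"
      using power_half_series sums_mult[OF power_half_series, of e] that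
      by (subst suminf_ennreal2) (auto simp: sums_iff)
    finally show ?thesis by simp
  qed
  then have "hausdorff_content \<delta> s (\<Union>i. A i) \<le> 0"
    by (rule ennreal_le_epsilon)
  then show "hausdorff_content \<delta> s (\<Union>i. A i) = 0" by simp
qed

lemma hausdorff_null_UN_countable:
  assumes "countable I" "\<And>i. i \<in> I \<Longrightarrow> hausdorff_measure s (A i) = 0"
  shows "hausdorff_measure s (\<Union>i\<in>I. A i) = 0"
proof (cases "I = {}")
  case True
  have "hausdorff_measure s ({}::'b set) \<le> 0"
    unfolding hausdorff_measure_def
    using hausdorff_content_le[of "\<lambda>_. {}" _ "{}::'b set" s]
    by (auto intro!: SUP_least simp: hausdorff_weight_def)
  then show ?thesis using True by simp
next
  case False
  then have "(\<Union>i\<in>I. A i) = (\<Union>n. A (from_nat_into I n))"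
    using range_from_nat_into[OF False assms(1)] by (metis image_image)
  then show ?thesis
    using hausdorff_null_UN[of s "\<lambda>n. A (from_nat_into I n)"] assms(2) from_nat_into[OF False] by simp
qed

lemma hausdorff_content_finite_cover:
  assumes "finite I" "\<And>i. i \<in> I \<Longrightarrow> bounded (U i)" "\<And>i. i \<in> I \<Longrightarrow> diameter (U i) \<le> r"
    and "A \<subseteq> (\<Union>i\<in>I. U i)" "0 < s" "0 \<le> r" "r \<le> \<delta>"
  shows "hausdorff_content \<delta> s A \<le> ennreal (card I * r powr s)"
proof -
  obtain f where f: "bij_betw f {0..<card I} I"
    using assms(1) ex_bij_betw_nat_finite by blast
  \<comment> \<open>Covers are sequences, so the finite family is padded with empty sets, whose
    weight is 0.\<close>
  define V where "V k = (if k < card I then U (f k) else {})" for k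
  have fI: "f k \<in> I" if "k < card I" for k using f that by (auto simp: bij_betw_def)
  have "hausdorff_content \<delta> s A \<le> (\<Sum>k. hausdorff_weight s (V k))"
  proof (rule hausdorff_content_le)
    show "A \<subseteq> (\<Union>k. V k)"
    proof
      fix x assume "x \<in> A"
      then obtain i where "i \<in> I" "x \<in> U i" using assms by auto
      moreover then obtain k where "k < card I" "f k = i" using f
        by (metis atLeast0LessThan bij_betw_iff_bijections lessThan_iff)
      ultimately show "x \<in> (\<Union>k. V k)" by (auto simp: V_def)
    qed
    fix k show "bounded (V k)" "diameter (V k) \<le> \<delta>"
      using assms(2,3)[OF fI[of k]] assms(6,7) by (auto simp: V_def)
  qed
  also have "\<dots> = (\<Sum>k<card I. hausdorff_weight s (V k))"
    by (intro suminf_finite) (auto simp: V_def hausdorff_weight_def)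
  also have "\<dots> \<le> (\<Sum>k<card I. ennreal (r powr s))"
  proof (rule sum_mono)
    fix k assume "k \<in> {..<card I}"
    then have "bounded (V k)" "diameter (V k) \<le> r" using assms(2,3)[OF fI[of k]] by (auto simp: V_def)
    then show "hausdorff_weight s (V k) \<le> ennreal (r powr s)"
      using assms diameter_ge_0[of "V k"]
      by (auto simp: hausdorff_weight_def intro!: ennreal_leI powr_mono2)
  qed
  also have "\<dots> = ennreal (card I * r powr s)"
    by (simp add: ennreal_mult'' ennreal_of_nat_eq_real_of_nat)
  finally show ?thesis .
qed

text \<open>The mass lives on the parameter space of \<open>f\<close>, so \<open>A\<close> itself
  may be non-measurable. Testing closed sets is enough because closing a covering set leaves its
  diameter unchanged.\<close>

lemma mass_distribution_principle:
  fixes f :: "'b \<Rightarrow> 'a::metric_space"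
  assumes [measurable]: "f \<in> borel_measurable N" "B \<in> sets N"
    and "0 < emeasure N B" "f ` B \<subseteq> A" "0 < s" "0 \<le> c"
    and small: "\<And>S. closed S \<Longrightarrow> bounded S \<Longrightarrow> emeasure N {x\<in>B. f x \<in> S} \<le> ennreal (c * diameter S powr s)"
  shows "hausdorff_measure s A \<noteq> 0"
proof
  assume "hausdorff_measure s A = 0"
  then have "hausdorff_content 1 s A = 0" by (simp add: hausdorff_null_iff)
  \<comment> \<open>Dividing by \<open>c + 1\<close> instead of \<open>c\<close> keeps the divisor
    positive when \<open>c = 0\<close>.\<close>
  moreover have "emeasure N B / ennreal (c + 1) \<le> hausdorff_content 1 s A"
    unfolding hausdorff_content_def
  proof (rule INF_greatest, safe)
    fix U :: "nat \<Rightarrow> 'a set"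
    assume U: "\<forall>i. bounded (U i) \<and> diameter (U i) \<le> 1" "A \<subseteq> (\<Union>i. U i)"
    have B: "B = (\<Union>i. {x\<in>B. f x \<in> closure (U i)})"
    proof -
      have "A \<subseteq> (\<Union>i. closure (U i))"
        using U(2) by (rule order_trans) (intro UN_mono closure_subset order_refl)
      then show ?thesis using assms(4) by auto
    qed
    have m: "{x\<in>B. f x \<in> closure (U i)} \<in> sets N" for i
    proof -
      have "{x\<in>B. f x \<in> closure (U i)} = B \<inter> (f -` closure (U i) \<inter> space N)"
        using sets.sets_into_space[OF assms(2)] by auto
      also have "\<dots> \<in> sets N" by (intro sets.Int assms(2) measurable_sets[OF assms(1)]) auto
      finally show ?thesis .
    qed
    have "emeasure N B \<le> (\<Sum>i. emeasure N {x\<in>B. f x \<in> closure (U i)})"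
      by (subst B, rule emeasure_subadditive_countably) (use m in auto)
    also have "\<dots> \<le> (\<Sum>i. ennreal (c + 1) * hausdorff_weight s (U i))"
    proof (intro suminf_le)
      fix i
      show "emeasure N {x\<in>B. f x \<in> closure (U i)} \<le> ennreal (c + 1) * hausdorff_weight s (U i)"
      proof (cases "U i = {}")
        case False
        have d: "diameter (closure (U i)) = diameter (U i)" using U by (simp add: diameter_closure)
        have "emeasure N {x\<in>B. f x \<in> closure (U i)} \<le> ennreal (c * diameter (closure (U i)) powr s)"
          using U by (intro small) auto
        also have "\<dots> \<le> ennreal ((c + 1) * diameter (U i) powr s)"
          unfolding d using assms by (intro ennreal_leI mult_right_mono) auto
        finally show ?thesis using False assms by (simp add: hausdorff_weight_def ennreal_mult)
      qed simp
    qed auto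
    also have "\<dots> = ennreal (c + 1) * (\<Sum>i. hausdorff_weight s (U i))" by simp
    finally show "emeasure N B / ennreal (c + 1) \<le> (\<Sum>i. hausdorff_weight s (U i))"
      using assms by (intro divide_le_posI_ennreal) (auto simp: ac_simps simp del: ennreal_plus)
  qed
  ultimately have "emeasure N B / ennreal (c + 1) = 0" by simp
  then show False using assms by simp
qed

text \<open>Meant for the projection of the graph onto the time axis: the images of a cover form a
  cover by sets of no larger diameter.\<close>

lemma hausdorff_null_image_nonexpansive:
  fixes f :: "'a::metric_space \<Rightarrow> 'b::metric_space"
  assumes f: "\<And>x y. dist (f x) (f y) \<le> dist x y"
    and "0 \<le> s" "hausdorff_measure s A = 0"
  shows "hausdorff_measure s (f ` A) = 0"
  unfolding hausdorff_null_iff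
proof (intro allI impI)
  have image: "bounded (f ` U) \<and> diameter (f ` U) \<le> diameter U" if "bounded U" for U
  proof (cases "U = {}")
    case False
    from that obtain x e where "\<forall>y\<in>U. dist x y \<le> e" unfolding bounded_def by blast
    then have "\<forall>y\<in>f ` U. dist (f x) y \<le> e" using f order_trans by blast
    moreover have "diameter (f ` U) \<le> diameter U"
      using False by (intro diameter_leI) (auto intro: order_trans[OF f] diameter_bounded_bound that)
    ultimately show ?thesis unfolding bounded_def by blast
  qed simp
  fix \<delta> :: real assume "\<delta> > 0"
  have "hausdorff_content \<delta> s (f ` A) \<le> hausdorff_content \<delta> s A"
    unfolding hausdorff_content_def[of \<delta> s A]
  proof (rule INF_greatest, safe)
    fix U :: "nat \<Rightarrow> 'a set"
    assume U: "\<forall>i. bounded (U i) \<and> diameter (U i) \<le> \<delta>" "A \<subseteq> (\<Union>i. U i)"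
    have "hausdorff_content \<delta> s (f ` A) \<le> (\<Sum>i. hausdorff_weight s (f ` U i))"
    proof (rule hausdorff_content_le)
      fix i show "bounded (f ` U i)" "diameter (f ` U i) \<le> \<delta>"
        using image[of "U i"] U by (auto intro: order_trans)
    qed (use U(2) in blast)
    also have "\<dots> \<le> (\<Sum>i. hausdorff_weight s (U i))"
    proof (intro suminf_le)
      fix i
      have "0 \<le> diameter (f ` U i)" "diameter (f ` U i) \<le> diameter (U i)"
        using image[of "U i"] U by (auto intro: diameter_ge_0)
      then show "hausdorff_weight s (f ` U i) \<le> hausdorff_weight s (U i)"
        using \<open>0 \<le> s\<close> by (auto simp: hausdorff_weight_def intro!: ennreal_leI powr_mono2)
    qed auto
    finally show "hausdorff_content \<delta> s (f ` A) \<le> (\<Sum>i. hausdorff_weight s (U i))" .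
  qed
  then show "hausdorff_content \<delta> s (f ` A) = 0"
    using assms(3) \<open>\<delta> > 0\<close> by (simp add: hausdorff_null_iff)
qed

text \<open>Lebesgue measure is the mass distribution; \<open>c = 2\<close> because a set lies in
  the interval around any of its points whose half-length is the diameter.\<close>

lemma hausdorff_measure_unit_interval: "hausdorff_measure 1 {0..1::real} \<noteq> 0"
proof (rule mass_distribution_principle[where N=lborel and f="\<lambda>x. x" and B="{0..1}" and c=2])
  fix S :: "real set" assume S: "closed S" "bounded S"
  show "emeasure lborel {x \<in> {0..1}. x \<in> S} \<le> ennreal (2 * diameter S powr 1)"
  proof (cases "S = {}")
    case False
    then obtain x where "x \<in> S" by auto
    have d: "0 \<le> diameter S" using S by (simp add: diameter_ge_0)
    have "{x \<in> {0..1}. x \<in> S} \<subseteq> {x - diameter S..x + diameter S}"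
      using diameter_bounded_bound[OF S(2) \<open>x \<in> S\<close>] by (force simp: dist_real_def abs_le_iff)
    then have "emeasure lborel {x \<in> {0..1}. x \<in> S} \<le> emeasure lborel {x - diameter S..x + diameter S}"
      by (intro emeasure_mono) auto
    also have "\<dots> = ennreal (2 * diameter S powr 1)" using d by simp
    finally show ?thesis .
  qed simp
qed auto

text \<open>Pieces of length \<open>1 / n\<close> cost at most
  \<open>2 * real n powr (- (s - 1))\<close> in total, which tends to 0. Such segments are the flat
  parts of the graph, over the jumps of the clock.\<close>

lemma hausdorff_null_segment:
  assumes "1 < s"
  shows "hausdorff_measure s ({0..1::real} \<times> {y::'a::metric_space}) = 0"
  unfolding hausdorff_null_iff
proof (intro allI impI)
  fix \<delta> :: real assume \<delta>: "\<delta> > 0"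
  have "hausdorff_content \<delta> s ({0..1::real} \<times> {y}) \<le> 0"
  proof (rule tendsto_lowerbound)
    have "(\<lambda>n. 2 * real n powr (- (s - 1))) \<longlonglongrightarrow> 2 * 0"
      using assms by (intro tendsto_mult tendsto_const tendsto_neg_powr filterlim_real_sequentially) auto
    then show "(\<lambda>n. ennreal (2 * real n powr (- (s - 1)))) \<longlonglongrightarrow> 0"
      using tendsto_ennrealI by fastforce
    have "\<forall>\<^sub>F n in sequentially. 1 / \<delta> < real n"
      using filterlim_real_sequentially by (simp add: filterlim_at_top_dense)
    then show "\<forall>\<^sub>F n in sequentially. hausdorff_content \<delta> s ({0..1::real} \<times> {y}) \<le> ennreal (2 * real n powr (- (s - 1)))"
    proof eventually_elim
      case (elim n)
      moreover have "0 < 1 / \<delta>" using \<delta> by simp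
      ultimately have n: "0 < real n" by linarith
      define U where "U k = {real k / n..(real k + 1) / n} \<times> {y}" for k :: nat
      have ne: "(real k / n, y) \<in> U k" for k using n by (simp add: U_def divide_right_mono)
      have diam: "dist p q \<le> 1 / n" if "p \<in> U k" "q \<in> U k" for p q k
        using n that by (auto simp: U_def dist_Pair_Pair dist_real_def abs_le_iff add_divide_distrib)
      have "hausdorff_content \<delta> s ({0..1::real} \<times> {y}) \<le> ennreal (card {..n} * (1 / real n) powr s)"
      proof (rule hausdorff_content_finite_cover)
        show "bounded (U k)" for k by (simp add: U_def bounded_Times)
        show "diameter (U k) \<le> 1 / n" for k
          using ne[of k] diam by (intro diameter_leI) auto
        show "{0..1} \<times> {y} \<subseteq> (\<Union>k\<in>{..n}. U k)"
        proof
          fix p assume "p \<in> {0..1::real} \<times> {y}"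
          then obtain x where x: "p = (x, y)" "0 \<le> x" "x \<le> 1" by auto
          \<comment> \<open>The value \<open>k = n\<close> occurs at \<open>x = 1\<close>, which is
            why \<open>n + 1\<close> pieces are taken.\<close>
          define k where "k = nat \<lfloor>x * n\<rfloor>"
          have k: "real k \<le> x * n" "x * n \<le> real k + 1" using x n by (auto simp: k_def)
          have "x * n \<le> real n" using x n by (simp add: mult_left_le_one_le)
          then have "k \<le> n" using k(1) by linarith
          moreover have "p \<in> U k" using k n by (simp add: U_def x divide_le_eq le_divide_eq)
          ultimately show "p \<in> (\<Union>k\<in>{..n}. U k)" by auto
        qed
        show "1 / real n \<le> \<delta>" using elim \<delta> n by (simp add: field_simps)
      qed (use assms n in auto)
      also have "\<dots> \<le> ennreal (2 * real n powr (- (s - 1)))"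
      proof (rule ennreal_leI)
        have eq: "(1 / real n) powr s = real n powr - s"
          using n by (simp add: powr_divide powr_minus_divide)
        have "real (card {..n}) * (1 / real n) powr s \<le> (2 * real n) * real n powr - s"
          unfolding eq using n by (intro mult_right_mono) auto
        also have "(2 * real n) * real n powr - s = 2 * real n powr (- (s - 1))"
          using n by (simp add: powr_diff powr_minus_divide)
        finally show "real (card {..n}) * (1 / real n) powr s \<le> 2 * real n powr (- (s - 1))" .
      qed
      finally show ?case .
    qed
  qed simp
  then show "hausdorff_content \<delta> s ({0..1::real} \<times> {y}) = 0" by simp
qed

section \<open>Hausdorff dimension in terms of null measures\<close>

lemma hausdorff_dim_leI:
  assumes "0 \<le> a" "\<And>s. s > a \<Longrightarrow> hausdorff_measure s A = 0"
  shows "hausdorff_dim A \<le> ereal a"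
proof (rule ereal_le_epsilon2)
  fix e :: real assume "e > 0"
  then have "hausdorff_dim A \<le> ereal (a + e)"
    unfolding hausdorff_dim_def using assms by (intro INF_lower) auto
  then show "hausdorff_dim A \<le> ereal a + ereal e" by simp
qed

lemma hausdorff_dim_geI:
  assumes "\<And>s. 0 \<le> s \<Longrightarrow> s < a \<Longrightarrow> hausdorff_measure s A \<noteq> 0"
  shows "ereal a \<le> hausdorff_dim A"
  unfolding hausdorff_dim_def using assms
  by (intro INF_greatest) (metis (mono_tags, lifting) ereal_less_eq(3) mem_Collect_eq not_less)

lemma hausdorff_dim_leD:
  assumes "hausdorff_dim A \<le> ereal a" "a < s"
  shows "hausdorff_measure s A = 0"
proof -
  have "hausdorff_dim A < ereal s" using assms(1) by (rule order.strict_trans1) (use assms(2) in simp)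
  then obtain u where "0 \<le> u" "hausdorff_measure u A = 0" "u < s"
    unfolding hausdorff_dim_def INF_less_iff by auto
  then show ?thesis using hausdorff_null_antimono_exponent[of u s A] by simp
qed

lemma hausdorff_dim_mono: "A \<subseteq> B \<Longrightarrow> hausdorff_dim A \<le> hausdorff_dim B"
  unfolding hausdorff_dim_def
  by (intro Inf_superset_mono image_mono) (auto intro: hausdorff_null_subset)

section \<open>Gaussian densities and Riesz kernels\<close>

lemma nn_set_integral_mono:
  assumes "A \<subseteq> B" "\<And>x. x \<in> A \<Longrightarrow> f x \<le> g x"
  shows "(\<integral>\<^sup>+x\<in>A. f x \<partial>M) \<le> (\<integral>\<^sup>+x\<in>B. g x \<partial>M)"
  using assms by (intro nn_integral_mono) (auto split: split_indicator)

lemma nn_set_integral_cong: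
  assumes "\<And>x. x \<in> A \<Longrightarrow> f x = g x"
  shows "(\<integral>\<^sup>+x\<in>A. f x \<partial>M) = (\<integral>\<^sup>+x\<in>A. g x \<partial>M)"
  using assms by (intro nn_integral_cong) (auto split: split_indicator)

lemma nn_set_integral_cmult:
  assumes "f \<in> borel_measurable M" "A \<in> sets M"
  shows "(\<integral>\<^sup>+x\<in>A. c * f x \<partial>M) = c * (\<integral>\<^sup>+x\<in>A. f x \<partial>M)"
  using assms by (simp add: mult.assoc nn_integral_cmult)

section \<open>Power integrals on the half-line\<close>

lemma nn_integral_powr_at_zero:
  fixes a k :: real
  assumes "0 < k" "0 \<le> a"
  shows "(\<integral>\<^sup>+s\<in>{0<..a}. ennreal (s powr (k - 1)) \<partial>lborel) = ennreal (a powr k / k)"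
proof -
  have "((\<lambda>x. x powr (k - 1)) has_integral (a powr k / k)) {0..a}"
    using has_integral_powr_from_0[of "k - 1" a] assms by simp
  then have "(\<integral>\<^sup>+s. ennreal (indicator {0..a} s * s powr (k - 1)) \<partial>lborel) = ennreal (a powr k / k)"
    by (intro nn_integral_has_integral_lebesgue) auto
  moreover have "(\<integral>\<^sup>+s\<in>{0<..a}. ennreal (s powr (k - 1)) \<partial>lborel)
    = (\<integral>\<^sup>+s. ennreal (indicator {0..a} s * s powr (k - 1)) \<partial>lborel)"
    by (intro nn_integral_cong) (auto split: split_indicator)
  ultimately show ?thesis by simp
qed

lemma nn_integral_powr_at_top:
  fixes a k :: real
  assumes "0 < k" "0 < a"
  shows "(\<integral>\<^sup>+s\<in>{a..}. ennreal (s powr (- k - 1)) \<partial>lborel) = ennreal (a powr - k / k)"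
proof -
  have "(\<integral>\<^sup>+s\<in>{a..}. ennreal (s powr (- k - 1)) \<partial>lborel) = ennreal (0 - (- (a powr - k / k)))"
  proof (rule nn_integral_FTC_atLeast)
    show "((\<lambda>s. - (s powr - k / k)) has_real_derivative x powr (- k - 1)) (at x)" if "a \<le> x" for x
      using that assms by (auto intro!: derivative_eq_intros)
    have "((\<lambda>s. s powr - k) \<longlongrightarrow> 0) at_top"
      using assms by (intro tendsto_neg_powr filterlim_ident) auto
    then show "((\<lambda>s. - (s powr - k / k)) \<longlongrightarrow> 0) at_top"
      using tendsto_minus tendsto_divide_zero by fastforce
  qed (use assms in auto)
  then show ?thesis by simp
qed

lemma nn_integral_powr_at_top_eq_infinity:
  fixes a k :: real
  assumes "0 \<le> k" "0 < a"
  shows "(\<integral>\<^sup>+s\<in>{a..}. ennreal (s powr (k - 1)) \<partial>lborel) = \<infinity>"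
proof (rule ccontr)
  \<comment> \<open>Beyond 1 the integrand dominates \<open>1 / s\<close>, whose integral over
    \<open>{b..b * exp (r + 1)}\<close> is \<open>r + 1\<close>, more than the supposed value
    \<open>r\<close> of the whole integral.\<close>
  define b where "b = max a 1"
  have b: "1 \<le> b" "a \<le> b" by (auto simp: b_def)
  let ?I = "\<integral>\<^sup>+s\<in>{a..}. ennreal (s powr (k - 1)) \<partial>lborel"
  assume "?I \<noteq> \<infinity>"
  then obtain r where r: "0 \<le> r" "?I = ennreal r" by (cases ?I) auto
  have "ennreal (ln (b * exp (r + 1)) - ln b) = (\<integral>\<^sup>+s\<in>{b..b * exp (r + 1)}. ennreal (1 / s) \<partial>lborel)"
    using b r(1) by (intro nn_integral_FTC_Icc[symmetric]) (auto intro!: derivative_eq_intros)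
  also have "\<dots> \<le> ?I"
  proof (intro nn_integral_mono)
    fix s :: real
    have "1 / s \<le> s powr (k - 1)" if "b \<le> s"
    proof -
      have "s powr (- 1) \<le> s powr (k - 1)" using that b assms by (intro powr_mono) auto
      then show ?thesis using that b by (simp add: powr_minus_divide)
    qed
    then show "ennreal (1 / s) * indicator {b..b * exp (r + 1)} s
      \<le> ennreal (s powr (k - 1)) * indicator {a..} s"
      using b by (auto split: split_indicator intro: ennreal_leI)
  qed
  finally have "ennreal (r + 1) \<le> ennreal r" using r b by (simp add: ln_mult)
  then show False using r by simp
qed

text \<open>Raise \<open>y / a \<le> exp (y / a)\<close> to the power \<open>a\<close>. This trades
  exponential decay for polynomial decay of any chosen order, with an explicit constant.\<close>

lemma powr_mult_exp_minus_le:
  fixes a y :: real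
  assumes "0 < a" "0 < y"
  shows "exp (- y) \<le> a powr a * y powr (- a)"
proof -
  have "y / a \<le> exp (y / a)" using exp_ge_add_one_self[of "y / a"] by linarith
  then have "(y / a) powr a \<le> exp (y / a) powr a" using assms by (intro powr_mono2) auto
  then have "y powr a / a powr a \<le> exp y" using assms by (simp add: powr_divide exp_powr_real)
  then show ?thesis using assms by (simp add: powr_minus exp_minus divide_simps mult.commute)
qed

text \<open>The total mass of the unnormalised inverse gamma density with shape \<open>k\<close> and
  scale \<open>q\<close>. For positive \<open>k\<close> and \<open>q\<close> the substitution
  \<open>u = q / s\<close> shows that it is the Gamma function at \<open>k\<close> times
  \<open>q powr - k\<close>; two-sided bounds of this order take the place of the exact
  value.\<close>

definition inverse_gamma_integral :: "real \<Rightarrow> real \<Rightarrow> ennreal" where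
  "inverse_gamma_integral k q = (\<integral>\<^sup>+s\<in>{0<..}. ennreal (s powr (- k - 1) * exp (- q / s)) \<partial>lborel)"

text \<open>For \<open>s \<ge> q\<close> the exponential factor is at least
  \<open>exp (- 1)\<close>. The bound yields the lower estimate for positive \<open>k\<close> and
  the divergence for \<open>k \<le> 0\<close>.\<close>

lemma inverse_gamma_integral_ge:
  assumes "0 < q"
  shows "ennreal (exp (- 1)) * (\<integral>\<^sup>+s\<in>{q..}. ennreal (s powr (- k - 1)) \<partial>lborel) \<le> inverse_gamma_integral k q"
proof -
  have "(\<integral>\<^sup>+s\<in>{q..}. ennreal (exp (- 1)) * ennreal (s powr (- k - 1)) \<partial>lborel) \<le> inverse_gamma_integral k q"
    unfolding inverse_gamma_integral_def using assms
    by (intro nn_set_integral_mono)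
      (auto simp: mult.commute[of "exp _"] simp flip: ennreal_mult' intro!: ennreal_leI mult_left_mono)
  then show ?thesis by (simp add: nn_set_integral_cmult)
qed

lemma inverse_gamma_integral_lower:
  assumes "0 < k" "0 < q"
  shows "ennreal (exp (- 1) / k * q powr - k) \<le> inverse_gamma_integral k q"
  using inverse_gamma_integral_ge[of q k] assms
  by (simp add: nn_integral_powr_at_top flip: ennreal_mult')

lemma inverse_gamma_integral_eq_infinity:
  assumes "k \<le> 0" "0 < q"
  shows "inverse_gamma_integral k q = \<infinity>"
  using inverse_gamma_integral_ge[of q k] assms nn_integral_powr_at_top_eq_infinity[of "- k" q]
  by (simp add: ennreal_mult_top top_unique)

lemma inverse_gamma_integral_upper:
  assumes "0 < k" "0 < q"
  shows "inverse_gamma_integral k q \<le> ennreal (((k + 1) powr (k + 1) + 1 / k) * q powr - k)"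
proof -
  \<comment> \<open>A bound for the integrand on \<open>{0<..q}\<close>: the estimate of the
    exponential with exponent \<open>k + 1\<close> cancels \<open>s powr (- k - 1)\<close> exactly.
    Beyond \<open>q\<close> the exponential is simply dropped.\<close>
  define c where "c = (k + 1) powr (k + 1) * q powr (- k - 1)"
  have "inverse_gamma_integral k q
    \<le> (\<integral>\<^sup>+s. ennreal c * indicator {0..q} s + ennreal (s powr (- k - 1)) * indicator {q..} s \<partial>lborel)"
    unfolding inverse_gamma_integral_def
  proof (intro nn_integral_mono)
    fix s :: real
    have 1: "s powr (- k - 1) * exp (- q / s) \<le> c" if "0 < s"
    proof -
      have "s powr (- k - 1) * exp (- (q / s))
          \<le> s powr (- k - 1) * ((k + 1) powr (k + 1) * (q / s) powr (- (k + 1)))"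
        using that assms by (intro mult_left_mono powr_mult_exp_minus_le) auto
      also have "\<dots> = c"
        using that assms by (simp add: c_def powr_divide)
      finally show ?thesis by simp
    qed
    have 2: "s powr (- k - 1) * exp (- q / s) \<le> s powr (- k - 1)" if "0 < s"
      using that assms by (simp add: mult_left_le)
    show "ennreal (s powr (- k - 1) * exp (- q / s)) * indicator {0<..} s
      \<le> ennreal c * indicator {0..q} s + ennreal (s powr (- k - 1)) * indicator {q..} s"
      using 1 2 assms
      by (auto split: split_indicator intro!: ennreal_leI simp: not_le intro: add_increasing2)
  qed
  also have "\<dots> = ennreal (c * q) + ennreal (q powr - k / k)"
    using assms by (simp add: nn_integral_add nn_integral_cmult nn_integral_powr_at_top c_def flip: ennreal_mult')
  also have "\<dots> = ennreal (c * q + q powr - k / k)"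
    using assms by (simp add: c_def)
  also have "c * q + q powr - k / k = ((k + 1) powr (k + 1) + 1 / k) * q powr - k"
    using assms by (simp add: c_def powr_diff field_simps)
  finally show ?thesis .
qed

text \<open>Variance \<open>2 * s\<close> in each coordinate makes the characteristic function equal
  to \<open>exp (- s * (norm x)\<^sup>2)\<close>. The product form lets integrals factor over
  \<open>Basis\<close>.\<close>

definition gauss_density :: "real \<Rightarrow> 'a::euclidean_space \<Rightarrow> real" where
  "gauss_density s x = (\<Prod>b\<in>Basis. normal_density 0 (sqrt (2 * s)) (x \<bullet> b))"

lemma gauss_density_nonneg: "0 \<le> gauss_density s x"
  by (simp add: gauss_density_def prod_nonneg)

lemma borel_measurable_gauss_density [measurable (raw)]:
  fixes g :: "'b \<Rightarrow> 'a::euclidean_space"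
  assumes [measurable]: "f \<in> borel_measurable N" "g \<in> borel_measurable N"
  shows "(\<lambda>x. gauss_density (f x) (g x)) \<in> borel_measurable N"
  unfolding gauss_density_def normal_density_def by measurable

lemma gauss_density_eq:
  fixes x :: "'a::euclidean_space"
  assumes "0 < s"
  shows "gauss_density s x = (4 * pi * s) powr - (DIM('a) / 2) * exp (- (norm x)\<^sup>2 / (4 * s))"
proof -
  have "gauss_density s x = (\<Prod>b\<in>(Basis::'a set). (4 * pi * s) powr (- 1 / 2) * exp (- (x \<bullet> b)\<^sup>2 / (4 * s)))"
  proof -
    have "1 / sqrt (4 * pi * s) = (4 * pi * s) powr (- 1 / 2)"
      using assms powr_half_sqrt[of "4 * pi * s"] by (simp add: powr_minus_divide)
    then show ?thesis
      unfolding gauss_density_def normal_density_def using assms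
      by (intro prod.cong) (auto simp: mult_ac)
  qed
  also have "\<dots> = ((4 * pi * s) powr (- 1 / 2)) ^ DIM('a) * exp (\<Sum>b\<in>(Basis::'a set). - (x \<bullet> b)\<^sup>2 / (4 * s))"
    by (simp add: prod.distrib exp_sum)
  also have "((4 * pi * s) powr (- 1 / 2)) ^ DIM('a) = (4 * pi * s) powr - (DIM('a) / 2)"
    using assms by (simp add: powr_powr flip: powr_realpow)
  also have "(\<Sum>b\<in>(Basis::'a set). - (x \<bullet> b)\<^sup>2 / (4 * s)) = - (norm x)\<^sup>2 / (4 * s)"
    by (simp add: power2_norm_eq_inner euclidean_inner[of x x] sum_negf flip: sum_divide_distrib power2_eq_square)
  finally show ?thesis .
qed

lemma nn_integral_gauss_density:
  assumes "0 < s"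
  shows "(\<integral>\<^sup>+x. ennreal (gauss_density s x) \<partial>(lborel :: 'a::euclidean_space measure)) = 1"
proof -
  interpret prob_space "density lborel (normal_density 0 (sqrt (2 * s)))"
    using assms by (intro prob_space_normal_density) auto
  have 1: "(\<integral>\<^sup>+x. ennreal (normal_density 0 (sqrt (2 * s)) x) \<partial>lborel) = 1"
    using emeasure_space_1 by (simp add: emeasure_density)
  show ?thesis
    by (simp only: gauss_density_def prod_ennreal[symmetric] normal_density_nonneg)
      (subst nn_integral_lborel_prod; simp add: 1)
qed

lemma prob_space_gauss:
  assumes "0 < s"
  shows "prob_space (density lborel (gauss_density s :: 'a::euclidean_space \<Rightarrow> real))"
  by (rule prob_spaceI) (simp add: emeasure_density nn_integral_gauss_density assms)

lemma normal_density_char: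
  assumes "0 < c"
  shows "(\<integral>x. complex_of_real (normal_density 0 c x) * iexp (t * x) \<partial>lborel)
       = complex_of_real (exp (- (c * t)\<^sup>2 / 2))" (is "?L = ?R")
    and "integrable lborel (\<lambda>x. complex_of_real (normal_density 0 c x) * iexp (t * x))"
proof -
  have "?L = c *\<^sub>R (\<integral>x. complex_of_real (normal_density 0 c (0 + c * x)) * iexp (t * (0 + c * x)) \<partial>lborel)"
    using lborel_integral_real_affine[of c "\<lambda>x. complex_of_real (normal_density 0 c x) * iexp (t * x)" 0] assms by simp
  also have "\<dots> = (\<integral>x. c *\<^sub>R (complex_of_real (normal_density 0 c (0 + c * x)) * iexp (t * (0 + c * x))) \<partial>lborel)"
    by simp
  also have "\<dots> = (\<integral>x. std_normal_density x *\<^sub>R iexp ((c * t) * x) \<partial>lborel)"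
  proof (intro Bochner_Integration.integral_cong refl)
    fix x
    have "c * normal_density 0 c (c * x) = std_normal_density x"
      using assms by (simp add: normal_density_def real_sqrt_mult power_mult_distrib)
    then show "c *\<^sub>R (complex_of_real (normal_density 0 c (0 + c * x)) * iexp (t * (0 + c * x)))
      = std_normal_density x *\<^sub>R iexp ((c * t) * x)"
      by (simp add: scaleR_conv_of_real mult_ac flip: of_real_mult)
  qed
  also have "\<dots> = (\<integral>x. iexp ((c * t) * x) \<partial>std_normal_distribution)"
    by (subst integral_density) auto
  also have "\<dots> = ?R"
    using fun_cong[OF char_std_normal_distribution, of "c * t"] by (simp add: char_def)
  finally show "?L = ?R" .
  show "integrable lborel (\<lambda>x. complex_of_real (normal_density 0 c x) * iexp (t * x))"
    by (rule Bochner_Integration.integrable_bound[OF integrable_normal_density[OF assms]])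
      (auto simp: norm_mult)
qed

lemma gauss_char:
  fixes x :: "'a::euclidean_space"
  assumes "0 < s"
  shows "(\<integral>\<xi>. iexp (\<xi> \<bullet> x) \<partial>density lborel (gauss_density s :: 'a \<Rightarrow> real))
       = complex_of_real (exp (- s * (norm x)\<^sup>2))"
proof -
  let ?g = "\<lambda>b y. complex_of_real (normal_density 0 (sqrt (2 * s)) y) * iexp ((x \<bullet> b) * y)"
  interpret product_sigma_finite "\<lambda>_. lborel :: real measure" ..
  have "(\<integral>\<xi>. iexp (\<xi> \<bullet> x) \<partial>density lborel (gauss_density s :: 'a \<Rightarrow> real))
      = (\<integral>\<xi>. gauss_density s \<xi> *\<^sub>R iexp (\<xi> \<bullet> x) \<partial>lborel)"
    by (intro integral_density) (auto simp: gauss_density_nonneg)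
  also have "\<dots> = (\<integral>\<xi>. (\<Prod>b\<in>Basis. ?g b (\<xi> \<bullet> b)) \<partial>lborel)"
    unfolding gauss_density_def
    by (intro Bochner_Integration.integral_cong refl)
      (simp add: prod.distrib scaleR_conv_of_real euclidean_inner[of _ x] sum_distrib_left mult.commute flip: exp_sum)
  also have "\<dots> = (\<integral>f. (\<Prod>b\<in>Basis. ?g b ((\<Sum>b\<in>Basis. f b *\<^sub>R b) \<bullet> b)) \<partial>(\<Pi>\<^sub>M b\<in>(Basis::'a set). lborel))"
    by (subst lborel_eq, subst integral_distr) auto
  also have "\<dots> = (\<integral>f. (\<Prod>b\<in>Basis. ?g b (f b)) \<partial>(\<Pi>\<^sub>M b\<in>(Basis::'a set). lborel))"
    by (intro Bochner_Integration.integral_cong prod.cong refl) simp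
  also have "\<dots> = (\<Prod>b\<in>(Basis::'a set). \<integral>y. ?g b y \<partial>lborel)"
    using assms by (intro product_integral_prod normal_density_char(2)) auto
  also have "\<dots> = (\<Prod>b\<in>(Basis::'a set). complex_of_real (exp (- s * (x \<bullet> b)\<^sup>2)))"
    using assms by (intro prod.cong refl) (subst normal_density_char(1), auto simp: power_mult_distrib)
  also have "\<dots> = complex_of_real (exp (\<Sum>b\<in>(Basis::'a set). - s * (x \<bullet> b)\<^sup>2))"
    by (simp add: exp_sum)
  also have "(\<Sum>b\<in>(Basis::'a set). - s * (x \<bullet> b)\<^sup>2) = - s * (norm x)\<^sup>2"
    by (simp only: norm_eq_sqrt_inner euclidean_inner[of x x] power2_eq_square sum_distrib_left) (simp add: sum_nonneg sum_distrib_left)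
  finally show ?thesis .
qed

section \<open>Mixtures of Gaussian densities\<close>

lemma square_div_4_powr:
  fixes x k :: real
  assumes "0 < x"
  shows "(x\<^sup>2 / 4) powr - k = 4 powr k / x powr (2 * k)"
  using assms by (simp add: powr_divide powr_minus powr_powr divide_simps flip: powr_numeral)

lemma powr_mult_powr_eq:
  fixes s a b c :: real
  assumes "a + b = c"
  shows "s powr a * s powr b = s powr c"
  using assms by (simp flip: powr_add)

text \<open>The weight \<open>s powr (\<gamma> / 2 - 1)\<close> is the one that mixes the functions
  \<open>exp (- s * (norm x)\<^sup>2)\<close> into a multiple of
  \<open>norm x powr - \<gamma>\<close> when \<open>\<gamma> > 0\<close>. Applied to their Fourier
  counterparts, the Gaussian densities, it produces the dual kernel.\<close>

lemma gauss_density_mixture: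
  fixes \<xi> :: "'a::euclidean_space"
  defines "n \<equiv> real DIM('a)"
  shows "(\<integral>\<^sup>+s\<in>{0<..}. ennreal (s powr (\<gamma> / 2 - 1) * gauss_density s \<xi>) \<partial>lborel)
    = ennreal ((4 * pi) powr - (n / 2)) * inverse_gamma_integral ((n - \<gamma>) / 2) ((norm \<xi>)\<^sup>2 / 4)"
proof -
  have "s powr (\<gamma> / 2 - 1) * gauss_density s \<xi> =
    (4 * pi) powr - (n / 2) * (s powr (- ((n - \<gamma>) / 2) - 1) * exp (- ((norm \<xi>)\<^sup>2 / 4) / s))" if "0 < s" for s
  proof -
    have "s powr (\<gamma> / 2 - 1) * s powr - (n / 2) = s powr (- ((n - \<gamma>) / 2) - 1)"
      by (rule powr_mult_powr_eq) (simp add: field_simps)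
    then show ?thesis
      using that by (simp add: gauss_density_eq n_def powr_mult mult_ac)
  qed
  then have "(\<integral>\<^sup>+s\<in>{0<..}. ennreal (s powr (\<gamma> / 2 - 1) * gauss_density s \<xi>) \<partial>lborel)
    = (\<integral>\<^sup>+s\<in>{0<..}. ennreal ((4 * pi) powr - (n / 2))
        * ennreal (s powr (- ((n - \<gamma>) / 2) - 1) * exp (- ((norm \<xi>)\<^sup>2 / 4) / s)) \<partial>lborel)"
    by (intro nn_set_integral_cong) (simp flip: ennreal_mult')
  then show ?thesis
    unfolding inverse_gamma_integral_def by (simp add: nn_set_integral_cmult)
qed

lemma borel_measurable_inverse_gamma_integral [measurable]:
  "inverse_gamma_integral k \<in> borel_measurable borel"
  unfolding inverse_gamma_integral_def by measurable

text \<open>Local integrability of the Riesz kernel. After exchanging the integrals, for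
  \<open>s < 1\<close> the Gaussian has total mass 1 and leaves
  \<open>s powr (\<gamma> / 2 - 1)\<close>, integrable at 0 since \<open>\<gamma> > 0\<close>; for
  \<open>s \<ge> 1\<close> the exponential is dropped and \<open>s powr (- k - 1)\<close> is
  integrable since \<open>k > 0\<close>.\<close>

lemma nn_integral_inverse_gamma_integral_ball:
  fixes \<gamma> :: real
  defines "n \<equiv> real DIM('a)"
  assumes "0 < \<gamma>" "\<gamma> < n"
  shows "(\<integral>\<^sup>+\<xi>\<in>{\<xi>. norm \<xi> < 1}. inverse_gamma_integral ((n - \<gamma>) / 2) ((norm \<xi>)\<^sup>2 / 4)
    \<partial>(lborel :: 'a::euclidean_space measure)) < \<infinity>"
proof -
  define k where "k = (n - \<gamma>) / 2"
  have k: "0 < k" using assms by (simp add: k_def)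
  have vol: "emeasure lborel ({\<xi>::'a. norm \<xi> < 1}) < \<infinity>" 
    using emeasure_lborel_ball_finite[of "0::'a" 1] by (simp add: ball_def)
  have "(\<integral>\<^sup>+\<xi>\<in>{\<xi>::'a. norm \<xi> < 1}. inverse_gamma_integral k ((norm \<xi>)\<^sup>2 / 4) \<partial>lborel)
    = (\<integral>\<^sup>+\<xi>. (\<integral>\<^sup>+s. ennreal (s powr (- k - 1) * exp (- ((norm \<xi>)\<^sup>2 / 4) / s)) * indicator {0<..} s
         * indicator ({\<xi>::'a. norm \<xi> < 1}) \<xi> \<partial>lborel) \<partial>lborel)"
    unfolding inverse_gamma_integral_def
    by (intro nn_integral_cong nn_integral_multc[symmetric]) simp
  also have "\<dots> = (\<integral>\<^sup>+s. (\<integral>\<^sup>+\<xi>. ennreal (s powr (- k - 1) * exp (- ((norm \<xi>)\<^sup>2 / 4) / s)) * indicator {0<..} s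
         * indicator ({\<xi>::'a. norm \<xi> < 1}) \<xi> \<partial>lborel) \<partial>lborel)"
    by (intro lborel_pair.Fubini') measurable
  also have "\<dots> \<le> (\<integral>\<^sup>+s. ennreal ((4 * pi) powr (n / 2)) * (ennreal (s powr (\<gamma> / 2 - 1)) * indicator {0<..1} s)
      + emeasure lborel ({\<xi>::'a. norm \<xi> < 1}) * (ennreal (s powr (- k - 1)) * indicator {1..} s) \<partial>lborel)"
  proof (intro nn_integral_mono)
    fix s :: real
    show "(\<integral>\<^sup>+\<xi>. ennreal (s powr (- k - 1) * exp (- ((norm \<xi>)\<^sup>2 / 4) / s)) * indicator {0<..} s
         * indicator ({\<xi>::'a. norm \<xi> < 1}) \<xi> \<partial>lborel)
      \<le> ennreal ((4 * pi) powr (n / 2)) * (ennreal (s powr (\<gamma> / 2 - 1)) * indicator {0<..1} s)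
      + emeasure lborel ({\<xi>::'a. norm \<xi> < 1}) * (ennreal (s powr (- k - 1)) * indicator {1..} s)" (is "?L \<le> ?A + ?B")
    proof -
      consider "s \<le> 0" | "0 < s" "s < 1" | "1 \<le> s" by linarith
      then show ?thesis
      proof cases
        case 2
        have eq: "s powr (- k - 1) * exp (- ((norm \<xi>)\<^sup>2 / 4) / s)
          = (4 * pi) powr (n / 2) * s powr (\<gamma> / 2 - 1) * gauss_density s \<xi>" for \<xi> :: 'a
        proof -
          have "s powr (\<gamma> / 2 - 1) * s powr - (n / 2) = s powr (- k - 1)"
            by (rule powr_mult_powr_eq) (simp add: k_def field_simps)
          then show ?thesis
            using 2 by (simp add: gauss_density_eq n_def powr_mult powr_minus field_simps)
        qed
        have "?L \<le> (\<integral>\<^sup>+\<xi>. ennreal ((4 * pi) powr (n / 2) * s powr (\<gamma> / 2 - 1)) * ennreal (gauss_density s (\<xi>::'a)) \<partial>lborel)"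
          by (intro nn_integral_mono) (auto split: split_indicator simp flip: eq ennreal_mult')
        also have "\<dots> = ennreal ((4 * pi) powr (n / 2) * s powr (\<gamma> / 2 - 1))"
          using 2 by (simp add: nn_integral_cmult nn_integral_gauss_density)
        also have "\<dots> = ?A" using 2 by (simp add: ennreal_mult')
        finally show ?thesis by (rule add_increasing2[rotated]) simp
      next
        case 3
        have "?L \<le> (\<integral>\<^sup>+\<xi>. ennreal (s powr (- k - 1)) * indicator ({\<xi>::'a. norm \<xi> < 1}) \<xi> \<partial>lborel)"
          using 3 by (intro nn_integral_mono) (auto split: split_indicator intro!: ennreal_leI mult_left_le)
        also have "\<dots> = ?B" using 3 by (simp add: nn_integral_cmult mult.commute)
        finally show ?thesis by (rule add_increasing[rotated]) simp
      qed simp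
    qed
  qed
  also have "\<dots> = ennreal ((4 * pi) powr (n / 2)) * ennreal (1 / (\<gamma> / 2)) + emeasure lborel ({\<xi>::'a. norm \<xi> < 1}) * ennreal (1 / k)"
    using nn_integral_powr_at_zero[of "\<gamma> / 2" 1] nn_integral_powr_at_top[of k 1] assms k
    by (simp add: nn_integral_add nn_integral_cmult)
  also have "\<dots> < \<infinity>" using vol by (simp add: ennreal_mult_less_top)
  finally show ?thesis unfolding k_def .
qed

text \<open>
  Both sides are integrals of \<open>v\<close> against a Riesz kernel: the mixture of the Gaussian densities
  over \<open>s\<close> is a multiple of \<open>\<parallel>\<xi>\<parallel> powr (\<gamma> - n)\<close>.
\<close>

theorem gauss_mixture_finite_iff:
  fixes v :: "'a::euclidean_space \<Rightarrow> real"
  defines "n \<equiv> real DIM('a)"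
  assumes [measurable]: "v \<in> borel_measurable borel"
    and v: "\<And>\<xi>. 0 < v \<xi>" "\<And>\<xi>. v \<xi> \<le> 1"
    and f: "\<And>s. 0 < s \<Longrightarrow> f s = (\<integral>\<^sup>+\<xi>. ennreal (gauss_density s \<xi> * v \<xi>) \<partial>lborel)"
    and "0 < \<gamma>"
  shows "(\<integral>\<^sup>+s\<in>{0<..}. ennreal (s powr (\<gamma> / 2 - 1)) * f s \<partial>lborel) < \<infinity> \<longleftrightarrow>
    \<gamma> < n \<and> (\<integral>\<^sup>+\<xi>\<in>{\<xi>. 1 \<le> norm \<xi>}. ennreal (v \<xi> / norm \<xi> powr (n - \<gamma>)) \<partial>lborel) < \<infinity>"
proof -
  define k where "k = (n - \<gamma>) / 2"
  define c where "c = (4 * pi) powr - (n / 2)"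
  have c: "0 < c" by (simp add: c_def)
  let ?h = "\<lambda>\<xi>::'a. inverse_gamma_integral k ((norm \<xi>)\<^sup>2 / 4)"
  have "(\<integral>\<^sup>+s\<in>{0<..}. ennreal (s powr (\<gamma> / 2 - 1)) * f s \<partial>lborel)
    = (\<integral>\<^sup>+s. (\<integral>\<^sup>+\<xi>. ennreal (s powr (\<gamma> / 2 - 1) * gauss_density s \<xi>) * indicator {0<..} s * ennreal (v \<xi>) \<partial>lborel) \<partial>lborel)"
  proof (intro nn_integral_cong)
    fix s :: real
    show "ennreal (s powr (\<gamma> / 2 - 1)) * f s * indicator {0<..} s
      = (\<integral>\<^sup>+\<xi>. ennreal (s powr (\<gamma> / 2 - 1) * gauss_density s \<xi>) * indicator {0<..} s * ennreal (v \<xi>) \<partial>lborel)"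
      by (cases "0 < s")
        (auto simp: f ennreal_mult' ennreal_mult'' gauss_density_nonneg less_imp_le[OF v(1)] nn_integral_cmult mult.assoc)
  qed
  also have "\<dots> = (\<integral>\<^sup>+\<xi>. (\<integral>\<^sup>+s. ennreal (s powr (\<gamma> / 2 - 1) * gauss_density s \<xi>) * indicator {0<..} s * ennreal (v \<xi>) \<partial>lborel) \<partial>lborel)"
    by (intro lborel_pair.Fubini') measurable
  also have "\<dots> = (\<integral>\<^sup>+\<xi>. ennreal c * (?h \<xi> * ennreal (v \<xi>)) \<partial>lborel)"
    by (intro nn_integral_cong, subst nn_integral_multc)
      (auto simp: gauss_density_mixture c_def k_def n_def mult.assoc)
  also have "\<dots> = ennreal c * (\<integral>\<^sup>+\<xi>. ?h \<xi> * ennreal (v \<xi>) \<partial>lborel)"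
    by (rule nn_integral_cmult) measurable
  finally have J: "(\<integral>\<^sup>+s\<in>{0<..}. ennreal (s powr (\<gamma> / 2 - 1)) * f s \<partial>lborel) < \<infinity>
      \<longleftrightarrow> (\<integral>\<^sup>+\<xi>. ?h \<xi> * ennreal (v \<xi>) \<partial>lborel) < \<infinity>"
    using c by (simp add: ennreal_mult_less_top) (metis ennreal_zero_less_top)
  let ?I = "\<integral>\<^sup>+\<xi>\<in>{\<xi>. 1 \<le> norm \<xi>}. ennreal (v \<xi> / norm \<xi> powr (n - \<gamma>)) \<partial>lborel"
  show ?thesis
  proof (cases "\<gamma> < n")
    case False
    \<comment> \<open>For \<open>\<gamma> \<ge> n\<close> the mixture is infinite away from the
      origin; as \<open>v\<close> is positive, the integral diverges whatever \<open>v\<close>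
      is.\<close>
    have "(\<integral>\<^sup>+\<xi>. ?h \<xi> * ennreal (v \<xi>) \<partial>lborel) = (\<integral>\<^sup>+\<xi>. \<infinity> \<partial>(lborel :: 'a measure))"
    proof (rule nn_integral_cong_AE)
      show "AE \<xi> in lborel. ?h \<xi> * ennreal (v \<xi>) = \<infinity>"
        using AE_lborel_singleton[of "0::'a"]
      proof eventually_elim
        case (elim \<xi>)
        then have "?h \<xi> = \<infinity>"
          using False by (intro inverse_gamma_integral_eq_infinity) (auto simp: k_def)
        then show ?case using v(1)[of \<xi>] by (simp add: ennreal_top_mult)
      qed
    qed
    then show ?thesis using False J by simp
  next
    case True
    then have k: "0 < k" by (simp add: k_def)
    define a where "a = exp (- 1) / k * 4 powr k"
    define b where "b = ((k + 1) powr (k + 1) + 1 / k) * 4 powr k"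
    have a: "0 < a" using k by (simp add: a_def)
    have q: "((norm \<xi>)\<^sup>2 / 4) powr - k = 4 powr k / norm \<xi> powr (n - \<gamma>)" if "\<xi> \<noteq> 0" for \<xi> :: 'a
    proof -
      have "2 * k = n - \<gamma>" by (simp add: k_def)
      then show ?thesis using square_div_4_powr[of "norm \<xi>" k] that by simp
    qed
    have lower: "ennreal a * ?I \<le> (\<integral>\<^sup>+\<xi>. ?h \<xi> * ennreal (v \<xi>) \<partial>lborel)"
    proof -
      have "ennreal a * ?I = (\<integral>\<^sup>+\<xi>\<in>{\<xi>. 1 \<le> norm \<xi>}. ennreal a * ennreal (v \<xi> / norm \<xi> powr (n - \<gamma>)) \<partial>lborel)"
        by (rule nn_set_integral_cmult[symmetric]) measurable
      also have "\<dots> \<le> (\<integral>\<^sup>+\<xi>\<in>UNIV. ?h \<xi> * ennreal (v \<xi>) \<partial>lborel)"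
      proof (rule nn_set_integral_mono)
        fix \<xi> :: 'a assume "\<xi> \<in> {\<xi>. 1 \<le> norm \<xi>}"
        then have nz: "\<xi> \<noteq> 0" by auto
        have "ennreal a * ennreal (v \<xi> / norm \<xi> powr (n - \<gamma>))
          = ennreal (exp (- 1) / k * ((norm \<xi>)\<^sup>2 / 4) powr - k) * ennreal (v \<xi>)"
          using a k less_imp_le[OF v(1)] by (simp add: q[OF nz] a_def flip: ennreal_mult')
        also have "\<dots> \<le> ?h \<xi> * ennreal (v \<xi>)"
          using nz by (intro mult_right_mono inverse_gamma_integral_lower k) auto
        finally show "ennreal a * ennreal (v \<xi> / norm \<xi> powr (n - \<gamma>)) \<le> ?h \<xi> * ennreal (v \<xi>)" .
      qed simp
      finally show ?thesis by simp
    qed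
    \<comment> \<open>The condition on \<open>v\<close> sees only \<open>norm \<xi> \<ge> 1\<close>.
      In the unit ball \<open>v \<le> 1\<close> and the kernel is integrable, so that part is always
      finite.\<close>
    have upper: "(\<integral>\<^sup>+\<xi>. ?h \<xi> * ennreal (v \<xi>) \<partial>lborel) \<le>
      (\<integral>\<^sup>+\<xi>\<in>{\<xi>. norm \<xi> < 1}. ?h \<xi> \<partial>lborel) + ennreal b * ?I"
    proof -
      have "(\<integral>\<^sup>+\<xi>. ?h \<xi> * ennreal (v \<xi>) \<partial>lborel) \<le>
        (\<integral>\<^sup>+\<xi>. ?h \<xi> * indicator ({\<xi>. norm \<xi> < 1}) \<xi> +
          ennreal b * (ennreal (v \<xi> / norm \<xi> powr (n - \<gamma>)) * indicator {\<xi>. 1 \<le> norm \<xi>} \<xi>) \<partial>lborel)"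
      proof (intro nn_integral_mono)
        fix \<xi> :: 'a
        show "?h \<xi> * ennreal (v \<xi>) \<le> ?h \<xi> * indicator ({\<xi>. norm \<xi> < 1}) \<xi> +
          ennreal b * (ennreal (v \<xi> / norm \<xi> powr (n - \<gamma>)) * indicator {\<xi>. 1 \<le> norm \<xi>} \<xi>)"
        proof (cases "1 \<le> norm \<xi>")
          case True
          then have nz: "\<xi> \<noteq> 0" by auto
          have "?h \<xi> * ennreal (v \<xi>)
            \<le> ennreal (((k + 1) powr (k + 1) + 1 / k) * ((norm \<xi>)\<^sup>2 / 4) powr - k) * ennreal (v \<xi>)"
            using nz by (intro mult_right_mono inverse_gamma_integral_upper k) auto
          also have "\<dots> = ennreal b * ennreal (v \<xi> / norm \<xi> powr (n - \<gamma>))"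
            using k less_imp_le[OF v(1)] by (simp add: q[OF nz] b_def flip: ennreal_mult')
          finally show ?thesis using True by simp
        next
          case False
          have "?h \<xi> * ennreal (v \<xi>) \<le> ?h \<xi> * 1"
            using v(2)[of \<xi>] by (intro mult_left_mono) (auto simp: ennreal_le_1)
          then show ?thesis using False by simp
        qed
      qed
      also have "\<dots> = (\<integral>\<^sup>+\<xi>\<in>{\<xi>. norm \<xi> < 1}. ?h \<xi> \<partial>lborel) + ennreal b * ?I"
        by (simp add: nn_integral_add nn_integral_cmult)
      finally show ?thesis .
    qed
    have ball: "(\<integral>\<^sup>+\<xi>\<in>{\<xi>::'a. norm \<xi> < 1}. ?h \<xi> \<partial>lborel) < \<infinity>"
      using nn_integral_inverse_gamma_integral_ball[of \<gamma>, where 'a='a] assms(6) True by (simp add: k_def n_def)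
    show ?thesis
    proof
      assume "(\<integral>\<^sup>+s\<in>{0<..}. ennreal (s powr (\<gamma> / 2 - 1)) * f s \<partial>lborel) < \<infinity>"
      then have "ennreal a * ?I < \<infinity>" using J lower by (auto intro: le_less_trans)
      then show "\<gamma> < n \<and> ?I < \<infinity>" using a True by (auto simp: ennreal_mult_less_top)
    next
      assume "\<gamma> < n \<and> ?I < \<infinity>"
      then have "(\<integral>\<^sup>+\<xi>\<in>{\<xi>. norm \<xi> < 1}. ?h \<xi> \<partial>lborel) + ennreal b * ?I < \<infinity>"
        using ball by (simp add: ennreal_mult_less_top)
      then show "(\<integral>\<^sup>+s\<in>{0<..}. ennreal (s powr (\<gamma> / 2 - 1)) * f s \<partial>lborel) < \<infinity>"
        using upper J by (auto intro: le_less_trans)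
    qed
  qed
qed

text \<open>Places every negative exponent in the set whose supremum is the dimension, so that this
  set is nonempty and its supremum nonnegative.\<close>

lemma nn_integral_norm_powr_outside_ball:
  fixes \<gamma> :: real
  defines "n \<equiv> real DIM('a)"
  assumes "\<gamma> < 0"
  shows "(\<integral>\<^sup>+\<xi>\<in>{\<xi>. 1 \<le> norm \<xi>}. ennreal (1 / norm \<xi> powr (n - \<gamma>)) \<partial>(lborel :: 'a::euclidean_space measure)) < \<infinity>"
proof -
  define k where "k = (n - \<gamma>) / 2"
  have k: "0 < k" using assms by (simp add: k_def n_def)
  define a where "a = exp (- 1) / k * 4 powr k"
  have a: "0 < a" using k by (simp add: a_def)
  \<comment> \<open>The cut-off \<open>1/4\<close> is the least value of
    \<open>(norm \<xi>)\<^sup>2 / 4\<close> on the domain. It removes the neighbourhood of 0, where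
    \<open>s powr (\<gamma> / 2 - 1)\<close> is not integrable for negative
    \<open>\<gamma>\<close>.\<close>
  let ?g = "\<lambda>s (\<xi>::'a). ennreal ((4 * pi) powr (n / 2) * s powr (\<gamma> / 2 - 1) * gauss_density s \<xi>) * indicator {1/4..} s"
  have "ennreal a * (\<integral>\<^sup>+\<xi>\<in>{\<xi>. 1 \<le> norm \<xi>}. ennreal (1 / norm \<xi> powr (n - \<gamma>)) \<partial>(lborel :: 'a measure))
      = (\<integral>\<^sup>+\<xi>\<in>{\<xi>. 1 \<le> norm \<xi>}. ennreal a * ennreal (1 / norm \<xi> powr (n - \<gamma>)) \<partial>(lborel :: 'a measure))"
    by (rule nn_set_integral_cmult[symmetric]) measurable
  also have "\<dots> \<le> (\<integral>\<^sup>+\<xi>\<in>UNIV. (\<integral>\<^sup>+s. ?g s \<xi> \<partial>lborel) \<partial>(lborel :: 'a measure))"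
  proof (rule nn_set_integral_mono)
    fix \<xi> :: 'a assume \<xi>: "\<xi> \<in> {\<xi>. 1 \<le> norm \<xi>}"
    define q where "q = (norm \<xi>)\<^sup>2 / 4"
    have q: "1 / 4 \<le> q" using \<xi> by (simp add: q_def)
    have "2 * k = n - \<gamma>" by (simp add: k_def)
    then have qk: "q powr - k = 4 powr k / norm \<xi> powr (n - \<gamma>)"
      using square_div_4_powr[of "norm \<xi>" k] \<xi> by (cases "\<xi> = 0") (auto simp: q_def)
    have "ennreal a * ennreal (1 / norm \<xi> powr (n - \<gamma>)) = ennreal (exp (- 1)) * ennreal (q powr - k / k)"
      using k a by (simp add: qk a_def flip: ennreal_mult')
    also have "\<dots> = (\<integral>\<^sup>+s\<in>{q..}. ennreal (exp (- 1)) * ennreal (s powr (- k - 1)) \<partial>lborel)"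
      using q k by (simp add: nn_set_integral_cmult nn_integral_powr_at_top)
    also have "\<dots> \<le> (\<integral>\<^sup>+s. ?g s \<xi> \<partial>lborel)"
    proof (rule nn_set_integral_mono)
      fix s :: real assume s': "s \<in> {q..}"
      then have s: "0 < s" using q by auto
      have "s powr (\<gamma> / 2 - 1) * s powr - (n / 2) = s powr (- k - 1)"
        by (rule powr_mult_powr_eq) (simp add: k_def field_simps)
      then have "(4 * pi) powr (n / 2) * s powr (\<gamma> / 2 - 1) * gauss_density s \<xi> = s powr (- k - 1) * exp (- q / s)"
        using s by (simp add: gauss_density_eq n_def powr_mult powr_minus q_def field_simps)
      moreover have "exp (- 1) \<le> exp (- q / s)" using s' s by simp
      then have "s powr (- k - 1) * exp (- 1) \<le> s powr (- k - 1) * exp (- q / s)"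
        by (rule mult_left_mono) simp
      ultimately show "ennreal (exp (- 1)) * ennreal (s powr (- k - 1))
          \<le> ennreal ((4 * pi) powr (n / 2) * s powr (\<gamma> / 2 - 1) * gauss_density s \<xi>)"
        by (simp add: ennreal_leI mult.commute flip: ennreal_mult')
    qed (use q in auto)
    finally show "ennreal a * ennreal (1 / norm \<xi> powr (n - \<gamma>)) \<le> (\<integral>\<^sup>+s. ?g s \<xi> \<partial>lborel)" .
  qed simp
  also have "\<dots> = (\<integral>\<^sup>+\<xi>. (\<integral>\<^sup>+s. ?g s \<xi> \<partial>lborel) \<partial>(lborel :: 'a measure))" by simp
  also have "\<dots> = (\<integral>\<^sup>+s. (\<integral>\<^sup>+\<xi>. ?g s \<xi> \<partial>lborel) \<partial>lborel)"
    by (intro lborel_pair.Fubini') measurable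
  also have "\<dots> = (\<integral>\<^sup>+s\<in>{1/4..}. ennreal ((4 * pi) powr (n / 2)) * ennreal (s powr (- (- \<gamma> / 2) - 1)) \<partial>lborel)"
    by (intro nn_integral_cong)
      (auto split: split_indicator simp: ennreal_mult' nn_integral_cmult nn_integral_gauss_density gauss_density_nonneg)
  also have "\<dots> = ennreal ((4 * pi) powr (n / 2)) * ennreal ((1/4) powr - (- \<gamma> / 2) / (- \<gamma> / 2))"
    using assms nn_integral_powr_at_top[of "- \<gamma> / 2" "1/4"] by (simp add: nn_set_integral_cmult)
  also have "\<dots> < \<infinity>" by (simp add: ennreal_mult_less_top)
  finally show ?thesis using a by (auto simp: ennreal_mult_less_top)
qed

section \<open>The potential measure of a Levy process\<close>

text \<open>The grid point strictly to the right of \<open>t\<close>, even if \<open>t\<close> is on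
  the grid: the approximation then converges within \<open>at_right t\<close>, the side on which
  cadlag paths are continuous.\<close>

definition dyadic_above :: "nat \<Rightarrow> real \<Rightarrow> real" where
  "dyadic_above m t = (of_int \<lfloor>2 ^ m * t\<rfloor> + 1) / 2 ^ m"

lemma dyadic_above_bounds: "t < dyadic_above m t" "dyadic_above m t \<le> t + (1 / 2) ^ m"
proof -
  have "2 ^ m * t < of_int \<lfloor>2 ^ m * t\<rfloor> + 1" "of_int \<lfloor>2 ^ m * t\<rfloor> \<le> 2 ^ m * t"
    by linarith+
  then show "t < dyadic_above m t" "dyadic_above m t \<le> t + (1 / 2) ^ m"
    unfolding dyadic_above_def
    by (simp_all only: pos_less_divide_eq pos_divide_le_eq zero_less_power zero_less_numeral)
      (simp_all add: mult.commute distrib_left power_divide)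
qed

lemma filterlim_dyadic_above: "filterlim (\<lambda>m. dyadic_above m t) (at_right t) sequentially"
proof (rule tendsto_imp_filterlim_at_right)
  show "(\<lambda>m. dyadic_above m t) \<longlonglongrightarrow> t"
  proof (rule tendsto_sandwich)
    show "\<forall>\<^sub>F m in sequentially. t \<le> dyadic_above m t"
      using dyadic_above_bounds(1) by (intro always_eventually allI less_imp_le)
    show "\<forall>\<^sub>F m in sequentially. dyadic_above m t \<le> t + (1 / 2) ^ m"
      using dyadic_above_bounds(2) by (intro always_eventually allI)
    have "(\<lambda>m. t + (1 / 2) ^ m) \<longlonglongrightarrow> t + 0"
      by (intro tendsto_add tendsto_const LIMSEQ_power_zero) auto
    then show "(\<lambda>m. t + (1 / 2) ^ m) \<longlonglongrightarrow> t" by simp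
  qed simp
qed (use dyadic_above_bounds(1) in auto)

lemma cadlag_dyadic_above:
  assumes "cadlag f" "0 \<le> t"
  shows "(\<lambda>m. f (dyadic_above m t)) \<longlonglongrightarrow> f t"
  using assms filterlim_compose[OF _ filterlim_dyadic_above] by (auto simp: cadlag_def)

text \<open>Paths are cadlag only almost surely, so \<open>Y\<close> itself may fail to be jointly
  measurable. The limit of its dyadic step approximations is, and off one null set it agrees with
  \<open>Y\<close> at all times at once.\<close>

lemma levy_process_jointly_measurable_version:
  fixes Y :: "real \<Rightarrow> 'w \<Rightarrow> 'a::euclidean_space"
  assumes "levy_process M Y"
  obtains W where "(\<lambda>(t, \<omega>). W t \<omega>) \<in> borel_measurable (borel \<Otimes>\<^sub>M M)"
    and "AE \<omega> in M. \<forall>t\<ge>0. W t \<omega> = Y t \<omega>"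
proof -
  \<comment> \<open>\<open>max 0 t\<close> avoids negative times, at which nothing is known about
    \<open>Y\<close>; \<open>lim\<close> yields a measurable function even where the sequence
    diverges.\<close>
  define W where "W t \<omega> = lim (\<lambda>m. Y (dyadic_above m (max 0 t)) \<omega>)" for t \<omega>
  have Y: "Y x \<in> borel_measurable M" if "0 \<le> x" for x
    using assms that by (auto simp: levy_process_def)
  have "(\<lambda>(t, \<omega>). Y (dyadic_above m (max 0 t)) \<omega>) \<in> borel_measurable (borel \<Otimes>\<^sub>M M)" for m
  proof -
    have "(\<lambda>p. (\<lambda>i p. Y (of_nat i / 2 ^ m) (snd p)) (nat (\<lfloor>2 ^ m * max 0 (fst p :: real)\<rfloor> + 1)) p)
        \<in> borel_measurable (borel \<Otimes>\<^sub>M M)"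
    proof (rule measurable_compose_countable[where f="\<lambda>i p. Y (of_nat i / 2 ^ m) (snd p)"])
      fix i :: nat
      have [measurable]: "Y (of_nat i / 2 ^ m) \<in> borel_measurable M" by (rule Y) simp
      show "(\<lambda>p. Y (of_nat i / 2 ^ m) (snd p)) \<in> borel_measurable (borel \<Otimes>\<^sub>M M)" by measurable
    qed measurable
    also have "(\<lambda>p. (\<lambda>i p. Y (of_nat i / 2 ^ m) (snd p)) (nat (\<lfloor>2 ^ m * max 0 (fst p :: real)\<rfloor> + 1)) p)
      = (\<lambda>(t, \<omega>). Y (dyadic_above m (max 0 t)) \<omega>)"
      by (auto simp: dyadic_above_def fun_eq_iff)
    finally show ?thesis .
  qed
  then have "(\<lambda>p. lim (\<lambda>m. (\<lambda>(t, \<omega>). Y (dyadic_above m (max 0 t)) \<omega>) p)) \<in> borel_measurable (borel \<Otimes>\<^sub>M M)"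
    by (intro borel_measurable_lim_metric)
  then have "(\<lambda>(t, \<omega>). W t \<omega>) \<in> borel_measurable (borel \<Otimes>\<^sub>M M)"
    by (simp add: W_def split_beta)
  moreover have "AE \<omega> in M. \<forall>t\<ge>0. W t \<omega> = Y t \<omega>"
  proof -
    have "AE \<omega> in M. cadlag (\<lambda>x. Y x \<omega>)" using assms by (simp add: levy_process_def)
    then show ?thesis
    proof eventually_elim
      case (elim \<omega>)
      show ?case
      proof (intro allI impI)
        fix t :: real assume t: "0 \<le> t"
        have "(\<lambda>m. Y (dyadic_above m (max 0 t)) \<omega>) \<longlonglongrightarrow> Y t \<omega>"
          using cadlag_dyadic_above[OF elim t] t by simp
        then show "W t \<omega> = Y t \<omega>" unfolding W_def by (rule limI)
      qed
    qed
  qed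
  ultimately show ?thesis by (rule that)
qed

locale levy_potential = prob_space M for M :: "'w measure" +
  fixes Y W :: "real \<Rightarrow> 'w \<Rightarrow> 'a::euclidean_space"
  assumes levy: "levy_process M Y"
    and W_measurable: "(\<lambda>(t, \<omega>). W t \<omega>) \<in> borel_measurable (borel \<Otimes>\<^sub>M M)"
    and W_eq: "AE \<omega> in M. \<forall>t\<ge>0. W t \<omega> = Y t \<omega>"
begin

lemma W_measurable' [measurable (raw)]:
  assumes [measurable]: "f \<in> borel_measurable N" "g \<in> N \<rightarrow>\<^sub>M M"
  shows "(\<lambda>x. W (f x) (g x)) \<in> borel_measurable N"
  using measurable_compose[OF _ W_measurable, of "\<lambda>x. (f x, g x)" N] by simp

lemma Y_measurable: "0 \<le> t \<Longrightarrow> Y t \<in> borel_measurable M"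
  using levy by (simp add: levy_process_def)

lemma W_eq_at: "0 \<le> t \<Longrightarrow> AE \<omega> in M. W t \<omega> = Y t \<omega>"
  using W_eq by auto

lemma nn_integral_W_eq: "0 \<le> t \<Longrightarrow> (\<integral>\<^sup>+\<omega>. f (W t \<omega>) \<partial>M) = (\<integral>\<^sup>+\<omega>. f (Y t \<omega>) \<partial>M)"
  using W_eq_at[of t] by (intro nn_integral_cong_AE) auto

definition exp_time :: "real measure" where
  "exp_time = density lborel (\<lambda>t. ennreal (exp (- t)) * indicator {0..} t)"

lemma sets_exp_time [measurable_cong]: "sets exp_time = sets borel"
  by (simp add: exp_time_def)

lemma nn_integral_exp_time:
  assumes [measurable]: "f \<in> borel_measurable borel"
  shows "(\<integral>\<^sup>+t. f t \<partial>exp_time) = (\<integral>\<^sup>+t\<in>{0..}. ennreal (exp (- t)) * f t \<partial>lborel)"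
  unfolding exp_time_def
  by (subst nn_integral_density) (auto intro!: nn_integral_cong simp: ac_simps)

lemma prob_space_exp_time: "prob_space exp_time"
proof (rule prob_spaceI)
  have "(\<integral>\<^sup>+t. ennreal (exp (- t)) * indicator {0..} t \<partial>lborel) = ennreal (0 - (- exp (- 0)))"
  proof (rule nn_integral_FTC_atLeast)
    show "((\<lambda>t. - exp (- t)) \<longlongrightarrow> (0::real)) at_top"
      using tendsto_minus[OF filterlim_compose[OF exp_at_bot filterlim_uminus_at_bot_at_top]] by simp
  qed (auto intro!: derivative_eq_intros)
  then show "emeasure exp_time (space exp_time) = 1"
    by (simp add: exp_time_def emeasure_density)
qed

text \<open>The 1-potential measure as the law of the process at an independent exponential time of
  rate 1; in this normalisation it is a probability measure.\<close>

definition potential :: "'a measure" where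
  "potential = distr (exp_time \<Otimes>\<^sub>M M) borel (\<lambda>(t, \<omega>). W t \<omega>)"

lemma sets_potential [measurable_cong]: "sets potential = sets borel"
  by (simp add: potential_def)

lemma prob_space_pair: "prob_space (exp_time \<Otimes>\<^sub>M M)"
proof -
  interpret E: prob_space exp_time by (rule prob_space_exp_time)
  interpret P: pair_prob_space exp_time M ..
  show ?thesis by (rule P.P.prob_space_axioms)
qed

lemma prob_space_potential: "prob_space potential"
  unfolding potential_def by (intro prob_space.prob_space_distr prob_space_pair) measurable

lemma nn_integral_potential:
  assumes [measurable]: "f \<in> borel_measurable borel"
  shows "(\<integral>\<^sup>+x. f x \<partial>potential) = (\<integral>\<^sup>+t\<in>{0..}. ennreal (exp (- t)) * (\<integral>\<^sup>+\<omega>. f (Y t \<omega>) \<partial>M) \<partial>lborel)"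
proof -
  have "(\<integral>\<^sup>+x. f x \<partial>potential) = (\<integral>\<^sup>+p. f (W (fst p) (snd p)) \<partial>(exp_time \<Otimes>\<^sub>M M))"
    unfolding potential_def by (subst nn_integral_distr) (auto simp: split_beta)
  also have "\<dots> = (\<integral>\<^sup>+t. (\<integral>\<^sup>+\<omega>. f (W t \<omega>) \<partial>M) \<partial>exp_time)"
    by (subst nn_integral_fst[symmetric]) auto
  also have "\<dots> = (\<integral>\<^sup>+t\<in>{0..}. ennreal (exp (- t)) * (\<integral>\<^sup>+\<omega>. f (W t \<omega>) \<partial>M) \<partial>lborel)"
    by (rule nn_integral_exp_time) measurable
  also have "\<dots> = (\<integral>\<^sup>+t\<in>{0..}. ennreal (exp (- t)) * (\<integral>\<^sup>+\<omega>. f (Y t \<omega>) \<partial>M) \<partial>lborel)"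
    by (intro nn_set_integral_cong) (simp add: nn_integral_W_eq)
  finally show ?thesis .
qed

lemma emeasure_potential:
  assumes [measurable]: "A \<in> sets borel"
  shows "emeasure potential A = (\<integral>\<^sup>+t\<in>{0..}. ennreal (exp (- t)) * emeasure M {\<omega>\<in>space M. Y t \<omega> \<in> A} \<partial>lborel)"
proof -
  have "emeasure potential A = (\<integral>\<^sup>+x. indicator A x \<partial>potential)"
    by (simp add: sets_potential)
  also have "\<dots> = (\<integral>\<^sup>+t\<in>{0..}. ennreal (exp (- t)) * (\<integral>\<^sup>+\<omega>. indicator A (Y t \<omega>) \<partial>M) \<partial>lborel)"
    by (rule nn_integral_potential) measurable
  also have "\<dots> = (\<integral>\<^sup>+t\<in>{0..}. ennreal (exp (- t)) * emeasure M {\<omega>\<in>space M. Y t \<omega> \<in> A} \<partial>lborel)"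
  proof (rule nn_set_integral_cong)
    fix t :: real assume "t \<in> {0..}"
    then have [measurable]: "Y t \<in> borel_measurable M" by (intro Y_measurable) simp
    have "(\<integral>\<^sup>+\<omega>. indicator A (Y t \<omega>) \<partial>M) = (\<integral>\<^sup>+\<omega>. indicator {\<omega>\<in>space M. Y t \<omega> \<in> A} \<omega> \<partial>M)"
      by (intro nn_integral_cong) (auto split: split_indicator)
    then show "ennreal (exp (- t)) * (\<integral>\<^sup>+\<omega>. indicator A (Y t \<omega>) \<partial>M)
      = ennreal (exp (- t)) * emeasure M {\<omega>\<in>space M. Y t \<omega> \<in> A}" by simp
  qed
  finally show ?thesis .
qed

end

section \<open>The Fourier transform of the potential\<close>

lemma has_char_exponent_Re_nonneg:
  assumes "prob_space M" "has_char_exponent M Y \<Psi>" "levy_process M Y"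
  shows "0 \<le> Re (\<Psi> \<xi>)"
proof -
  interpret prob_space M by fact
  have [measurable]: "Y 1 \<in> borel_measurable M" using assms by (auto simp: levy_process_def)
  \<comment> \<open>The characteristic function at time 1 has modulus
    \<open>exp (- Re (\<Psi> \<xi>))\<close>, and a modulus of a characteristic function is at most
    1.\<close>
  have "cmod (\<integral>\<omega>. iexp (\<xi> \<bullet> Y 1 \<omega>) \<partial>M) \<le> (\<integral>\<omega>. cmod (iexp (\<xi> \<bullet> Y 1 \<omega>)) \<partial>M)"
    by (rule integral_norm_bound)
  also have "\<dots> = 1" by (simp add: prob_space)
  also have "(\<integral>\<omega>. iexp (\<xi> \<bullet> Y 1 \<omega>) \<partial>M) = exp (- complex_of_real 1 * \<Psi> \<xi>)"
    using assms unfolding has_char_exponent_def by (metis zero_le_one)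
  finally show ?thesis by simp
qed

lemma Re_inverse_one_plus:
  assumes "0 \<le> Re z"
  shows "0 < Re (1 / (1 + z))" "Re (1 / (1 + z)) \<le> 1"
proof -
  have "0 < (1 + Re z)\<^sup>2" using assms by simp
  then have d: "0 < (1 + Re z)\<^sup>2 + (Im z)\<^sup>2" by (rule add_pos_nonneg) simp
  then show "0 < Re (1 / (1 + z))" using assms by (simp add: Re_divide cmod_power2)
  have "1 + Re z \<le> (1 + Re z)\<^sup>2 + (Im z)\<^sup>2"
    using assms by (simp add: power2_eq_square algebra_simps)
  then show "Re (1 / (1 + z)) \<le> 1" using d by (simp add: Re_divide cmod_power2)
qed

lemma integral_exp_minus_complex:
  assumes "0 < Re z"
  shows "set_integrable lborel {0..} (\<lambda>t. exp (- complex_of_real t * z))"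
    and "(\<integral>t\<in>{0..}. exp (- complex_of_real t * z) \<partial>lborel) = 1 / z"
proof -
  have z: "z \<noteq> 0" using assms by auto
  have exp0: "((\<lambda>t. exp (- (t * Re z))) \<longlongrightarrow> 0) at_top"
  proof (rule filterlim_compose[OF exp_at_bot])
    show "filterlim (\<lambda>t. - (t * Re z)) at_bot at_top"
      using assms by (intro filterlim_compose[OF filterlim_uminus_at_bot_at_top]
          filterlim_at_top_mult_tendsto_pos[OF tendsto_const]) (auto simp: filterlim_ident mult.commute)
  qed
  have "set_integrable lborel {0..} (\<lambda>t. exp (- (t * Re z)))"
  proof -
    have "(\<integral>\<^sup>+t. ennreal (exp (- (t * Re z))) * indicator {0..} t \<partial>lborel) = ennreal (0 - (- exp (- (0 * Re z)) / Re z))"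
    proof (rule nn_integral_FTC_atLeast)
      show "((\<lambda>t. - exp (- (t * Re z)) / Re z) \<longlongrightarrow> 0) at_top"
        using tendsto_divide_zero[OF tendsto_minus[OF exp0, unfolded minus_zero]] .
    qed (use assms in \<open>auto intro!: derivative_eq_intros\<close>)
    then have "(\<integral>\<^sup>+t. ennreal (norm (indicator {0..} t *\<^sub>R exp (- (t * Re z)))) \<partial>lborel) < \<infinity>"
      by (simp add: ennreal_mult' mult.commute ennreal_indicator)
    then show ?thesis unfolding set_integrable_def by (intro integrableI_bounded) auto
  qed
  then show int: "set_integrable lborel {0..} (\<lambda>t. exp (- complex_of_real t * z))"
    by (rule set_integrable_bound) (auto simp: set_borel_measurable_def)
  have "(LBINT t=0..\<infinity>. exp (- complex_of_real t * z)) = 0 - (- exp (- complex_of_real 0 * z) / z)"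
  proof (rule interval_integral_FTC_integrable)
    show "((\<lambda>t. - exp (- complex_of_real t * z) / z) has_vector_derivative exp (- complex_of_real x * z)) (at x)" for x
      using z by (auto intro!: derivative_eq_intros has_vector_derivative_real_field simp: o_def)
    show "set_integrable lborel (einterval 0 \<infinity>) (\<lambda>t. exp (- complex_of_real t * z))"
      by (rule set_integrable_subset[OF int]) (auto simp: einterval_def)
    have "((\<lambda>t. - exp (- complex_of_real t * z) / z) \<longlongrightarrow> - exp (- complex_of_real 0 * z) / z) (at_right 0)"
      by (intro tendsto_intros) (use z in auto)
    then show "(((\<lambda>t. - exp (- complex_of_real t * z) / z) \<circ> real_of_ereal) \<longlongrightarrow> - exp (- complex_of_real 0 * z) / z) (at_right 0)"
      unfolding zero_ereal_def ereal_tendsto_simps1 .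
    have "((\<lambda>t. norm (- exp (- complex_of_real t * z) / z)) \<longlongrightarrow> 0) at_top"
      using tendsto_divide_zero[OF exp0, of "cmod z"] by (simp add: norm_divide)
    then show "(((\<lambda>t. - exp (- complex_of_real t * z) / z) \<circ> real_of_ereal) \<longlongrightarrow> 0) (at_left \<infinity>)"
      unfolding ereal_tendsto_simps1 tendsto_norm_zero_iff .
  qed (auto intro!: continuous_intros)
  also have "(LBINT t=0..\<infinity>. exp (- complex_of_real t * z)) = (\<integral>t\<in>{0<..}. exp (- complex_of_real t * z) \<partial>lborel)"
    unfolding zero_ereal_def by (rule interval_integral_to_infinity_eq)
  also have "\<dots> = (\<integral>t\<in>{0..}. exp (- complex_of_real t * z) \<partial>lborel)"
    unfolding set_lebesgue_integral_def
    using AE_lborel_singleton[of 0] by (intro integral_cong_AE) (auto split: split_indicator)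
  finally show "(\<integral>t\<in>{0..}. exp (- complex_of_real t * z) \<partial>lborel) = 1 / z" by simp
qed

text \<open>For \<open>\<gamma> > 0\<close> a constant multiple of the integral of
  \<open>norm x powr - \<gamma>\<close> against \<open>U\<close>. It is an energy in that, for
  \<open>U\<close> the potential, stationary increments let it bound the expected energy of the
  occupation measure.\<close>

definition riesz_energy :: "real \<Rightarrow> 'a::real_normed_vector measure \<Rightarrow> ennreal" where
  "riesz_energy \<gamma> U =
    (\<integral>\<^sup>+s\<in>{0<..}. ennreal (s powr (\<gamma> / 2 - 1)) * (\<integral>\<^sup>+x. ennreal (exp (- s * (norm x)\<^sup>2)) \<partial>U) \<partial>lborel)"

definition exponent_integral :: "('a::euclidean_space \<Rightarrow> complex) \<Rightarrow> real \<Rightarrow> ennreal" where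
  "exponent_integral \<Psi> \<gamma> = (\<integral>\<^sup>+\<xi>\<in>{\<xi>. 1 \<le> norm \<xi>}.
    ennreal (Re (1 / (1 + \<Psi> \<xi>)) / norm \<xi> powr (real DIM('a) - \<gamma>)) \<partial>lborel)"

context levy_potential
begin

text \<open>By Fubini this is the average of \<open>exp (- t * \<Psi> \<xi>)\<close> over an
  exponential time, a Laplace transform.\<close>

lemma potential_char:
  assumes "has_char_exponent M Y \<Psi>"
  shows "(\<integral>x. iexp (\<xi> \<bullet> x) \<partial>potential) = 1 / (1 + \<Psi> \<xi>)"
proof -
  have Re: "0 \<le> Re (\<Psi> \<xi>)"
    using has_char_exponent_Re_nonneg[OF prob_space_axioms assms levy] .
  interpret E: prob_space exp_time by (rule prob_space_exp_time)
  interpret P: pair_prob_space exp_time M ..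
  have "(\<integral>x. iexp (\<xi> \<bullet> x) \<partial>potential)
      = (\<integral>p. iexp (\<xi> \<bullet> W (fst p) (snd p)) \<partial>(exp_time \<Otimes>\<^sub>M M))"
    unfolding potential_def by (subst integral_distr) (auto simp: split_beta)
  also have "\<dots> = (\<integral>t. (\<integral>\<omega>. iexp (\<xi> \<bullet> W t \<omega>) \<partial>M) \<partial>exp_time)"
    by (subst P.integral_fst'[symmetric]) (auto intro!: P.P.integrable_const_bound[where B=1])
  also have "\<dots> = (\<integral>t. indicator {0..} t *\<^sub>R exp (- complex_of_real t * (1 + \<Psi> \<xi>)) \<partial>lborel)"
  proof -
    have e: "exp_time = density lborel (\<lambda>t. ennreal (exp (- t) * indicator {0..} t))"
      unfolding exp_time_def by (intro density_cong) (auto split: split_indicator)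
    have "(\<integral>t. (\<integral>\<omega>. iexp (\<xi> \<bullet> W t \<omega>) \<partial>M) \<partial>exp_time)
      = (\<integral>t. (exp (- t) * indicator {0..} t) *\<^sub>R (\<integral>\<omega>. iexp (\<xi> \<bullet> W t \<omega>) \<partial>M) \<partial>lborel)"
      by (subst e, intro integral_density) auto
    also have "\<dots> = (\<integral>t. indicator {0..} t *\<^sub>R exp (- complex_of_real t * (1 + \<Psi> \<xi>)) \<partial>lborel)"
    proof (intro Bochner_Integration.integral_cong refl)
      fix t :: real
      have "(\<integral>\<omega>. iexp (\<xi> \<bullet> W t \<omega>) \<partial>M) = exp (- complex_of_real t * \<Psi> \<xi>)" if t: "0 \<le> t"
      proof -
        have [measurable]: "Y t \<in> borel_measurable M" by (rule Y_measurable[OF t])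
        have "(\<integral>\<omega>. iexp (\<xi> \<bullet> W t \<omega>) \<partial>M) = (\<integral>\<omega>. iexp (\<xi> \<bullet> Y t \<omega>) \<partial>M)"
          using W_eq_at[OF t] by (intro integral_cong_AE) auto
        then show ?thesis using assms t by (auto simp: has_char_exponent_def)
      qed
      then show "(exp (- t) * indicator {0..} t) *\<^sub>R (\<integral>\<omega>. iexp (\<xi> \<bullet> W t \<omega>) \<partial>M)
        = indicator {0..} t *\<^sub>R exp (- complex_of_real t * (1 + \<Psi> \<xi>))"
        by (auto split: split_indicator simp: scaleR_conv_of_real distrib_left exp_of_real[symmetric] simp flip: exp_add)
    qed
    finally show ?thesis .
  qed
  also have "\<dots> = 1 / (1 + \<Psi> \<xi>)"
    using integral_exp_minus_complex(2)[of "1 + \<Psi> \<xi>"] Re by (simp add: set_lebesgue_integral_def)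
  finally show ?thesis .
qed

lemma Re_char_exponent:
  assumes "has_char_exponent M Y \<Psi>"
  shows "0 < Re (1 / (1 + \<Psi> \<xi>))" "Re (1 / (1 + \<Psi> \<xi>)) \<le> 1"
  using Re_inverse_one_plus[OF has_char_exponent_Re_nonneg[OF prob_space_axioms assms levy]] by auto

lemma borel_measurable_inverse_one_plus_exponent:
  assumes "has_char_exponent M Y \<Psi>"
  shows "(\<lambda>\<xi>. 1 / (1 + \<Psi> \<xi>)) \<in> borel_measurable borel"
proof -
  interpret P: prob_space potential by (rule prob_space_potential)
  have "(\<lambda>\<xi>. \<integral>x. iexp (\<xi> \<bullet> x) \<partial>potential) \<in> borel_measurable borel"
    by measurable
  then show ?thesis by (simp add: potential_char[OF assms])
qed

text \<open>Parseval for two probability measures: Fubini for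
  \<open>iexp (\<xi> \<bullet> x)\<close> under the product of \<open>potential\<close> and a
  Gaussian law. The left side is real, so only the real part of
  \<open>1 / (1 + \<Psi> \<xi>)\<close> survives.\<close>

lemma potential_gauss:
  assumes "has_char_exponent M Y \<Psi>" "0 < s"
  shows "(\<integral>\<^sup>+x. ennreal (exp (- s * (norm x)\<^sup>2)) \<partial>potential)
       = (\<integral>\<^sup>+\<xi>. ennreal (gauss_density s \<xi> * Re (1 / (1 + \<Psi> \<xi>))) \<partial>lborel)"
proof -
  define G where "G = density lborel (gauss_density s :: 'a \<Rightarrow> real)"
  have [measurable_cong]: "sets G = sets borel" by (simp add: G_def)
  interpret U: prob_space potential by (rule prob_space_potential)
  interpret G: prob_space G unfolding G_def by (rule prob_space_gauss[OF assms(2)])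
  interpret P: pair_prob_space potential G ..
  note [measurable] = borel_measurable_inverse_one_plus_exponent[OF assms(1)]
  have bound: "cmod (1 / (1 + \<Psi> \<xi>)) \<le> 1" for \<xi>
  proof -
    have "0 \<le> Re (\<Psi> \<xi>)" using has_char_exponent_Re_nonneg[OF prob_space_axioms assms(1) levy] .
    then have "1 \<le> cmod (1 + \<Psi> \<xi>)" using abs_Re_le_cmod[of "1 + \<Psi> \<xi>"] by simp
    then show ?thesis by (simp add: norm_divide divide_le_eq)
  qed
  have int: "integrable G (\<lambda>\<xi>. 1 / (1 + \<Psi> \<xi>))"
    using bound by (intro G.integrable_const_bound[where B=1]) auto
  have "complex_of_real (\<integral>x. exp (- s * (norm x)\<^sup>2) \<partial>potential)
      = (\<integral>x. (\<integral>\<xi>. iexp (\<xi> \<bullet> x) \<partial>G) \<partial>potential)"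
    unfolding G_def gauss_char[OF assms(2)] by simp
  also have "\<dots> = (\<integral>\<xi>. (\<integral>x. iexp (\<xi> \<bullet> x) \<partial>potential) \<partial>G)"
    by (intro P.Fubini_integral[symmetric] P.P.integrable_const_bound[where B=1]) auto
  also have "\<dots> = (\<integral>\<xi>. 1 / (1 + \<Psi> \<xi>) \<partial>G)"
    by (simp add: potential_char[OF assms(1)])
  finally have "(\<integral>x. exp (- s * (norm x)\<^sup>2) \<partial>potential) = Re (\<integral>\<xi>. 1 / (1 + \<Psi> \<xi>) \<partial>G)"
    by (metis Re_complex_of_real)
  also have "\<dots> = (\<integral>\<xi>. Re (1 / (1 + \<Psi> \<xi>)) \<partial>G)"
    using int by simp
  finally have eq: "(\<integral>x. exp (- s * (norm x)\<^sup>2) \<partial>potential) = (\<integral>\<xi>. Re (1 / (1 + \<Psi> \<xi>)) \<partial>G)" .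
  have "(\<integral>\<^sup>+x. ennreal (exp (- s * (norm x)\<^sup>2)) \<partial>potential) = ennreal (\<integral>x. exp (- s * (norm x)\<^sup>2) \<partial>potential)"
    using assms(2) by (intro nn_integral_eq_integral U.integrable_const_bound[where B=1]) auto
  also have "\<dots> = (\<integral>\<^sup>+\<xi>. ennreal (Re (1 / (1 + \<Psi> \<xi>))) \<partial>G)"
    unfolding eq using int Re_char_exponent(1)[OF assms(1)]
    by (intro nn_integral_eq_integral[symmetric] integrable_Re) (auto intro: less_imp_le)
  also have "\<dots> = (\<integral>\<^sup>+\<xi>. ennreal (gauss_density s \<xi>) * ennreal (Re (1 / (1 + \<Psi> \<xi>))) \<partial>lborel)"
    unfolding G_def by (rule nn_integral_density) auto
  finally show ?thesis
    by (simp add: ennreal_mult' gauss_density_nonneg)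
qed

lemma potential_riesz_finite_iff:
  assumes "has_char_exponent M Y \<Psi>" "0 < \<gamma>"
  shows "riesz_energy \<gamma> potential < \<infinity> \<longleftrightarrow> \<gamma> < real DIM('a) \<and> exponent_integral \<Psi> \<gamma> < \<infinity>"
proof -
  note [measurable] = borel_measurable_inverse_one_plus_exponent[OF assms(1)]
  show ?thesis
    unfolding riesz_energy_def exponent_integral_def using assms Re_char_exponent[OF assms(1)]
    by (intro gauss_mixture_finite_iff potential_gauss) auto
qed

end

section \<open>Lower bound: finite energy\<close>

text \<open>For \<open>\<gamma> > 0\<close> and \<open>x\<close> nonzero, a constant multiple of
  \<open>norm x powr - \<gamma>\<close>. At the origin the mixture is infinite, as a kernel must be
  to exclude atoms, whereas \<open>0 powr - \<gamma>\<close> is 0.\<close>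

definition riesz_kernel :: "real \<Rightarrow> 'a::real_normed_vector \<Rightarrow> ennreal" where
  "riesz_kernel \<gamma> x = (\<integral>\<^sup>+s\<in>{0<..}. ennreal (s powr (\<gamma> / 2 - 1) * exp (- s * (norm x)\<^sup>2)) \<partial>lborel)"

lemma borel_measurable_riesz_kernel [measurable]:
  "(riesz_kernel \<gamma> :: 'a::euclidean_space \<Rightarrow> ennreal) \<in> borel_measurable borel"
  unfolding riesz_kernel_def by measurable

lemma riesz_kernel_minus_commute: "riesz_kernel \<gamma> (x - y) = riesz_kernel \<gamma> (y - x)"
  by (simp add: riesz_kernel_def norm_minus_commute)

lemma riesz_kernel_zero:
  assumes "0 < \<gamma>"
  shows "riesz_kernel \<gamma> (0::'a::real_normed_vector) = \<infinity>"
proof -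
  have "\<infinity> = (\<integral>\<^sup>+s\<in>{1..}. ennreal (s powr (\<gamma> / 2 - 1)) \<partial>lborel)"
    using nn_integral_powr_at_top_eq_infinity[of "\<gamma> / 2" 1] assms by simp
  also have "\<dots> \<le> riesz_kernel \<gamma> (0::'a)"
    unfolding riesz_kernel_def by (intro nn_integral_mono) (auto split: split_indicator)
  finally show ?thesis by (simp add: top_unique)
qed

text \<open>Keep only the part of the mixture with \<open>s \<le> 1 / d\<^sup>2\<close>, where
  \<open>s * (norm x)\<^sup>2\<close> is at most 1.\<close>

lemma riesz_kernel_ge:
  assumes "0 < \<gamma>" "norm x \<le> d" "0 < d"
  shows "ennreal (exp (- 1) * (2 / \<gamma>) * d powr - \<gamma>) \<le> riesz_kernel \<gamma> x"
proof -
  have "ennreal (exp (- 1) * (2 / \<gamma>) * d powr - \<gamma>) = ennreal (exp (- 1)) * ennreal ((1 / d\<^sup>2) powr (\<gamma> / 2) / (\<gamma> / 2))"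
    using assms by (simp add: powr_divide powr_powr powr_minus_divide flip: ennreal_mult' powr_numeral)
  also have "\<dots> = ennreal (exp (- 1)) * (\<integral>\<^sup>+s\<in>{0<..1 / d\<^sup>2}. ennreal (s powr (\<gamma> / 2 - 1)) \<partial>lborel)"
    using assms by (subst nn_integral_powr_at_zero) auto
  also have "\<dots> = (\<integral>\<^sup>+s. ennreal (exp (- 1)) * (ennreal (s powr (\<gamma> / 2 - 1)) * indicator {0<..1 / d\<^sup>2} s) \<partial>lborel)"
    by (rule nn_integral_cmult[symmetric]) simp
  also have "\<dots> \<le> riesz_kernel \<gamma> x"
    unfolding riesz_kernel_def
  proof (intro nn_integral_mono)
    fix s :: real
    have "exp (- 1) * s powr (\<gamma> / 2 - 1) \<le> s powr (\<gamma> / 2 - 1) * exp (- s * (norm x)\<^sup>2)" if "0 < s" "s \<le> 1 / d\<^sup>2"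
    proof -
      have "s * (norm x)\<^sup>2 \<le> (1 / d\<^sup>2) * d\<^sup>2"
        using that assms by (intro mult_mono power_mono) auto
      then have "s * (norm x)\<^sup>2 \<le> 1" using assms by simp
      then have "s powr (\<gamma> / 2 - 1) * exp (- 1) \<le> s powr (\<gamma> / 2 - 1) * exp (- s * (norm x)\<^sup>2)"
        by (intro mult_left_mono) auto
      then show ?thesis by (simp add: mult.commute)
    qed
    then show "ennreal (exp (- 1)) * (ennreal (s powr (\<gamma> / 2 - 1)) * indicator {0<..1 / d\<^sup>2} s)
      \<le> ennreal (s powr (\<gamma> / 2 - 1) * exp (- s * (norm x)\<^sup>2)) * indicator {0<..} s"
      by (auto split: split_indicator simp flip: ennreal_mult' intro!: ennreal_leI)
  qed
  finally show ?thesis .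
qed

text \<open>A finite Riesz potential at a point bounds the mass of every small set containing it.\<close>

lemma hausdorff_measure_nonzero_if_finite_energy:
  fixes f :: "'b \<Rightarrow> 'a::euclidean_space"
  assumes "finite_measure N" "0 < emeasure N (space N)"
    and f [measurable]: "f \<in> borel_measurable N"
    and "0 < \<gamma>"
    and energy: "(\<integral>\<^sup>+a. (\<integral>\<^sup>+b. riesz_kernel \<gamma> (f b - f a) \<partial>N) \<partial>N) < \<infinity>"
    and "f ` space N \<subseteq> A"
  shows "hausdorff_measure \<gamma> A \<noteq> 0"
proof -
  interpret finite_measure N by fact
  define \<phi> where "\<phi> a = (\<integral>\<^sup>+b. riesz_kernel \<gamma> (f b - f a) \<partial>N)" for a
  have [measurable]: "\<phi> \<in> borel_measurable N" unfolding \<phi>_def by measurable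
  \<comment> \<open>The potential is finite almost everywhere, so one of these sublevel sets carries
    positive mass.\<close>
  define B where "B m = {a\<in>space N. \<phi> a \<le> of_nat m}" for m :: nat
  have [measurable]: "B m \<in> sets N" for m unfolding B_def by measurable
  have "AE a in N. \<phi> a \<noteq> \<infinity>"
    using energy by (intro nn_integral_PInf_AE) (auto simp: \<phi>_def)
  then have "AE a in N. a \<in> (\<Union>m. B m)"
  proof (rule AE_mp, intro AE_I2 impI)
    fix a assume "a \<in> space N" "\<phi> a \<noteq> \<infinity>"
    then obtain r where "\<phi> a = ennreal r" "0 \<le> r" by (cases "\<phi> a") auto
    moreover obtain m :: nat where "r \<le> real m" using real_arch_simple by blast
    ultimately show "a \<in> (\<Union>m. B m)"
      using \<open>a \<in> space N\<close> by (auto simp: B_def ennreal_of_nat_eq_real_of_nat intro!: exI[of _ m] ennreal_leI)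
  qed
  then have "emeasure N (\<Union>m. B m) = emeasure N (space N)"
    by (intro emeasure_eq_AE) (auto simp: B_def)
  then have "emeasure N (\<Union>m. B m) \<noteq> 0" using assms(2) by simp
  then obtain m where m: "emeasure N (B m) \<noteq> 0"
    using emeasure_UN_eq_0[of N B] by (metis \<open>\<And>m. B m \<in> sets N\<close> image_subset_iff)
  define c where "c = exp (- 1) * (2 / \<gamma>)"
  have c: "0 < c" using assms(4) by (simp add: c_def)
  show ?thesis
  proof (rule mass_distribution_principle[where f=f and N=N and B="B m" and c="m / c"])
    show "f ` B m \<subseteq> A" using assms(6) by (auto simp: B_def)
    fix S :: "'a set" assume S: "closed S" "bounded S"
    define S' where "S' = {x\<in>B m. f x \<in> S}"
    have S'_eq: "S' = B m \<inter> (f -` S \<inter> space N)" by (auto simp: S'_def B_def)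
    have [measurable]: "S' \<in> sets N"
      unfolding S'_eq by (intro sets.Int measurable_sets[OF f] borel_closed S) measurable
    have mass: "C * emeasure N S' \<le> ennreal m" if a: "a \<in> S'" and C: "\<And>b. b \<in> S' \<Longrightarrow> C \<le> riesz_kernel \<gamma> (f b - f a)" for a C
    proof -
      have "C * emeasure N S' = (\<integral>\<^sup>+b. C * indicator S' b \<partial>N)"
        by (rule nn_integral_cmult_indicator[symmetric]) measurable
      also have "\<dots> \<le> \<phi> a" unfolding \<phi>_def
        using C by (intro nn_integral_mono) (auto split: split_indicator)
      also have "\<dots> \<le> ennreal m" using a by (simp add: S'_def B_def ennreal_of_nat_eq_real_of_nat)
      finally show ?thesis .
    qed
    have "emeasure N S' \<le> ennreal (m / c * diameter S powr \<gamma>)"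
    proof (cases "S' = {}")
      case False
      then obtain a where a: "a \<in> S'" by auto
      have norm: "norm (f b - f a) \<le> diameter S" if "b \<in> S'" for b
        using diameter_bounded_bound[OF S(2), of "f b" "f a"] a that by (simp add: S'_def dist_norm)
      show ?thesis
      \<comment> \<open>If \<open>S\<close> is a single point, the infinite value of the kernel at
        the origin forces \<open>S'\<close> to be a null set.\<close>
      proof (cases "diameter S = 0")
        case True
        have "\<infinity> * emeasure N S' \<le> ennreal m"
          using norm True riesz_kernel_zero[OF assms(4), where 'a='a] by (intro mass[OF a]) auto
        then have "emeasure N S' = 0" by (cases "emeasure N S' = 0") (auto simp: ennreal_top_mult top_unique)
        then show ?thesis by simp
      next
        case False
        then have d: "0 < diameter S" using diameter_ge_0[OF S(2)] by simp
        have "ennreal (c * diameter S powr - \<gamma>) * emeasure N S' \<le> ennreal m"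
          unfolding c_def using norm d assms(4) by (intro mass[OF a] riesz_kernel_ge) auto
        then have "ennreal (c * diameter S powr - \<gamma> * measure N S') \<le> ennreal m"
          using c by (simp add: emeasure_eq_measure ennreal_mult')
        then have "c * diameter S powr - \<gamma> * measure N S' \<le> m" by simp
        then have "measure N S' \<le> m / c * diameter S powr \<gamma>"
          using c d by (simp add: powr_minus field_simps)
        then show ?thesis by (simp add: emeasure_eq_measure ennreal_leI)
      qed
    qed simp
    then show "emeasure N {x \<in> B m. f x \<in> S} \<le> ennreal (real m / c * diameter S powr \<gamma>)"
      by (simp add: S'_def)
  qed (use m assms c in \<open>auto simp: zero_less_iff_neq_zero\<close>)
qed

context levy_potential
begin

lemma nn_integral_increment:
  assumes [measurable]: "h \<in> borel_measurable borel" and "0 \<le> a" "a \<le> b"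
  shows "(\<integral>\<^sup>+\<omega>. h (W b \<omega> - W a \<omega>) \<partial>M) = (\<integral>\<^sup>+\<omega>. h (W (b - a) \<omega>) \<partial>M)"
proof -
  have [measurable]: "Y a \<in> borel_measurable M" "Y b \<in> borel_measurable M" "Y (b - a) \<in> borel_measurable M"
    using assms by (auto intro: Y_measurable)
  have "distr M borel (\<lambda>\<omega>. Y (a + (b - a)) \<omega> - Y a \<omega>) = distr M borel (Y (b - a))"
    using levy assms(2,3) unfolding levy_process_def by (metis diff_ge_0_iff_ge)
  then have *: "distr M borel (\<lambda>\<omega>. Y b \<omega> - Y a \<omega>) = distr M borel (Y (b - a))" by simp
  have "(\<integral>\<^sup>+\<omega>. h (W b \<omega> - W a \<omega>) \<partial>M) = (\<integral>\<^sup>+\<omega>. h (Y b \<omega> - Y a \<omega>) \<partial>M)"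
    using W_eq assms by (intro nn_integral_cong_AE) (auto elim!: eventually_mono)
  also have "\<dots> = (\<integral>\<^sup>+x. h x \<partial>distr M borel (\<lambda>\<omega>. Y b \<omega> - Y a \<omega>))"
    by (subst nn_integral_distr) auto
  also have "\<dots> = (\<integral>\<^sup>+\<omega>. h (Y (b - a) \<omega>) \<partial>M)"
    unfolding * by (subst nn_integral_distr) auto
  also have "\<dots> = (\<integral>\<^sup>+\<omega>. h (W (b - a) \<omega>) \<partial>M)"
    using W_eq assms by (intro nn_integral_cong_AE) (auto elim!: eventually_mono)
  finally show ?thesis .
qed

text \<open>The mass is Lebesgue measure on \<open>{0..T}\<close>, carried along the path. By
  stationarity the expected kernel between times \<open>a\<close> and \<open>b\<close> depends only
  on their distance, so the expected energy is at most \<open>2 * T\<close> times the integral of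
  \<open>g\<close> over \<open>{0..T}\<close>, the factor 2 counting both orders. That integral is
  at most \<open>exp T\<close> times the energy of the potential.\<close>

lemma AE_hausdorff_measure_range_nonzero:
  assumes "0 < \<gamma>" "0 < T"
    and fin: "riesz_energy \<gamma> potential < \<infinity>"
  shows "AE \<omega> in M. hausdorff_measure \<gamma> ((\<lambda>t. Y t \<omega>) ` {0..T}) \<noteq> 0"
proof -
  define N where "N = restrict_space lborel {0..T}"
  define g where "g t = (\<integral>\<^sup>+\<omega>. riesz_kernel \<gamma> (W t \<omega>) \<partial>M)" for t
  have [measurable]: "g \<in> borel_measurable borel" unfolding g_def by measurable
  interpret U: prob_space potential by (rule prob_space_potential)
  interpret UL: pair_sigma_finite potential lborel ..
  interpret LM: pair_sigma_finite lborel M ..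
  have "riesz_energy \<gamma> potential
    = (\<integral>\<^sup>+s. (\<integral>\<^sup>+x. ennreal (s powr (\<gamma> / 2 - 1) * exp (- s * (norm x)\<^sup>2)) * indicator {0<..} s \<partial>potential) \<partial>lborel)"
    unfolding riesz_energy_def by (intro nn_integral_cong)
      (auto simp: ennreal_mult' nn_integral_cmult nn_integral_multc simp flip: nn_integral_cmult split: split_indicator)
  also have "\<dots> = (\<integral>\<^sup>+x. riesz_kernel \<gamma> x \<partial>potential)"
    unfolding riesz_kernel_def by (rule UL.Fubini') measurable
  also have "\<dots> = (\<integral>\<^sup>+t\<in>{0..}. ennreal (exp (- t)) * (\<integral>\<^sup>+\<omega>. riesz_kernel \<gamma> (Y t \<omega>) \<partial>M) \<partial>lborel)"
    by (rule nn_integral_potential) measurable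
  also have "\<dots> = (\<integral>\<^sup>+t\<in>{0..}. ennreal (exp (- t)) * g t \<partial>lborel)"
    unfolding g_def by (intro nn_set_integral_cong) (simp add: nn_integral_W_eq)
  finally have "(\<integral>\<^sup>+t\<in>{0..}. ennreal (exp (- t)) * g t \<partial>lborel) < \<infinity>" using fin by simp
  moreover have "ennreal (exp (- T)) * (\<integral>\<^sup>+t\<in>{0..T}. g t \<partial>lborel) \<le> (\<integral>\<^sup>+t\<in>{0..}. ennreal (exp (- t)) * g t \<partial>lborel)"
  proof -
    have "ennreal (exp (- T)) * (\<integral>\<^sup>+t\<in>{0..T}. g t \<partial>lborel) = (\<integral>\<^sup>+t\<in>{0..T}. ennreal (exp (- T)) * g t \<partial>lborel)"
      by (rule nn_set_integral_cmult[symmetric]) measurable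
    also have "\<dots> \<le> (\<integral>\<^sup>+t\<in>{0..}. ennreal (exp (- t)) * g t \<partial>lborel)"
      by (rule nn_set_integral_mono) (auto intro!: mult_right_mono ennreal_leI)
    finally show ?thesis .
  qed
  ultimately have "ennreal (exp (- T)) * (\<integral>\<^sup>+t\<in>{0..T}. g t \<partial>lborel) < \<infinity>" by (rule le_less_trans[rotated])
  then have G: "(\<integral>\<^sup>+t\<in>{0..T}. g t \<partial>lborel) < \<infinity>" by (auto simp: ennreal_mult_less_top)
  define F where "F a b \<omega> = riesz_kernel \<gamma> (W b \<omega> - W a \<omega>) * indicator {0..T} b * indicator {0..T} a" for a b \<omega>
  have inner: "(\<integral>\<^sup>+\<omega>. F a b \<omega> \<partial>M) = g \<bar>b - a\<bar> * indicator {0..T} b * indicator {0..T} a" for a b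
  proof (cases "a \<in> {0..T} \<and> b \<in> {0..T}")
    case True
    then have "(\<integral>\<^sup>+\<omega>. F a b \<omega> \<partial>M) = (\<integral>\<^sup>+\<omega>. riesz_kernel \<gamma> (W b \<omega> - W a \<omega>) \<partial>M)" by (simp add: F_def)
    also have "\<dots> = g \<bar>b - a\<bar>"
    proof (cases "a \<le> b")
      case le: True
      then show ?thesis using nn_integral_increment[of "riesz_kernel \<gamma>" a b] True by (simp add: g_def)
    next
      case False
      have "(\<integral>\<^sup>+\<omega>. riesz_kernel \<gamma> (W b \<omega> - W a \<omega>) \<partial>M) = (\<integral>\<^sup>+\<omega>. riesz_kernel \<gamma> (W a \<omega> - W b \<omega>) \<partial>M)"
        by (intro nn_integral_cong riesz_kernel_minus_commute)
      then show ?thesis using nn_integral_increment[of "riesz_kernel \<gamma>" b a] True False by (simp add: g_def)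
    qed
    finally show ?thesis using True by simp
  qed (auto simp: F_def)
  have bound: "(\<integral>\<^sup>+b. g \<bar>b - a\<bar> * indicator {0..T} b \<partial>lborel) \<le> 2 * (\<integral>\<^sup>+t\<in>{0..T}. g t \<partial>lborel)" if "a \<in> {0..T}" for a
  proof -
    have "(\<integral>\<^sup>+b. g \<bar>b - a\<bar> * indicator {0..T} b \<partial>lborel)
      \<le> (\<integral>\<^sup>+b. g (b - a) * indicator {0..T} (b - a) + g (a - b) * indicator {0..T} (a - b) \<partial>lborel)"
      using that by (intro nn_integral_mono) (auto split: split_indicator simp: abs_if intro: add_increasing add_increasing2)
    also have "\<dots> = (\<integral>\<^sup>+b. g (b - a) * indicator {0..T} (b - a) \<partial>lborel) + (\<integral>\<^sup>+b. g (a - b) * indicator {0..T} (a - b) \<partial>lborel)"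
      by (intro nn_integral_add) measurable
    also have "(\<integral>\<^sup>+b. g (b - a) * indicator {0..T} (b - a) \<partial>lborel) = (\<integral>\<^sup>+t\<in>{0..T}. g t \<partial>lborel)"
      using nn_integral_real_affine[of "\<lambda>b. g (b - a) * indicator {0..T} (b - a)" 1 a] by simp
    also have "(\<integral>\<^sup>+b. g (a - b) * indicator {0..T} (a - b) \<partial>lborel) = (\<integral>\<^sup>+t\<in>{0..T}. g t \<partial>lborel)"
      using nn_integral_real_affine[of "\<lambda>b. g (a - b) * indicator {0..T} (a - b)" "-1" a] by simp
    finally show ?thesis by (simp add: mult_2)
  qed
  have "(\<integral>\<^sup>+\<omega>. (\<integral>\<^sup>+a. (\<integral>\<^sup>+b. F a b \<omega> \<partial>lborel) \<partial>lborel) \<partial>M) = (\<integral>\<^sup>+a. (\<integral>\<^sup>+\<omega>. (\<integral>\<^sup>+b. F a b \<omega> \<partial>lborel) \<partial>M) \<partial>lborel)"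
    unfolding F_def by (rule LM.Fubini') measurable
  also have "\<dots> = (\<integral>\<^sup>+a. (\<integral>\<^sup>+b. (\<integral>\<^sup>+\<omega>. F a b \<omega> \<partial>M) \<partial>lborel) \<partial>lborel)"
    unfolding F_def by (intro nn_integral_cong LM.Fubini') measurable
  also have "\<dots> \<le> (\<integral>\<^sup>+a. 2 * (\<integral>\<^sup>+t\<in>{0..T}. g t \<partial>lborel) * indicator {0..T} a \<partial>lborel)"
    using bound by (intro nn_integral_mono) (auto simp: inner split: split_indicator)
  also have "\<dots> = 2 * (\<integral>\<^sup>+t\<in>{0..T}. g t \<partial>lborel) * ennreal T"
    using assms by (subst nn_integral_cmult_indicator) auto
  also have "\<dots> < \<infinity>" using G by (simp add: ennreal_mult_less_top)
  finally have "(\<integral>\<^sup>+\<omega>. (\<integral>\<^sup>+a. (\<integral>\<^sup>+b. F a b \<omega> \<partial>lborel) \<partial>lborel) \<partial>M) < \<infinity>" .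
  then have "AE \<omega> in M. (\<integral>\<^sup>+a. (\<integral>\<^sup>+b. F a b \<omega> \<partial>lborel) \<partial>lborel) \<noteq> \<infinity>"
    unfolding F_def by (intro nn_integral_PInf_AE) auto
  then show ?thesis
    using W_eq AE_space
  proof eventually_elim
    case (elim \<omega>)
    note [measurable] = elim(3)
    show ?case
    proof (rule hausdorff_measure_nonzero_if_finite_energy[where N=N and f="\<lambda>t. W t \<omega>"])
      show "finite_measure N" "0 < emeasure N (space N)"
        using assms(2) by (auto simp: N_def space_restrict_space emeasure_restrict_space intro!: finite_measureI)
      show "(\<lambda>t. W t \<omega>) \<in> borel_measurable N" 
        unfolding N_def by (rule measurable_restrict_space1) measurable
      have "(\<integral>\<^sup>+a. (\<integral>\<^sup>+b. riesz_kernel \<gamma> (W b \<omega> - W a \<omega>) \<partial>N) \<partial>N) = (\<integral>\<^sup>+a. (\<integral>\<^sup>+b. F a b \<omega> \<partial>lborel) \<partial>lborel)"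
        by (auto simp: N_def nn_integral_restrict_space F_def split: split_indicator intro!: nn_integral_cong)
      then show "(\<integral>\<^sup>+a. (\<integral>\<^sup>+b. riesz_kernel \<gamma> (W b \<omega> - W a \<omega>) \<partial>N) \<partial>N) < \<infinity>"
        using elim(1) by (simp add: less_top)
      show "(\<lambda>t. W t \<omega>) ` space N \<subseteq> (\<lambda>t. Y t \<omega>) ` {0..T}"
        using elim(2) by (auto simp: N_def space_restrict_space intro!: image_eqI)
    qed fact
  qed
qed

end

section \<open>Upper bound: counting visited cells\<close>

definition int_lattice :: "'a::euclidean_space set" where
  "int_lattice = {z. \<forall>b\<in>Basis. z \<bullet> b \<in> \<int>}"

text \<open>The index of the half-open cube of side \<open>r\<close> that contains \<open>x\<close>:
  its lower corner divided by \<open>r\<close>.\<close>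

definition cell :: "real \<Rightarrow> 'a::euclidean_space \<Rightarrow> 'a" where
  "cell r x = (\<Sum>b\<in>Basis. of_int \<lfloor>x \<bullet> b / r\<rfloor> *\<^sub>R b)"

lemma cell_inner: "b \<in> Basis \<Longrightarrow> cell r x \<bullet> b = of_int \<lfloor>x \<bullet> b / r\<rfloor>"
  by (simp add: cell_def)

lemma cell_in_int_lattice: "cell r x \<in> int_lattice"
  by (simp add: int_lattice_def cell_inner)

lemma borel_measurable_cell [measurable]: "cell r \<in> borel_measurable borel"
  unfolding cell_def by measurable

text \<open>With \<open>I = UNIV\<close> it gives countability of the lattice, with
  \<open>I = {-1..1}\<close> finiteness of the set of neighbours.\<close>

lemma int_lattice_image:
  "{z\<in>int_lattice. \<forall>b\<in>Basis. z \<bullet> b \<in> of_int ` I} = (\<lambda>f. \<Sum>b\<in>Basis. of_int (f b) *\<^sub>R b) ` (Basis \<rightarrow>\<^sub>E I)"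
  (is "?L = ?R")
proof
  show "?L \<subseteq> (?R :: 'a set)"
  proof
    fix z :: 'a assume "z \<in> ?L"
    then have "\<forall>b\<in>Basis. \<exists>k\<in>I. z \<bullet> b = of_int k" by auto
    then obtain f where f: "\<And>b. b \<in> Basis \<Longrightarrow> f b \<in> I \<and> z \<bullet> b = of_int (f b)" by metis
    then have "z = (\<Sum>b\<in>Basis. of_int (restrict f Basis b) *\<^sub>R b)"
      by (subst euclidean_representation[symmetric, of z]) (auto intro!: sum.cong)
    then show "z \<in> ?R" using f by (intro image_eqI[where x="restrict f Basis"]) auto
  qed
qed (auto simp: int_lattice_def)

lemma countable_int_lattice: "countable (int_lattice :: 'a::euclidean_space set)"
proof -
  have "int_lattice = {z\<in>int_lattice. \<forall>b\<in>Basis. (z::'a) \<bullet> b \<in> of_int ` (UNIV :: int set)}"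
    by (auto simp: int_lattice_def Ints_def)
  then show ?thesis unfolding int_lattice_image
    by (rule ssubst) (intro countable_image countable_PiE; simp)
qed

definition cell_neighbours :: "'a::euclidean_space set" where
  "cell_neighbours = {z\<in>int_lattice. \<forall>b\<in>Basis. z \<bullet> b \<in> of_int ` {-1..1}}"

lemma finite_cell_neighbours: "finite (cell_neighbours :: 'a::euclidean_space set)"
  unfolding cell_neighbours_def int_lattice_image by (intro finite_imageI finite_PiE) auto

lemma cell_neighbour:
  assumes "norm (x - y) < r"
  obtains e where "e \<in> cell_neighbours" "cell r y = cell r x + e"
proof
  show "cell r y = cell r x + (cell r y - cell r x)" by simp
  have r: "0 < r" using assms norm_ge_zero[of "x - y"] by linarith
  have "cell r y \<bullet> b - cell r x \<bullet> b \<in> of_int ` {-1..1}" if b: "b \<in> Basis" for b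
  proof -
    have "\<bar>x \<bullet> b - y \<bullet> b\<bar> < r"
      using Basis_le_norm[OF b, of "x - y"] assms by (simp add: inner_diff_left)
    then have "x \<bullet> b / r < y \<bullet> b / r + 1" "y \<bullet> b / r < x \<bullet> b / r + 1"
      using r by (auto simp: field_simps)
    then have "\<lfloor>y \<bullet> b / r\<rfloor> - \<lfloor>x \<bullet> b / r\<rfloor> \<in> {-1..1}" by (simp, linarith)
    then have "of_int (\<lfloor>y \<bullet> b / r\<rfloor> - \<lfloor>x \<bullet> b / r\<rfloor>) \<in> (of_int ` {-1..1} :: real set)" by (rule imageI)
    then show ?thesis using b by (simp add: cell_inner)
  qed
  then show "cell r y - cell r x \<in> cell_neighbours"
    by (auto simp: cell_neighbours_def int_lattice_def inner_diff_left cell_inner)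
qed

lemma dist_le_if_cell_eq:
  fixes x y :: "'a::euclidean_space" and r :: real
  assumes "cell r x = cell r y" "0 < r"
  shows "dist x y \<le> DIM('a) * r"
proof -
  have "\<bar>(x - y) \<bullet> b\<bar> \<le> r" if b: "b \<in> Basis" for b
  proof -
    have "\<lfloor>x \<bullet> b / r\<rfloor> = \<lfloor>y \<bullet> b / r\<rfloor>"
      using arg_cong[OF assms(1), of "\<lambda>z. z \<bullet> b"] b by (simp add: cell_inner)
    then have "\<bar>x \<bullet> b / r - y \<bullet> b / r\<bar> \<le> 1" by linarith
    then show ?thesis using assms(2) by (simp add: inner_diff_left abs_le_iff field_simps)
  qed
  then have "norm (x - y) \<le> (\<Sum>b\<in>(Basis::'a set). r)"
    by (intro order_trans[OF norm_le_l1] sum_mono) auto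
  then show ?thesis by (simp add: dist_norm)
qed

context levy_potential
begin

text \<open>The path at \<open>x 0, ..., x j\<close> consists of the partial sums of its increments,
  so an event of the past is an event of the first \<open>j\<close> increments, which are
  independent of the next one. The partial sums give the path only where \<open>Y 0 = 0\<close>,
  hence events are identified up to null sets.\<close>

lemma indep_increment_of_past:
  assumes x: "x 0 = 0" "\<And>i. i \<le> j \<Longrightarrow> x i < x (Suc i)"
    and [measurable]: "Measurable.pred (Pi\<^sub>M {..<j} (\<lambda>_. borel)) (\<lambda>f. P (\<lambda>i. \<Sum>k<i. f k :: 'a))" "S \<in> sets borel"
    and past [measurable]: "{\<omega>\<in>space M. P (\<lambda>i. Y (x i) \<omega>)} \<in> sets M"
    and P: "\<And>f g. (\<And>i. i \<le> j \<Longrightarrow> f i = g i) \<Longrightarrow> P f = P g"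
  shows "emeasure M {\<omega>\<in>space M. P (\<lambda>i. Y (x i) \<omega>) \<and> Y (x (Suc j)) \<omega> - Y (x j) \<omega> \<in> S}
    = emeasure M {\<omega>\<in>space M. P (\<lambda>i. Y (x i) \<omega>)} * emeasure M {\<omega>\<in>space M. Y (x (Suc j) - x j) \<omega> \<in> S}"
proof -
  define \<Delta> where "\<Delta> i \<omega> = Y (x (Suc i)) \<omega> - Y (x i) \<omega>" for i \<omega>
  have x0: "0 \<le> x i" if "i \<le> Suc j" for i
    using that
  proof (induction i)
    case (Suc i)
    then show ?case using x(2)[of i] by simp
  qed (use x in simp)
  have Y [measurable]: "Y (x i) \<in> borel_measurable M" if "i \<le> Suc j" for i
    using x0[OF that] by (rule Y_measurable)
  have "indep_vars (\<lambda>_. borel) \<Delta> {..<Suc j}"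
    using levy x unfolding levy_process_def \<Delta>_def by simp
  then have "indep_var (Pi\<^sub>M {..<j} (\<lambda>_. borel)) (\<lambda>\<omega>. restrict (\<lambda>i. \<Delta> i \<omega>) {..<j})
      (Pi\<^sub>M {j} (\<lambda>_. borel)) (\<lambda>\<omega>. restrict (\<lambda>i. \<Delta> i \<omega>) {j})"
    by (rule indep_var_restrict) auto
  note ind = indep_varD[OF this]
  define A where "A = {f\<in>space (Pi\<^sub>M {..<j} (\<lambda>_. borel)). P (\<lambda>i. \<Sum>k<i. f k :: 'a)}"
  define B where "B = {f\<in>space (Pi\<^sub>M {j} (\<lambda>_. borel)). f j \<in> S}"
  have A: "A \<in> sets (Pi\<^sub>M {..<j} (\<lambda>_. borel))" unfolding A_def by measurable
  have B: "B \<in> sets (Pi\<^sub>M {j} (\<lambda>_. borel))" unfolding B_def by measurable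
  have 0: "AE \<omega> in M. Y 0 \<omega> = 0" using levy by (simp add: levy_process_def)
  have sum: "(\<Sum>k<i. \<Delta> k \<omega>) = Y (x i) \<omega>" if "Y 0 \<omega> = 0" for i \<omega>
    using that x(1) sum_lessThan_telescope[of "\<lambda>i. Y (x i) \<omega>" i] by (simp add: \<Delta>_def)
  \<comment> \<open>Restricted to \<open>{..<j}\<close>, the increments are \<open>undefined\<close>
    from \<open>j\<close> on. \<open>P\<close> looks only at indices up to \<open>j\<close>, whose
    partial sums stop before that.\<close>
  have P_eq: "P (\<lambda>i. \<Sum>k<i. if k < j then \<Delta> k \<omega> else undefined) \<longleftrightarrow> P (\<lambda>i. Y (x i) \<omega>)" if "Y 0 \<omega> = 0" for \<omega>
    using sum[OF that] by (intro P) (auto simp flip: sum[OF that] intro!: sum.cong)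
  have [measurable]: "Y (x (Suc j) - x j) \<in> borel_measurable M"
    using x(2)[of j] by (intro Y_measurable) simp
  have \<Delta>j: "Y (x (Suc j)) \<omega> - Y (x j) \<omega> = \<Delta> j \<omega>" for \<omega> by (simp add: \<Delta>_def)
  have "AE \<omega> in M. \<omega> \<in> (\<lambda>\<omega>. (restrict (\<lambda>i. \<Delta> i \<omega>) {..<j}, restrict (\<lambda>i. \<Delta> i \<omega>) {j})) -` (A \<times> B) \<inter> space M
    \<longleftrightarrow> \<omega> \<in> {\<omega>\<in>space M. P (\<lambda>i. Y (x i) \<omega>) \<and> Y (x (Suc j)) \<omega> - Y (x j) \<omega> \<in> S}"
    using 0 by eventually_elim (auto simp: A_def B_def P_eq space_PiM \<Delta>j)
  then have 1: "prob ((\<lambda>\<omega>. (restrict (\<lambda>i. \<Delta> i \<omega>) {..<j}, restrict (\<lambda>i. \<Delta> i \<omega>) {j})) -` (A \<times> B) \<inter> space M)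
    = prob {\<omega>\<in>space M. P (\<lambda>i. Y (x i) \<omega>) \<and> Y (x (Suc j)) \<omega> - Y (x j) \<omega> \<in> S}"
    using A B by (intro finite_measure_eq_AE) (auto simp: \<Delta>_def)
  have "AE \<omega> in M. \<omega> \<in> (\<lambda>\<omega>. restrict (\<lambda>i. \<Delta> i \<omega>) {..<j}) -` A \<inter> space M
    \<longleftrightarrow> \<omega> \<in> {\<omega>\<in>space M. P (\<lambda>i. Y (x i) \<omega>)}"
    using 0 by eventually_elim (auto simp: A_def P_eq space_PiM)
  then have 2: "prob ((\<lambda>\<omega>. restrict (\<lambda>i. \<Delta> i \<omega>) {..<j}) -` A \<inter> space M)
    = prob {\<omega>\<in>space M. P (\<lambda>i. Y (x i) \<omega>)}"
    using A by (intro finite_measure_eq_AE) (auto simp: \<Delta>_def)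
  have "(\<lambda>\<omega>. restrict (\<lambda>i. \<Delta> i \<omega>) {j}) -` B \<inter> space M = \<Delta> j -` S \<inter> space M"
    by (auto simp: B_def space_PiM)
  moreover have [measurable]: "\<Delta> j \<in> borel_measurable M" unfolding \<Delta>_def by measurable
  moreover have "prob (\<Delta> j -` S \<inter> space M) = measure (distr M borel (\<Delta> j)) S"
    by (subst measure_distr) auto
  moreover have "distr M borel (\<Delta> j) = distr M borel (Y (x (Suc j) - x j))"
  proof -
    have "distr M borel (\<lambda>\<omega>. Y (x j + (x (Suc j) - x j)) \<omega> - Y (x j) \<omega>) = distr M borel (Y (x (Suc j) - x j))"
      using levy x0[of j] x(2)[of j] unfolding levy_process_def by (metis diff_ge_0_iff_ge le_SucI less_imp_le order_refl)
    then show ?thesis by (simp add: \<Delta>_def[abs_def])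
  qed
  moreover have "measure (distr M borel (Y (x (Suc j) - x j))) S = prob {\<omega>\<in>space M. Y (x (Suc j) - x j) \<omega> \<in> S}"
    by (subst measure_distr) (auto intro!: arg_cong[where f=prob])
  ultimately have 3: "prob ((\<lambda>\<omega>. restrict (\<lambda>i. \<Delta> i \<omega>) {j}) -` B \<inter> space M) = prob {\<omega>\<in>space M. Y (x (Suc j) - x j) \<omega> \<in> S}"
    by simp
  show ?thesis
    using ind[OF A B] unfolding 1 2 3 emeasure_eq_measure by (simp add: ennreal_mult')
qed

text \<open>Decompose by the first grid time \<open>t j\<close> at which the cell is occupied, an
  event of the path up to \<open>t j\<close>. Independently of it, the process at lag
  \<open>u\<close> is within \<open>r\<close> of its entry point with probability
  \<open>p u\<close>, and then in a neighbouring cell. Integrating over discounted time gives the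
  potential of \<open>ball 0 r\<close> times \<open>exp (- t j)\<close>, and
  \<open>t j \<le> N\<close>.\<close>

lemma first_hit_potential:
  fixes r :: real and m N :: nat and z :: 'a
  assumes "0 < r"
  shows "emeasure M {\<omega>\<in>space M. \<exists>j\<le>N * 2 ^ m. cell r (Y (real j / 2 ^ m) \<omega>) = z}
      * (ennreal (exp (- real N)) * emeasure potential (ball 0 r))
    \<le> emeasure potential {x. \<exists>e\<in>cell_neighbours. cell r x = z + e}"
proof -
  define t where "t j = real j / 2 ^ m" for j :: nat
  define J where "J = N * 2 ^ m"
  have t: "0 \<le> t j" "t 0 = 0" "t j < t (Suc j)" for j
    by (auto simp: t_def divide_strict_right_mono)
  have t_le: "t j \<le> N" if "j \<le> J" for j
  proof -
    have "real j \<le> real (N * 2 ^ m)" using that unfolding J_def by (rule of_nat_mono)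
    then show ?thesis by (simp add: t_def pos_divide_le_eq)
  qed
  define b where "b = ennreal (exp (- real N)) * emeasure potential (ball 0 r)"
  define A where "A j = {\<omega>\<in>space M. cell r (Y (t j) \<omega>) = z \<and> (\<forall>i<j. cell r (Y (t i) \<omega>) \<noteq> z)}" for j
  define C where "C = {x. \<exists>e\<in>cell_neighbours. cell r x = z + (e::'a)}"
  define p where "p u = emeasure M {\<omega>\<in>space M. norm (W u \<omega>) < r}" for u
  have [measurable]: "Y (t j) \<in> borel_measurable M" for j by (rule Y_measurable[OF t(1)])
  have [measurable]: "A j \<in> sets M" for j unfolding A_def by measurable
  have C_eq: "C = (\<Union>e\<in>cell_neighbours. {x. cell r x = z + e})" by (auto simp: C_def)
  have [measurable]: "C \<in> sets borel"
    unfolding C_eq by (intro sets.finite_UN finite_cell_neighbours) measurable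
  have [measurable]: "p \<in> borel_measurable borel" unfolding p_def by measurable
  have p_le: "p u \<le> 1" for u unfolding p_def by (rule emeasure_le_1)
  have p_eq: "p u = emeasure M {\<omega>\<in>space M. Y u \<omega> \<in> ball 0 r}" if "0 \<le> u" for u
  proof -
    have [measurable]: "Y u \<in> borel_measurable M" by (rule Y_measurable[OF that])
    show ?thesis unfolding p_def using W_eq_at[OF that] by (intro emeasure_eq_AE) auto
  qed
  have A_disj: "i = j" if "\<omega> \<in> A i" "\<omega> \<in> A j" for i j \<omega>
    using that by (cases i j rule: linorder_cases) (auto simp: A_def)
  have hit: "{\<omega>\<in>space M. \<exists>j\<le>N * 2 ^ m. cell r (Y (real j / 2 ^ m) \<omega>) = z} = (\<Union>j\<in>{..J}. A j)"
  proof (intro equalityI subsetI)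
    fix \<omega> assume "\<omega> \<in> {\<omega>\<in>space M. \<exists>j\<le>N * 2 ^ m. cell r (Y (real j / 2 ^ m) \<omega>) = z}"
    then obtain j where j: "\<omega> \<in> space M" "j \<le> J" "cell r (Y (t j) \<omega>) = z" by (auto simp: t_def J_def)
    define k where "k = (LEAST j. cell r (Y (t j) \<omega>) = z)"
    have "cell r (Y (t k) \<omega>) = z" unfolding k_def using j(3) by (rule LeastI)
    moreover have "k \<le> j" unfolding k_def using j(3) by (rule Least_le)
    moreover have "\<forall>i<k. cell r (Y (t i) \<omega>) \<noteq> z" unfolding k_def using not_less_Least by blast
    ultimately show "\<omega> \<in> (\<Union>j\<in>{..J}. A j)" using j by (auto simp: A_def intro!: bexI[of _ k])
  qed (auto simp: A_def t_def J_def)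
  define a where "a s j = p (s - t j) * indicator {t j..} s" for s j
  have [measurable]: "(\<lambda>s. a s j) \<in> borel_measurable borel" for j unfolding a_def by measurable
  have step: "(\<Sum>j\<le>J. emeasure M (A j) * (a s j)) \<le> emeasure M {\<omega>\<in>space M. Y s \<omega> \<in> C}"
    if s: "0 \<le> s" for s
  proof -
    have [measurable]: "Y s \<in> borel_measurable M" by (rule Y_measurable[OF s])
    define Q where "Q j = {\<omega>\<in>A j. t j \<le> s \<and> norm (Y s \<omega> - Y (t j) \<omega>) < r}" for j
    have Q_eq: "Q j = A j \<inter> {\<omega>\<in>space M. t j \<le> s \<and> norm (Y s \<omega> - Y (t j) \<omega>) < r}" for j
      by (auto simp: Q_def A_def)
    have [measurable]: "Q j \<in> sets M" for j unfolding Q_eq by measurable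
    have le: "emeasure M (A j) * (a s j) \<le> emeasure M (Q j)" for j
    proof -
      consider "s < t j" | "s = t j" | "t j < s" by linarith
      then show ?thesis
      proof cases
        \<comment> \<open>Independence of the past is stated for strictly increasing times, so the
          lag 0 is treated by hand, with \<open>p \<le> 1\<close>.\<close>
        case 2
        then have "Q j = A j" using assms by (auto simp: Q_def)
        moreover have "emeasure M (A j) * p (s - t j) \<le> emeasure M (A j) * 1"
          using p_le by (intro mult_left_mono) auto
        ultimately show ?thesis using 2 by (simp add: a_def)
      next
        case 3
        define x where "x i = (if i \<le> j then t i else s)" for i
        define P where "P g \<longleftrightarrow> cell r (g j) = z \<and> (\<forall>i<j. cell r (g i) \<noteq> z)" for g :: "nat \<Rightarrow> 'a"
        have x: "x (Suc j) = s" "x j = t j" by (auto simp: x_def)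
        have PA: "{\<omega>\<in>space M. P (\<lambda>i. Y (x i) \<omega>)} = A j"
          by (auto simp: P_def A_def x_def)
        have "emeasure M {\<omega>\<in>space M. P (\<lambda>i. Y (x i) \<omega>) \<and> Y (x (Suc j)) \<omega> - Y (x j) \<omega> \<in> ball 0 r}
          = emeasure M {\<omega>\<in>space M. P (\<lambda>i. Y (x i) \<omega>)} * emeasure M {\<omega>\<in>space M. Y (x (Suc j) - x j) \<omega> \<in> ball 0 r}"
        proof (rule indep_increment_of_past)
          show "x 0 = 0" by (simp add: x_def t)
          show "x i < x (Suc i)" if "i \<le> j" for i
            using that 3 t(3)[of i] by (cases "i = j") (auto simp: x_def)
          \<comment> \<open>Beyond \<open>j\<close> the partial sums would involve coordinates
            outside \<open>{..<j}\<close>; they are cut to 0 there, where \<open>P\<close> does not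
            look.\<close>
          define h where "h i f = (if i \<le> j then \<Sum>k<i. f k else 0)" for i and f :: "nat \<Rightarrow> 'a"
          have [measurable]: "h i \<in> borel_measurable (Pi\<^sub>M {..<j} (\<lambda>_. borel))" for i
            unfolding h_def
            by (cases "i \<le> j") (auto intro!: borel_measurable_sum measurable_component_singleton)
          have "(\<lambda>f. P (\<lambda>i. \<Sum>k<i. f k :: 'a)) = (\<lambda>f. P (\<lambda>i. h i f))"
            by (auto simp: P_def h_def)
          also have "Measurable.pred (Pi\<^sub>M {..<j} (\<lambda>_. borel)) \<dots>"
            unfolding P_def by measurable
          finally show "Measurable.pred (Pi\<^sub>M {..<j} (\<lambda>_. borel)) (\<lambda>f. P (\<lambda>i. \<Sum>k<i. f k :: 'a))" .
          show "{\<omega>\<in>space M. P (\<lambda>i. Y (x i) \<omega>)} \<in> sets M" unfolding PA by measurable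
        qed (auto simp: P_def)
        moreover have "{\<omega>\<in>space M. P (\<lambda>i. Y (x i) \<omega>) \<and> Y (x (Suc j)) \<omega> - Y (x j) \<omega> \<in> ball 0 r} = Q j"
          using 3 PA by (auto simp: Q_def x)
        ultimately show ?thesis using 3 by (simp add: PA x p_eq a_def)
      qed (simp add: a_def)
    qed
    have "(\<Sum>j\<le>J. emeasure M (A j) * (a s j)) \<le> (\<Sum>j\<le>J. emeasure M (Q j))"
      by (intro sum_mono le)
    also have "\<dots> = emeasure M (\<Union>j\<le>J. Q j)"
      using A_disj by (intro sum_emeasure) (auto simp: disjoint_family_on_def Q_def)
    also have "\<dots> \<le> emeasure M {\<omega>\<in>space M. Y s \<omega> \<in> C}"
    proof (intro emeasure_mono subsetI)
      fix \<omega> assume "\<omega> \<in> (\<Union>j\<le>J. Q j)"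
      then obtain j where "\<omega> \<in> A j" "norm (Y (t j) \<omega> - Y s \<omega>) < r" by (auto simp: Q_def norm_minus_commute)
      moreover from cell_neighbour[OF this(2)] obtain e
        where "e \<in> cell_neighbours" "cell r (Y s \<omega>) = cell r (Y (t j) \<omega>) + e" .
      ultimately show "\<omega> \<in> {\<omega>\<in>space M. Y s \<omega> \<in> C}" by (auto simp: A_def C_def)
    qed measurable
    finally show ?thesis .
  qed
  \<comment> \<open>Substituting \<open>s = c + u\<close> splits off the discount
    \<open>exp (- c)\<close> accumulated before the cell is entered.\<close>
  have shift: "(\<integral>\<^sup>+s. ennreal (exp (- s)) * (p (s - c) * indicator {c..} s) \<partial>lborel)
    = ennreal (exp (- c)) * emeasure potential (ball 0 r)" for c
  proof -
    have "(\<integral>\<^sup>+s. ennreal (exp (- s)) * (p (s - c) * indicator {c..} s) \<partial>lborel)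
      = (\<integral>\<^sup>+u. ennreal (exp (- (c + u))) * (p u * indicator {0..} u) \<partial>lborel)"
      using nn_integral_real_affine[of "\<lambda>s. ennreal (exp (- s)) * (p (s - c) * indicator {c..} s)" 1 c]
      by (simp add: indicator_def)
    also have "\<dots> = (\<integral>\<^sup>+u. ennreal (exp (- c)) * (ennreal (exp (- u)) * p u * indicator {0..} u) \<partial>lborel)"
    proof -
      have "ennreal (exp (- (c + u))) = ennreal (exp (- c)) * ennreal (exp (- u))" for u
        by (simp add: mult_exp_exp flip: ennreal_mult')
      then show ?thesis by (simp only: mult.assoc)
    qed
    also have "\<dots> = ennreal (exp (- c)) * (\<integral>\<^sup>+u. ennreal (exp (- u)) * p u * indicator {0..} u \<partial>lborel)"
      by (rule nn_integral_cmult) measurable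
    also have "(\<integral>\<^sup>+u. ennreal (exp (- u)) * p u * indicator {0..} u \<partial>lborel) = emeasure potential (ball 0 r)"
      by (subst emeasure_potential) (auto intro!: nn_integral_cong split: split_indicator simp: p_eq)
    finally show ?thesis .
  qed
  have "emeasure M (\<Union>j\<in>{..J}. A j) * b
    = (\<Sum>j\<le>J. emeasure M (A j)) * b"
    using A_disj by (subst sum_emeasure) (auto simp: disjoint_family_on_def)
  also have "\<dots> = (\<Sum>j\<le>J. emeasure M (A j) * b)"
    by (rule sum_distrib_right)
  also have "\<dots> \<le> (\<Sum>j\<le>J. emeasure M (A j) * (ennreal (exp (- t j)) * emeasure potential (ball 0 r)))"
    unfolding b_def using t_le by (intro sum_mono mult_left_mono mult_right_mono ennreal_leI) auto
  also have "\<dots> = (\<Sum>j\<le>J. \<integral>\<^sup>+s. emeasure M (A j) * (ennreal (exp (- s)) * (a s j)) \<partial>lborel)"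
    by (intro sum.cong refl) (simp add: nn_integral_cmult shift a_def)
  also have "\<dots> = (\<integral>\<^sup>+s. (\<Sum>j\<le>J. emeasure M (A j) * (ennreal (exp (- s)) * (a s j))) \<partial>lborel)"
    by (rule nn_integral_sum[symmetric]) measurable
  also have "\<dots> \<le> (\<integral>\<^sup>+s\<in>{0..}. ennreal (exp (- s)) * emeasure M {\<omega>\<in>space M. Y s \<omega> \<in> C} \<partial>lborel)"
  proof (intro nn_integral_mono)
    fix s :: real
    show "(\<Sum>j\<le>J. emeasure M (A j) * (ennreal (exp (- s)) * (a s j)))
      \<le> ennreal (exp (- s)) * emeasure M {\<omega>\<in>space M. Y s \<omega> \<in> C} * indicator {0..} s"
    proof (cases "0 \<le> s")
      case True
      have "(\<Sum>j\<le>J. emeasure M (A j) * (ennreal (exp (- s)) * (a s j)))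
        = ennreal (exp (- s)) * (\<Sum>j\<le>J. emeasure M (A j) * (a s j))"
        by (simp add: sum_distrib_left mult.left_commute)
      also have "\<dots> \<le> ennreal (exp (- s)) * emeasure M {\<omega>\<in>space M. Y s \<omega> \<in> C}"
        by (intro mult_left_mono step True) auto
      finally show ?thesis using True by simp
    next
      case False
      then have "\<not> t j \<le> s" for j using t(1)[of j] by linarith
      then show ?thesis by (simp add: a_def)
    qed
  qed
  also have "\<dots> = emeasure potential C" by (rule emeasure_potential[symmetric]) measurable
  finally show ?thesis unfolding hit C_def b_def .
qed

end

section \<open>Decay of the potential of balls and finiteness of the energy\<close>

lemma nn_integral_exp_neg_sq_le:
  fixes U :: "'a::euclidean_space measure"
  assumes "prob_space U" and [measurable_cong]: "sets U = sets borel" and "0 \<le> s" "0 \<le> \<rho>"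
  shows "(\<integral>\<^sup>+x. ennreal (exp (- s * (norm x)\<^sup>2)) \<partial>U) \<le> emeasure U (ball 0 \<rho>) + ennreal (exp (- s * \<rho>\<^sup>2))"
proof -
  interpret prob_space U by fact
  have "(\<integral>\<^sup>+x. ennreal (exp (- s * (norm x)\<^sup>2)) \<partial>U) \<le> (\<integral>\<^sup>+x. indicator (ball 0 \<rho>) x + ennreal (exp (- s * \<rho>\<^sup>2)) \<partial>U)"
  proof (intro nn_integral_mono)
    fix x :: 'a
    have "exp (- s * (norm x)\<^sup>2) \<le> exp (- s * \<rho>\<^sup>2)" if "\<rho> \<le> norm x"
      using that assms(3,4) by (auto intro!: mult_left_mono power_mono)
    moreover have "exp (- s * (norm x)\<^sup>2) \<le> 1" using assms(3) by simp
    ultimately show "ennreal (exp (- s * (norm x)\<^sup>2)) \<le> indicator (ball 0 \<rho>) x + ennreal (exp (- s * \<rho>\<^sup>2))"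
      by (auto split: split_indicator intro!: ennreal_leI simp: ennreal_le_1 intro: add_increasing2)
  qed
  also have "\<dots> = emeasure U (ball 0 \<rho>) + ennreal (exp (- s * \<rho>\<^sup>2))"
  proof -
    have [measurable]: "ball 0 \<rho> \<in> sets U" by (simp add: assms(2))
    show ?thesis by (subst nn_integral_add) (auto simp: emeasure_space_1)
  qed
  finally show ?thesis .
qed

text \<open>Only large \<open>s\<close> matters, since the inner integral is at most 1. There space
  is split at a radius slightly larger than the natural scale \<open>s powr (- 1 / 2)\<close>: the
  ball is small by \<open>decay\<close>, and outside it the Gaussian is smaller than any power of
  \<open>s\<close>.\<close>

lemma riesz_potential_finite_if_ball_decay:
  fixes U :: "'a::euclidean_space measure"
  assumes "prob_space U" "sets U = sets borel"
    and decay: "\<And>r. 0 < r \<Longrightarrow> emeasure U (ball 0 r) \<le> ennreal (C * r powr \<gamma>)"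
    and "0 < \<gamma>'" "\<gamma>' < \<gamma>" "0 \<le> C"
  shows "riesz_energy \<gamma>' U < \<infinity>"
proof -
  interpret prob_space U by fact
  note [measurable_cong] = assms(2)
  \<comment> \<open>\<open>\<beta>\<close> is the midpoint of \<open>\<gamma>' / 2\<close> and
    \<open>\<gamma> / 2\<close>. The choice of \<open>e\<close> makes the radius
    \<open>s powr (e - 1 / 2)\<close>, raised to \<open>\<gamma>\<close>, equal to
    \<open>s powr - \<beta>\<close>; the choice of \<open>a\<close> gives the tail
    \<open>exp (- (s powr (2 * e)))\<close> the same order.\<close>
  define e where "e = (\<gamma> - \<gamma>') / (4 * \<gamma>)"
  define \<beta> where "\<beta> = (\<gamma> + \<gamma>') / 4"
  define a where "a = \<beta> / (2 * e)"
  have e: "0 < e" using assms by (simp add: e_def)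
  have \<beta>: "\<gamma>' / 2 < \<beta>" "0 < \<beta>" using assms by (auto simp: \<beta>_def)
  have a: "0 < a" using e \<beta> by (simp add: a_def)
  let ?f = "\<lambda>s. \<integral>\<^sup>+x. ennreal (exp (- s * (norm x)\<^sup>2)) \<partial>U"
  define K where "K = C + a powr a"
  have K: "0 \<le> K" using assms(6) by (simp add: K_def)
  have f_le: "?f s \<le> ennreal (K * s powr - \<beta>)" if s: "1 \<le> s" for s
  proof -
    define \<rho> where "\<rho> = s powr (e - 1 / 2)"
    have \<rho>: "0 < \<rho>" using s by (simp add: \<rho>_def)
    have "(e - 1 / 2) * \<gamma> = - \<beta>"
      using assms(4,5) by (simp add: e_def \<beta>_def field_simps)
    then have 1: "\<rho> powr \<gamma> = s powr - \<beta>"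
      by (simp add: \<rho>_def powr_powr)
    have "\<rho>\<^sup>2 = s powr (2 * e - 1)"
      using s by (simp add: \<rho>_def powr_powr algebra_simps flip: powr_numeral)
    then have "s * \<rho>\<^sup>2 = s powr (2 * e)" using s by (simp add: powr_diff)
    then have "exp (- s * \<rho>\<^sup>2) \<le> a powr a * (s powr (2 * e)) powr - a"
      using powr_mult_exp_minus_le[OF a, of "s powr (2 * e)"] s by simp
    also have "(s powr (2 * e)) powr - a = s powr - \<beta>"
      using e by (simp add: powr_powr a_def)
    finally have 2: "exp (- s * \<rho>\<^sup>2) \<le> a powr a * s powr - \<beta>" .
    have "?f s \<le> emeasure U (ball 0 \<rho>) + ennreal (exp (- s * \<rho>\<^sup>2))"
      using s \<rho> by (intro nn_integral_exp_neg_sq_le assms) auto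
    also have "\<dots> \<le> ennreal (C * s powr - \<beta>) + ennreal (a powr a * s powr - \<beta>)"
      using decay[OF \<rho>] 1 2 by (intro add_mono ennreal_leI) auto
    also have "\<dots> = ennreal (K * s powr - \<beta>)"
      using assms(6) by (simp add: K_def distrib_right)
    finally show ?thesis .
  qed
  have f_le_1: "?f s \<le> 1" if "0 \<le> s" for s
  proof -
    have "?f s \<le> (\<integral>\<^sup>+x. 1 \<partial>U)" using that by (intro nn_integral_mono) (auto simp: ennreal_le_1)
    then show ?thesis by (simp add: emeasure_space_1)
  qed
  have "riesz_energy \<gamma>' U
    \<le> (\<integral>\<^sup>+s. ennreal (s powr (\<gamma>' / 2 - 1)) * indicator {0<..1} s
        + ennreal K * (ennreal (s powr (- (\<beta> - \<gamma>' / 2) - 1)) * indicator {1..} s) \<partial>lborel)"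
    unfolding riesz_energy_def
  proof (intro nn_integral_mono)
    fix s :: real
    consider "s \<le> 0" | "0 < s" "s < 1" | "1 \<le> s" by linarith
    then show "ennreal (s powr (\<gamma>' / 2 - 1)) * ?f s * indicator {0<..} s
      \<le> ennreal (s powr (\<gamma>' / 2 - 1)) * indicator {0<..1} s
        + ennreal K * (ennreal (s powr (- (\<beta> - \<gamma>' / 2) - 1)) * indicator {1..} s)"
    proof cases
      case 2
      have "ennreal (s powr (\<gamma>' / 2 - 1)) * ?f s \<le> ennreal (s powr (\<gamma>' / 2 - 1)) * 1"
        using 2 by (intro mult_left_mono f_le_1) auto
      then show ?thesis using 2 by simp
    next
      case 3
      have "ennreal (s powr (\<gamma>' / 2 - 1)) * ?f s \<le> ennreal (s powr (\<gamma>' / 2 - 1)) * ennreal (K * s powr - \<beta>)"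
        by (intro mult_left_mono f_le 3) auto
      also have "\<dots> = ennreal K * ennreal (s powr (\<gamma>' / 2 - 1) * s powr - \<beta>)"
        using K by (simp add: mult_ac flip: ennreal_mult')
      also have "s powr (\<gamma>' / 2 - 1) * s powr - \<beta> = s powr (- (\<beta> - \<gamma>' / 2) - 1)"
        by (rule powr_mult_powr_eq) simp
      finally show ?thesis using 3 by (auto intro: add_increasing)
    qed simp
  qed
  also have "\<dots> = ennreal (1 / (\<gamma>' / 2)) + ennreal K * ennreal (1 / (\<beta> - \<gamma>' / 2))"
    using nn_integral_powr_at_zero[of "\<gamma>' / 2" 1] nn_integral_powr_at_top[of "\<beta> - \<gamma>' / 2" 1] \<beta> assms
    by (simp add: nn_integral_add nn_integral_cmult)
  also have "\<dots> < \<infinity>" by (simp add: ennreal_mult_less_top)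
  finally show ?thesis .
qed

context levy_potential
begin

text \<open>Restricting to dyadic times up to \<open>N\<close> keeps the event measurable;
  right-continuity and the closures of the cells account for the other times.\<close>

definition visits :: "nat \<Rightarrow> real \<Rightarrow> 'a \<Rightarrow> 'w set" where
  "visits N r z = {\<omega>\<in>space M. \<exists>m. \<exists>j\<le>N * 2 ^ m. cell r (Y (real j / 2 ^ m) \<omega>) = z}"

text \<open>A cardinality written as an integral over counting measure: it may be infinite, and its
  expectation can be exchanged with the sum over cells.\<close>

definition visited_cells :: "nat \<Rightarrow> real \<Rightarrow> 'w \<Rightarrow> ennreal" where
  "visited_cells N r \<omega> = (\<integral>\<^sup>+z. indicator (visits N r z) \<omega> \<partial>count_space int_lattice)"

lemma sets_visits [measurable]: "visits N r z \<in> sets M"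
proof -
  have [measurable]: "Y (real j / 2 ^ m) \<in> borel_measurable M" for j m by (rule Y_measurable) simp
  show ?thesis unfolding visits_def by measurable
qed

lemma borel_measurable_visited_cells [measurable]: "visited_cells N r \<in> borel_measurable M"
proof -
  interpret C: sigma_finite_measure "count_space (int_lattice :: 'a set)"
    by (rule sigma_finite_measure_count_space_countable[OF countable_int_lattice])
  have "(\<lambda>(\<omega>, z). indicator (visits N r z) \<omega> :: ennreal) \<in> borel_measurable (M \<Otimes>\<^sub>M count_space int_lattice)"
    by (subst measurable_pair_swap_iff, rule measurable_pair_measure_countable1)
      (auto simp: countable_int_lattice split_beta)
  then show ?thesis unfolding visited_cells_def by (rule C.borel_measurable_nn_integral)
qed

text \<open>Monotone limit over refining grids; index \<open>j\<close> on one grid becomes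
  \<open>2 * j\<close> on the next.\<close>

lemma visits_potential:
  assumes "0 < r"
  shows "emeasure M (visits N r z) * (ennreal (exp (- real N)) * emeasure potential (ball 0 r))
    \<le> emeasure potential {x. \<exists>e\<in>cell_neighbours. cell r x = z + e}"
proof -
  define H where "H m = {\<omega>\<in>space M. \<exists>j\<le>N * 2 ^ m. cell r (Y (real j / 2 ^ m) \<omega>) = z}" for m
  have [measurable]: "Y (real j / 2 ^ m) \<in> borel_measurable M" for j m by (rule Y_measurable) simp
  have [measurable]: "H m \<in> sets M" for m unfolding H_def by measurable
  have "incseq H"
  proof (rule incseq_SucI, rule subsetI)
    fix m \<omega> assume "\<omega> \<in> H m"
    then obtain j where "\<omega> \<in> space M" "j \<le> N * 2 ^ m" "cell r (Y (real j / 2 ^ m) \<omega>) = z"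
      by (auto simp: H_def)
    then show "\<omega> \<in> H (Suc m)" by (auto simp: H_def intro!: exI[of _ "2 * j"])
  qed
  then have "emeasure M (visits N r z) = (SUP m. emeasure M (H m))"
    by (subst SUP_emeasure_incseq) (auto simp: visits_def H_def intro!: arg_cong[where f="emeasure M"])
  also have "\<dots> * (ennreal (exp (- real N)) * emeasure potential (ball 0 r))
    = (SUP m. emeasure M (H m) * (ennreal (exp (- real N)) * emeasure potential (ball 0 r)))"
    by (rule SUP_mult_right_ennreal)
  also have "\<dots> \<le> emeasure potential {x. \<exists>e\<in>cell_neighbours. cell r x = z + e}"
    using first_hit_potential[OF assms, of N _ z] by (intro SUP_least) (simp add: H_def)
  finally show ?thesis .
qed

text \<open>
  Once a cell is entered, the process spends potential time at least \<open>U(ball 0 r)\<close> in the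
  neighbouring cells, up to the discount factor; but the total potential mass is 1.
\<close>

lemma expected_visited_cells:
  assumes "0 < r"
  shows "(\<integral>\<^sup>+\<omega>. visited_cells N r \<omega> \<partial>M) * (ennreal (exp (- real N)) * emeasure potential (ball 0 r))
    \<le> of_nat (card (cell_neighbours :: 'a set))"
proof -
  interpret U: prob_space potential by (rule prob_space_potential)
  define c where "c = ennreal (exp (- real N)) * emeasure potential (ball 0 r)"
  have "(\<integral>\<^sup>+\<omega>. visited_cells N r \<omega> \<partial>M) = (\<integral>\<^sup>+z. (\<integral>\<^sup>+\<omega>. indicator (visits N r z) \<omega> \<partial>M) \<partial>count_space int_lattice)"
    unfolding visited_cells_def
    by (rule nn_integral_count_space_nn_integral) (auto simp: countable_int_lattice)
  also have "\<dots> = (\<integral>\<^sup>+z. emeasure M (visits N r z) \<partial>count_space int_lattice)" by simp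
  finally have "(\<integral>\<^sup>+\<omega>. visited_cells N r \<omega> \<partial>M) * c = (\<integral>\<^sup>+z. emeasure M (visits N r z) * c \<partial>count_space int_lattice)"
    by (simp add: nn_integral_multc)
  also have "\<dots> \<le> (\<integral>\<^sup>+z. (\<Sum>e\<in>cell_neighbours. emeasure potential {x. cell r x = z + e}) \<partial>count_space int_lattice)"
  proof (intro nn_integral_mono)
    fix z :: 'a
    have "emeasure M (visits N r z) * c \<le> emeasure potential {x. \<exists>e\<in>cell_neighbours. cell r x = z + e}"
      unfolding c_def by (rule visits_potential[OF assms])
    also have "{x. \<exists>e\<in>cell_neighbours. cell r x = z + e} = (\<Union>e\<in>cell_neighbours. {x. cell r x = z + e})" by auto
    also have "emeasure potential \<dots> \<le> (\<Sum>e\<in>cell_neighbours. emeasure potential {x. cell r x = z + e})"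
      by (rule emeasure_subadditive_finite) (auto simp: finite_cell_neighbours sets_potential)
    finally show "emeasure M (visits N r z) * c \<le> (\<Sum>e\<in>cell_neighbours. emeasure potential {x. cell r x = z + e})" .
  qed
  also have "\<dots> = (\<Sum>e\<in>cell_neighbours. \<integral>\<^sup>+z. emeasure potential {x. cell r x = z + e} \<partial>count_space int_lattice)"
    by (rule nn_integral_sum) simp
  also have "\<dots> \<le> (\<Sum>e\<in>(cell_neighbours :: 'a set). 1)"
  proof (intro sum_mono)
    fix e :: 'a
    \<comment> \<open>For a fixed offset \<open>e\<close> the cells \<open>z + e\<close> are
      disjoint, so each offset contributes at most the total mass 1.\<close>
    have "(\<integral>\<^sup>+z. emeasure potential {x. cell r x = z + e} \<partial>count_space int_lattice)
      = emeasure potential (\<Union>z\<in>int_lattice. {x. cell r x = z + e})"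
      by (rule emeasure_UN_countable[symmetric])
        (auto simp: countable_int_lattice sets_potential disjoint_family_on_def)
    then show "(\<integral>\<^sup>+z. emeasure potential {x. cell r x = z + e} \<partial>count_space int_lattice) \<le> 1"
      using U.emeasure_le_1 by simp
  qed
  finally show ?thesis by (simp add: c_def)
qed

text \<open>Every point of the path is a limit of values at dyadic times, which lie in visited
  cells. A finite union of closed cells contains such limits; with infinitely many visited cells the
  right side is infinite.\<close>

lemma hausdorff_content_range_le:
  fixes r \<delta> T :: real
  assumes "cadlag (\<lambda>t. Y t \<omega>)" "\<omega> \<in> space M" "0 < r" "DIM('a) * r \<le> \<delta>" "0 < \<gamma>" "T + 1 \<le> real N"
  shows "hausdorff_content \<delta> \<gamma> ((\<lambda>t. Y t \<omega>) ` {0..T}) \<le> visited_cells N r \<omega> * ennreal ((DIM('a) * r) powr \<gamma>)"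
proof -
  define S where "S = {z\<in>int_lattice. \<omega> \<in> visits N r z}"
  define V where "V z = closure {x. cell r x = z}" for z :: 'a
  have "visited_cells N r \<omega> = (\<integral>\<^sup>+z. indicator S z \<partial>count_space int_lattice)"
    unfolding visited_cells_def by (intro nn_integral_cong) (auto simp: S_def split: split_indicator)
  also have "\<dots> = emeasure (count_space int_lattice) S" by (rule nn_integral_indicator) (auto simp: S_def)
  finally have vc: "visited_cells N r \<omega> = emeasure (count_space int_lattice) S" .
  show ?thesis
  proof (cases "finite S")
    case False
    then have "visited_cells N r \<omega> = \<infinity>"
      unfolding vc by (subst emeasure_count_space_infinite) (auto simp: S_def)
    then show ?thesis using assms by (simp add: ennreal_top_mult)
  next
    case True
    have bd: "bounded {x. cell r x = z} \<and> diameter {x. cell r x = z} \<le> DIM('a) * r" for z :: 'a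
    proof (cases "{x. cell r x = z} = {}")
      case False
      then obtain x where "cell r x = z" by auto
      then have "\<forall>y\<in>{x. cell r x = z}. dist x y \<le> DIM('a) * r" using assms(3) by (auto intro: dist_le_if_cell_eq)
      then have "bounded {x. cell r x = z}" unfolding bounded_def by blast
      moreover have "diameter {x. cell r x = z} \<le> DIM('a) * r"
        using False assms(3) by (intro diameter_leI) (auto intro: dist_le_if_cell_eq)
      ultimately show ?thesis by simp
    qed (use assms(3) in simp)
    have "hausdorff_content \<delta> \<gamma> ((\<lambda>t. Y t \<omega>) ` {0..T}) \<le> ennreal (card S * (DIM('a) * r) powr \<gamma>)"
    proof (rule hausdorff_content_finite_cover)
      show "finite S" by fact
      show "bounded (V z)" "diameter (V z) \<le> DIM('a) * r" for z
        using bd[of z] by (auto simp: V_def diameter_closure)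
      show "(\<lambda>t. Y t \<omega>) ` {0..T} \<subseteq> (\<Union>z\<in>S. V z)"
      proof safe
        fix t assume t: "t \<in> {0..T}"
        have "dyadic_above m t \<in> (\<lambda>j. real j / 2 ^ m) ` {..N * 2 ^ m}" for m
        proof
          define j where "j = nat (\<lfloor>2 ^ m * t\<rfloor> + 1)"
          have pos: "0 \<le> \<lfloor>2 ^ m * t\<rfloor>" using t by simp
          then show "dyadic_above m t = real j / 2 ^ m" by (simp add: dyadic_above_def j_def)
          \<comment> \<open>The approximating time may exceed \<open>t\<close> by one grid step,
            hence the slack in \<open>T + 1 \<le> real N\<close>.\<close>
          have "real j \<le> 2 ^ m * t + 1" using pos by (simp add: j_def)
          also have "\<dots> \<le> 2 ^ m * T + 2 ^ m * 1" using t by (intro add_mono mult_left_mono) auto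
          also have "\<dots> \<le> 2 ^ m * real N"
            using mult_left_mono[OF assms(6), of "2 ^ m"] by (simp add: distrib_left)
          finally have "real j \<le> real (N * 2 ^ m)" by (simp add: mult.commute)
          then show "j \<in> {..N * 2 ^ m}" by (simp only: of_nat_le_iff atMost_iff)
        qed
        then have "Y (dyadic_above m t) \<omega> \<in> (\<Union>z\<in>S. V z)" for m
        proof -
          obtain j where j: "j \<le> N * 2 ^ m" "dyadic_above m t = real j / 2 ^ m"
            using \<open>\<And>m. dyadic_above m t \<in> (\<lambda>j. real j / 2 ^ m) ` {..N * 2 ^ m}\<close>[of m] by auto
          define z where "z = cell r (Y (dyadic_above m t) \<omega>)"
          have "z \<in> S" using j assms(2) by (auto simp: S_def visits_def z_def cell_in_int_lattice)
          moreover have "Y (dyadic_above m t) \<omega> \<in> V z"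
            unfolding V_def by (rule subsetD[OF closure_subset]) (simp add: z_def)
          ultimately show ?thesis by blast
        qed
        moreover have "closed (\<Union>z\<in>S. V z)" using True by (auto simp: V_def intro!: closed_UN)
        moreover have "(\<lambda>m. Y (dyadic_above m t) \<omega>) \<longlonglongrightarrow> Y t \<omega>"
          using assms(1) t by (intro cadlag_dyadic_above) auto
        ultimately show "Y t \<omega> \<in> (\<Union>z\<in>S. V z)"
          by (meson closed_sequentially)
      qed
    qed (use assms in auto)
    then show ?thesis
      using True by (simp add: vc S_def ennreal_mult' ennreal_of_nat_eq_real_of_nat)
  qed
qed

text \<open>Along suitable scales \<open>r k\<close> the expected cost of covering the range by
  visited cells is of order \<open>(1 / 2) ^ k\<close>. By Fatou the lower limit of the cost
  vanishes almost surely, and one sequence of scales tending to 0 is enough for a null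
  measure.\<close>

lemma AE_hausdorff_measure_range_zero:
  assumes "0 < \<gamma>"
    and small: "\<And>\<epsilon> \<delta>. 0 < \<epsilon> \<Longrightarrow> 0 < \<delta> \<Longrightarrow>
      \<exists>r. 0 < r \<and> r < \<delta> \<and> ennreal (r powr \<gamma>) < ennreal \<epsilon> * emeasure potential (ball 0 r)"
  shows "AE \<omega> in M. hausdorff_measure \<gamma> ((\<lambda>t. Y t \<omega>) ` {0..T}) = 0"
proof -
  interpret U: prob_space potential by (rule prob_space_potential)
  obtain N :: nat where N: "T + 1 \<le> real N" using real_arch_simple by blast
  have "\<exists>r. 0 < r \<and> r < (1 / 2) ^ k \<and> ennreal (r powr \<gamma>) < ennreal ((1 / 2) ^ k) * emeasure potential (ball 0 r)" for k :: nat
    by (rule small) auto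
  then obtain r where r: "\<And>k. 0 < r k" "\<And>k::nat. r k < (1 / 2) ^ k"
    "\<And>k. ennreal (r k powr \<gamma>) < ennreal ((1 / 2) ^ k) * emeasure potential (ball 0 (r k))" by metis
  define d where "d = real DIM('a)"
  have d: "0 < d" by (simp add: d_def)
  define X where "X k \<omega> = visited_cells N (r k) \<omega> * ennreal ((d * r k) powr \<gamma>)" for k \<omega>
  have [measurable]: "X k \<in> borel_measurable M" for k unfolding X_def by measurable
  \<comment> \<open>The factors stem from the number of neighbouring cells, the bound
    \<open>d * r k\<close> on the diameter of a cell, and the discount
    \<open>exp (- real N)\<close>.\<close>
  define c where "c = real (card (cell_neighbours :: 'a set)) * d powr \<gamma> * exp (real N)"
  have EX: "(\<integral>\<^sup>+\<omega>. X k \<omega> \<partial>M) \<le> ennreal (c * (1 / 2) ^ k)" for k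
  proof -
    define u where "u = measure potential (ball 0 (r k))"
    have u: "emeasure potential (ball 0 (r k)) = ennreal u" by (simp add: u_def U.emeasure_eq_measure)
    have u_pos: "r k powr \<gamma> < (1 / 2) ^ k * u"
      using r(3)[of k] unfolding u by (simp add: u_def ennreal_less_iff flip: ennreal_mult')
    then have "0 < (1 / 2) ^ k * u" by (rule le_less_trans[rotated]) simp
    then have "0 < u" by (simp add: zero_less_mult_iff)
    let ?V = "\<integral>\<^sup>+\<omega>. visited_cells N (r k) \<omega> \<partial>M"
    have V: "?V * ennreal (exp (- real N) * u) \<le> ennreal (card (cell_neighbours :: 'a set))"
      using expected_visited_cells[OF r(1)[of k], of N] \<open>0 < u\<close>
      by (simp add: u ennreal_mult' ennreal_of_nat_eq_real_of_nat)
    have "(\<integral>\<^sup>+\<omega>. X k \<omega> \<partial>M) = ?V * ennreal ((d * r k) powr \<gamma>)"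
      unfolding X_def by (rule nn_integral_multc) measurable
    also have "\<dots> \<le> ?V * ennreal ((exp (- real N) * u) * (d powr \<gamma> * exp (real N) * (1 / 2) ^ k))"
    proof (intro mult_left_mono ennreal_leI)
      have "d powr \<gamma> * r k powr \<gamma> \<le> d powr \<gamma> * ((1 / 2) ^ k * u)" using u_pos by (intro mult_left_mono) auto
      moreover have "(exp (- real N) * u) * (d powr \<gamma> * exp (real N) * (1 / 2) ^ k) = d powr \<gamma> * ((1 / 2) ^ k * u)"
        by (simp add: exp_minus field_simps)
      moreover have "(d * r k) powr \<gamma> = d powr \<gamma> * r k powr \<gamma>"
        using d r(1)[of k] by (simp add: powr_mult)
      ultimately show "(d * r k) powr \<gamma> \<le> (exp (- real N) * u) * (d powr \<gamma> * exp (real N) * (1 / 2) ^ k)"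
        by (simp only:)
    qed simp
    also have "\<dots> = ?V * ennreal (exp (- real N) * u) * ennreal (d powr \<gamma> * exp (real N) * (1 / 2) ^ k)"
      using \<open>0 < u\<close> by (simp add: ennreal_mult mult.assoc)
    also have "\<dots> \<le> ennreal (card (cell_neighbours :: 'a set)) * ennreal (d powr \<gamma> * exp (real N) * (1 / 2) ^ k)"
      by (intro mult_right_mono V) simp
    also have "\<dots> = ennreal (c * (1 / 2) ^ k)" by (simp add: c_def mult_ac flip: ennreal_mult')
    finally show ?thesis .
  qed
  have "(\<integral>\<^sup>+\<omega>. liminf (\<lambda>k. X k \<omega>) \<partial>M) \<le> liminf (\<lambda>k. \<integral>\<^sup>+\<omega>. X k \<omega> \<partial>M)"
    by (rule nn_integral_liminf) measurable
  also have "\<dots> \<le> liminf (\<lambda>k. ennreal (c * (1 / 2) ^ k))"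
    by (intro Liminf_mono always_eventually allI EX)
  also have "\<dots> = 0"
  proof (rule lim_imp_Liminf)
    have "(\<lambda>k. c * (1 / 2) ^ k) \<longlonglongrightarrow> c * 0"
      by (intro tendsto_mult tendsto_const LIMSEQ_power_zero) auto
    then show "(\<lambda>k. ennreal (c * (1 / 2) ^ k)) \<longlonglongrightarrow> 0"
      using tendsto_ennrealI by fastforce
  qed simp
  finally have "(\<integral>\<^sup>+\<omega>. liminf (\<lambda>k. X k \<omega>) \<partial>M) = 0" by simp
  then have "AE \<omega> in M. liminf (\<lambda>k. X k \<omega>) = 0"
    by (subst (asm) nn_integral_0_iff_AE) auto
  moreover have "AE \<omega> in M. cadlag (\<lambda>t. Y t \<omega>)" using levy by (simp add: levy_process_def)
  ultimately show ?thesis using AE_space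
  proof eventually_elim
    case (elim \<omega>)
    show ?case unfolding hausdorff_null_iff
    proof (intro allI impI)
      fix \<delta> :: real assume "0 < \<delta>"
      have "(\<lambda>k. d * (1 / 2) ^ k) \<longlonglongrightarrow> d * 0"
        by (intro tendsto_mult tendsto_const LIMSEQ_power_zero) auto
      then have "\<forall>\<^sub>F k in sequentially. d * (1 / 2) ^ k < \<delta>"
        using \<open>0 < \<delta>\<close> by (intro order_tendstoD) auto
      then have "\<forall>\<^sub>F k in sequentially. hausdorff_content \<delta> \<gamma> ((\<lambda>t. Y t \<omega>) ` {0..T}) \<le> X k \<omega>"
      proof eventually_elim
        case (elim k)
        have "d * r k \<le> d * (1 / 2) ^ k" using d r(2)[of k] by (intro mult_left_mono) auto
        then have "d * r k \<le> \<delta>" using elim by linarith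
        then show ?case
          unfolding X_def d_def
          using \<open>cadlag (\<lambda>t. Y t \<omega>)\<close> \<open>\<omega> \<in> space M\<close> r(1)[of k] assms(1) N
          by (intro hausdorff_content_range_le)
      qed
      then have "hausdorff_content \<delta> \<gamma> ((\<lambda>t. Y t \<omega>) ` {0..T}) \<le> liminf (\<lambda>k. X k \<omega>)"
        by (rule Liminf_bounded)
      then show "hausdorff_content \<delta> \<gamma> ((\<lambda>t. Y t \<omega>) ` {0..T}) = 0" using elim by simp
    qed
  qed
qed

lemma potential_ball_not_small:
  assumes "0 < \<gamma>'" "\<gamma>' < \<gamma>" "0 < \<epsilon>" "0 < \<delta>"
    and inf: "\<not> riesz_energy \<gamma>' potential < \<infinity>"
  shows "\<exists>r. 0 < r \<and> r < \<delta> \<and> ennreal (r powr \<gamma>) < ennreal \<epsilon> * emeasure potential (ball 0 r)"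
proof (rule ccontr)
  assume *: "\<not> ?thesis"
  interpret U: prob_space potential by (rule prob_space_potential)
  \<comment> \<open>\<open>1 / \<epsilon>\<close> serves the radii below \<open>\<delta>\<close>;
    from \<open>\<delta>\<close> on, \<open>\<delta> powr - \<gamma>\<close> raises the bound to at
    least 1, the total mass.\<close>
  define C where "C = 1 / \<epsilon> + \<delta> powr - \<gamma>"
  have "emeasure potential (ball 0 r) \<le> ennreal (C * r powr \<gamma>)" if r: "0 < r" for r
  proof (cases "r < \<delta>")
    case True
    then have "ennreal \<epsilon> * emeasure potential (ball 0 r) \<le> ennreal (r powr \<gamma>)" using * r by (meson not_less)
    then have "\<epsilon> * measure potential (ball 0 r) \<le> r powr \<gamma>"
      using assms(3) by (simp add: U.emeasure_eq_measure flip: ennreal_mult')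
    then have "measure potential (ball 0 r) \<le> 1 / \<epsilon> * r powr \<gamma>" using assms(3) by (simp add: field_simps)
    also have "\<dots> \<le> C * r powr \<gamma>" unfolding C_def by (intro mult_right_mono) auto
    finally show ?thesis by (simp add: U.emeasure_eq_measure ennreal_leI)
  next
    case False
    have "1 = \<delta> powr - \<gamma> * \<delta> powr \<gamma>" using assms(4) by (simp flip: powr_add)
    also have "\<dots> \<le> C * r powr \<gamma>"
      unfolding C_def using False assms by (intro mult_mono powr_mono2) auto
    finally have "measure potential (ball 0 r) \<le> C * r powr \<gamma>" by (rule order_trans[OF U.prob_le_1])
    then show ?thesis by (simp add: U.emeasure_eq_measure ennreal_leI)
  qed
  then have "riesz_energy \<gamma>' potential < \<infinity>"
    using assms by (intro riesz_potential_finite_if_ball_decay[where C=C and \<gamma>=\<gamma>])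
      (auto simp: C_def sets_potential prob_space_potential)
  with inf show False by (rule notE)
qed

text \<open>The quantifier over \<open>T\<close> stands inside the almost sure event so that a
  random \<open>T\<close> may be inserted. Monotonicity in \<open>T\<close> and in the exponent
  reduces it to countably many cases: integer times for the upper bound, the times
  \<open>e n\<close> for the lower.\<close>

theorem AE_hausdorff_dim_range:
  assumes \<Psi>: "has_char_exponent M Y \<Psi>"
  shows "AE \<omega> in M. \<forall>T>0. hausdorff_dim ((\<lambda>t. Y t \<omega>) ` {0..T}) = ereal (Sup {\<gamma>. \<gamma> < real DIM('a) \<and> exponent_integral \<Psi> \<gamma> < \<infinity>})"
proof -
  define G where "G = {\<gamma>. \<gamma> < real DIM('a) \<and> exponent_integral \<Psi> \<gamma> < \<infinity>}"
  define s where "s = Sup G"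
  have bdd: "bdd_above G" by (auto simp: G_def intro!: bdd_aboveI[of _ "real DIM('a)"])
  have neg: "\<gamma> \<in> G" if "\<gamma> < 0" for \<gamma>
  proof -
    have "exponent_integral \<Psi> \<gamma> \<le> (\<integral>\<^sup>+\<xi>\<in>{\<xi>. 1 \<le> norm \<xi>}. ennreal (1 / norm \<xi> powr (real DIM('a) - \<gamma>)) \<partial>(lborel :: 'a measure))"
      unfolding exponent_integral_def using Re_char_exponent(2)[OF \<Psi>]
      by (intro nn_integral_mono mult_right_mono ennreal_leI divide_right_mono) auto
    also have "\<dots> < \<infinity>" by (rule nn_integral_norm_powr_outside_ball[OF that])
    finally show ?thesis using that by (simp add: G_def)
  qed
  have s_nonneg: "0 \<le> s"
  proof (rule field_le_epsilon)
    fix e :: real assume "0 < e"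
    then have "- e \<le> s" unfolding s_def by (intro cSup_upper neg bdd) auto
    then show "0 \<le> s + e" by simp
  qed
  have down: "\<gamma> \<in> G" if "\<gamma>' \<in> G" "\<gamma> \<le> \<gamma>'" for \<gamma> \<gamma>'
  proof -
    have "exponent_integral \<Psi> \<gamma> \<le> exponent_integral \<Psi> \<gamma>'"
      unfolding exponent_integral_def
    proof (intro nn_set_integral_mono ennreal_leI)
      fix \<xi> :: 'a assume "\<xi> \<in> {\<xi>. 1 \<le> norm \<xi>}"
      then show "Re (1 / (1 + \<Psi> \<xi>)) / norm \<xi> powr (real DIM('a) - \<gamma>) \<le> Re (1 / (1 + \<Psi> \<xi>)) / norm \<xi> powr (real DIM('a) - \<gamma>')"
        using \<open>\<gamma> \<le> \<gamma>'\<close> less_imp_le[OF Re_char_exponent(1)[OF \<Psi>, of \<xi>]]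
        by (intro divide_left_mono powr_mono mult_pos_pos) auto
    qed simp
    then show ?thesis using that by (auto simp: G_def)
  qed
  have J: "riesz_energy \<gamma> potential < \<infinity> \<longleftrightarrow> \<gamma> \<in> G"
    if "0 < \<gamma>" for \<gamma>
    using potential_riesz_finite_iff[OF \<Psi> that] by (simp add: G_def)
  define e where "e k = inverse (real (Suc k))" for k
  have e: "0 < e k" for k by (simp add: e_def)
  have upper: "AE \<omega> in M. hausdorff_measure (s + e k) ((\<lambda>t. Y t \<omega>) ` {0..real n}) = 0" for k n
  proof (rule AE_hausdorff_measure_range_zero)
    show "0 < s + e k" using s_nonneg e[of k] by linarith
    \<comment> \<open>Strictly above \<open>s\<close>, so that the energy is infinite, and strictly
      below \<open>s + e k\<close>, because passing from infinite energy to large balls costs a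
      little in the exponent.\<close>
    define \<gamma>' where "\<gamma>' = s + e k / 2"
    have \<gamma>': "0 < \<gamma>'" "\<gamma>' < s + e k" using s_nonneg e[of k] by (auto simp: \<gamma>'_def)
    have "\<gamma>' \<notin> G"
    proof
      assume "\<gamma>' \<in> G"
      then have "\<gamma>' \<le> s" unfolding s_def by (intro cSup_upper bdd)
      then show False using e[of k] by (simp add: \<gamma>'_def)
    qed
    then show "\<exists>r. 0 < r \<and> r < \<delta> \<and> ennreal (r powr (s + e k)) < ennreal \<epsilon> * emeasure potential (ball 0 r)"
      if "0 < \<epsilon>" "0 < \<delta>" for \<epsilon> \<delta>
      using potential_ball_not_small[OF \<gamma>' that] J[OF \<gamma>'(1)] by blast
  qed
  \<comment> \<open>The energy criterion is for positive exponents. If \<open>s = 0\<close>, every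
    premise here fails and the lower bound on the dimension is trivial.\<close>
  have lower: "AE \<omega> in M. s - e k > 0 \<longrightarrow> hausdorff_measure (s - e k) ((\<lambda>t. Y t \<omega>) ` {0..e n}) \<noteq> 0" for k n
  proof (cases "s - e k > 0")
    case True
    have "G \<noteq> {}" using neg[of "- 1"] by auto
    then obtain \<gamma>' where "\<gamma>' \<in> G" "s - e k < \<gamma>'"
      using less_cSup_iff[OF _ bdd, of "s - e k"] e[of k] by (auto simp: s_def)
    then have "s - e k \<in> G" using down by simp
    then show ?thesis
      using AE_hausdorff_measure_range_nonzero[OF True e] J[OF True] by simp
  qed simp
  have "AE \<omega> in M. \<forall>k n. hausdorff_measure (s + e k) ((\<lambda>t. Y t \<omega>) ` {0..real n}) = 0"
    using upper by (simp add: AE_all_countable)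
  moreover have "AE \<omega> in M. \<forall>k n. s - e k > 0 \<longrightarrow> hausdorff_measure (s - e k) ((\<lambda>t. Y t \<omega>) ` {0..e n}) \<noteq> 0"
    using lower by (simp only: AE_all_countable) simp
  ultimately show ?thesis
  proof eventually_elim
    case (elim \<omega>)
    show ?case
      unfolding G_def[symmetric] s_def[symmetric]
    proof (intro allI impI antisym)
      fix T :: real assume T: "0 < T"
      obtain n :: nat where n: "T \<le> real n" using real_arch_simple by blast
      show "hausdorff_dim ((\<lambda>t. Y t \<omega>) ` {0..T}) \<le> ereal s"
      proof (rule hausdorff_dim_leI[OF s_nonneg])
        fix u assume "s < u"
        then obtain k where "e k < u - s" unfolding e_def using reals_Archimedean[of "u - s"] by auto
        have "hausdorff_measure (s + e k) ((\<lambda>t. Y t \<omega>) ` {0..T}) = 0"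
          by (rule hausdorff_null_subset[OF image_mono elim(1)[rule_format, of k n]]) (use n in auto)
        from hausdorff_null_antimono_exponent[OF _ _ this, of u]
        show "hausdorff_measure u ((\<lambda>t. Y t \<omega>) ` {0..T}) = 0"
          using \<open>e k < u - s\<close> s_nonneg e[of k] by simp
      qed
      obtain n where n: "e n < T" unfolding e_def using reals_Archimedean[OF T] by auto
      show "ereal s \<le> hausdorff_dim ((\<lambda>t. Y t \<omega>) ` {0..T})"
      proof (rule hausdorff_dim_geI, rule notI)
        fix u assume u: "0 \<le> u" "u < s" "hausdorff_measure u ((\<lambda>t. Y t \<omega>) ` {0..T}) = 0"
        then obtain k where k: "e k < s - u" unfolding e_def using reals_Archimedean[of "s - u"] by auto
        have "hausdorff_measure u ((\<lambda>t. Y t \<omega>) ` {0..e n}) = 0"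
          by (rule hausdorff_null_subset[OF image_mono u(3)]) (use n in auto)
        from hausdorff_null_antimono_exponent[OF _ _ this, of "s - e k"]
        have "hausdorff_measure (s - e k) ((\<lambda>t. Y t \<omega>) ` {0..e n}) = 0"
          using k u(1) by simp
        then show False using elim(2) k u(1) by auto
      qed
    qed
  qed
qed

end

lemma AE_hausdorff_dim_levy_range:
  fixes Y :: "real \<Rightarrow> 'w \<Rightarrow> 'a::euclidean_space"
  assumes "prob_space M" "levy_process M Y" "has_char_exponent M Y \<Psi>"
  shows "AE \<omega> in M. \<forall>T>0. hausdorff_dim ((\<lambda>t. Y t \<omega>) ` {0..T}) =
    ereal (Sup {\<gamma>. \<gamma> < real DIM('a) \<and> exponent_integral \<Psi> \<gamma> < \<infinity>})"
proof -
  obtain W where "(\<lambda>(t, \<omega>). W t \<omega>) \<in> borel_measurable (borel \<Otimes>\<^sub>M M)" "AE \<omega> in M. \<forall>t\<ge>0. W t \<omega> = Y t \<omega>"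
    using levy_process_jointly_measurable_version[OF assms(2)] .
  with assms interpret levy_potential M Y W
    by (simp add: levy_potential_def levy_potential_axioms_def)
  show ?thesis using AE_hausdorff_dim_range[OF assms(3)] .
qed

section \<open>The inverse of a strictly increasing subordinator\<close>

text \<open>Collects path properties that hold almost surely; everything about the inverse is then
  deterministic, for one fixed path.\<close>

locale increasing_clock =
  fixes D :: "real \<Rightarrow> 'w \<Rightarrow> real" and \<omega> :: 'w
  assumes D_0: "D 0 \<omega> = 0"
    and D_strict_mono: "\<And>x y. 0 \<le> x \<Longrightarrow> x < y \<Longrightarrow> D x \<omega> < D y \<omega>"
    and D_right_cont: "\<And>x. 0 \<le> x \<Longrightarrow> ((\<lambda>x. D x \<omega>) \<longlongrightarrow> D x \<omega>) (at_right x)"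
    and D_unbounded: "\<And>c. \<exists>x\<ge>0. c < D x \<omega>"
begin

abbreviation E :: "real \<Rightarrow> real" where "E t \<equiv> inverse_process D t \<omega>"

lemma D_mono: "0 \<le> x \<Longrightarrow> x \<le> y \<Longrightarrow> D x \<omega> \<le> D y \<omega>"
  using D_strict_mono[of x y] by (cases "x = y") auto

lemma bdd_below_passage: "bdd_below {x. 0 \<le> x \<and> t < D x \<omega>}"
  by (intro bdd_belowI[of _ 0]) auto

lemma E_nonneg: "0 \<le> E t"
  unfolding inverse_process_def using D_unbounded[of t] by (intro cInf_greatest) auto

lemma D_le_before_E: "0 \<le> y \<Longrightarrow> y < E t \<Longrightarrow> D y \<omega> \<le> t"
  unfolding inverse_process_def using cInf_lower[OF _ bdd_below_passage, of y t] by fastforce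

lemma less_D_after_E: "E t < y \<Longrightarrow> t < D y \<omega>"
  unfolding inverse_process_def
  using cInf_lessD[of "{x. 0 \<le> x \<and> t < D x \<omega>}" y] D_unbounded[of t] D_mono
  by (smt (verit, best) empty_Collect_eq mem_Collect_eq)

lemma le_D_at_E: "t \<le> D (E t) \<omega>"
proof (rule tendsto_lowerbound[OF D_right_cont[OF E_nonneg]])
  show "\<forall>\<^sub>F x in at_right (E t). t \<le> D x \<omega>"
    using less_D_after_E by (auto simp: eventually_at_filter intro!: always_eventually less_imp_le)
qed simp

lemma E_eqI:
  assumes "0 \<le> x" "\<And>y. 0 \<le> y \<Longrightarrow> y < x \<Longrightarrow> D y \<omega> \<le> t" "\<And>y. x < y \<Longrightarrow> t < D y \<omega>"
  shows "E t = x"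
proof (rule antisym)
  show "E t \<le> x"
  proof (rule dense_ge)
    fix y assume "x < y"
    then show "E t \<le> y"
      unfolding inverse_process_def using assms by (intro cInf_lower bdd_below_passage) auto
  qed
  show "x \<le> E t"
  proof (rule ccontr)
    assume "\<not> x \<le> E t"
    then obtain y where y: "E t < y" "y < x" using dense[of "E t" x] by auto
    then have "D y \<omega> \<le> t" using E_nonneg[of t] by (intro assms(2)) auto
    then show False using less_D_after_E[OF y(1)] by simp
  qed
qed

lemma E_D: "0 \<le> x \<Longrightarrow> E (D x \<omega>) = x"
  by (rule E_eqI) (auto intro: less_imp_le D_strict_mono)

lemma E_mono:
  assumes "s \<le> t"
  shows "E s \<le> E t"
proof (rule ccontr)
  assume "\<not> E s \<le> E t"
  then obtain y where y: "E t < y" "y < E s" using dense[of "E t" "E s"] by auto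
  then have "D y \<omega> \<le> s" using E_nonneg[of t] by (intro D_le_before_E) auto
  then show False using less_D_after_E[OF y(1)] assms by simp
qed

lemma E_image: "E ` {0..1} = {0..E 1}"
proof
  show "E ` {0..1} \<subseteq> {0..E 1}" using E_nonneg E_mono by auto
  show "{0..E 1} \<subseteq> E ` {0..1}"
  proof
    fix x assume x: "x \<in> {0..E 1}"
    show "x \<in> E ` {0..1}"
    \<comment> \<open>\<open>D (E 1) \<omega>\<close> may exceed 1 if the clock jumps over 1, but
      \<open>E 1\<close> is attained at time 1 itself.\<close>
    proof (cases "x = E 1")
      case False
      then have "D x \<omega> \<le> 1" using x by (intro D_le_before_E) auto
      moreover have "0 \<le> D x \<omega>" using D_mono[of 0 x] D_0 x by simp
      ultimately show ?thesis using E_D[of x] x by (intro image_eqI[of _ _ "D x \<omega>"]) auto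
    qed auto
  qed
qed

lemma ex_pos_D_le_1: "\<exists>x>0. D x \<omega> \<le> 1"
proof -
  have "\<forall>\<^sub>F x in at_right 0. D x \<omega> < 1"
    using D_right_cont[of 0] D_0 by (intro order_tendstoD) auto
  moreover have "\<forall>\<^sub>F x::real in at_right 0. 0 < x" by (simp add: eventually_at_right_less)
  ultimately have "\<forall>\<^sub>F x in at_right 0. 0 < x \<and> D x \<omega> < 1" by eventually_elim simp
  then show ?thesis using eventually_happens[of _ "at_right (0::real)"] by fastforce
qed

lemma E_1_pos: "0 < E 1"
proof -
  obtain x where x: "0 < x" "D x \<omega> \<le> 1" using ex_pos_D_le_1 by auto
  then have "x \<le> E 1" using less_D_after_E[of 1 x] by force
  then show ?thesis using x by simp
qed

text \<open>
  Above a jump of the clock the time-changed path stays constant; a rational level inside the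
  jump identifies it, so countably many segments account for all of them.
\<close>

lemma graph_subset:
  "(\<lambda>t. (t, y (E t))) ` {0..1} \<subseteq> (\<lambda>x. (D x \<omega>, y x)) ` {0..E 1} \<union> (\<Union>q\<in>\<rat>. {0..1} \<times> {y (E q)})"
proof safe
  fix t :: real assume t: "t \<in> {0..1}"
    and *: "(t, y (E t)) \<notin> (\<Union>q\<in>\<rat>. {0..1} \<times> {y (E q)})"
  show "(t, y (E t)) \<in> (\<lambda>x. (D x \<omega>, y x)) ` {0..E 1}"
  proof (cases "D (E t) \<omega> = t")
    case True
    then show ?thesis using t E_mono[of t 1] E_nonneg[of t] by (intro image_eqI[of _ _ "E t"]) auto
  next
    case False
    then have "t < D (E t) \<omega>" using le_D_at_E[of t] by simp
    then obtain q where q: "q \<in> \<rat>" "t < q" "q < D (E t) \<omega>" using Rats_dense_in_real by blast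
    have "E q = E t"
    proof (rule E_eqI[OF E_nonneg])
      show "D x \<omega> \<le> q" if "0 \<le> x" "x < E t" for x using D_le_before_E[OF that] q by simp
      show "q < D x \<omega>" if "E t < x" for x using D_strict_mono[OF E_nonneg that] q by simp
    qed
    then have "(t, y (E t)) \<in> (\<Union>q\<in>\<rat>. {0..1} \<times> {y (E q)})" using q t by (auto intro!: bexI[of _ q])
    then show ?thesis using * by contradiction
  qed
qed

text \<open>Since \<open>E (D x \<omega>) = x\<close>, the graph passes through
  \<open>(D x \<omega>, y x)\<close> at time \<open>D x \<omega>\<close>.\<close>

lemma range_subset_graph:
  assumes "D x0 \<omega> \<le> 1"
  shows "(\<lambda>x. (D x \<omega>, y x)) ` {0..x0} \<subseteq> (\<lambda>t. (t, y (E t))) ` {0..1}"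
proof
  fix p assume "p \<in> (\<lambda>x. (D x \<omega>, y x)) ` {0..x0}"
  then obtain x where x: "0 \<le> x" "x \<le> x0" "p = (D x \<omega>, y x)" by auto
  have "D x \<omega> \<le> 1" using D_mono[of x x0] x assms by simp
  moreover have "0 \<le> D x \<omega>" using D_mono[of 0 x] D_0 x by simp
  ultimately show "p \<in> (\<lambda>t. (t, y (E t))) ` {0..1}"
    using x E_D[of x] by (intro image_eqI[of _ _ "D x \<omega>"]) auto
qed

end

section \<open>Strict increase and unboundedness of the clock\<close>

lemma levy_process_increments_in:
  fixes Y :: "real \<Rightarrow> 'w \<Rightarrow> 'a::euclidean_space" and n :: nat
  assumes "prob_space M" "levy_process M Y" "0 \<le> a" "0 < h" and [measurable]: "S \<in> sets borel"
  shows "measure M {\<omega>\<in>space M. \<forall>i<n. Y (a + real (Suc i) * h) \<omega> - Y (a + real i * h) \<omega> \<in> S}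
    = measure M {\<omega>\<in>space M. Y h \<omega> \<in> S} ^ n"
proof (cases "n = 0")
  case True
  interpret prob_space M by fact
  show ?thesis using True by (simp add: prob_space)
next
  case False
  interpret prob_space M by fact
  define x where "x i = a + real i * h" for i
  define \<Delta> where "\<Delta> i \<omega> = Y (x (Suc i)) \<omega> - Y (x i) \<omega>" for i \<omega>
  have x: "0 \<le> x i" "x i < x (Suc i)" "x (Suc i) = x i + h" for i
    using assms(3,4) by (auto simp: x_def algebra_simps)
  have [measurable]: "Y (x i) \<in> borel_measurable M" for i using assms(2) x by (simp add: levy_process_def)
  have [measurable]: "Y h \<in> borel_measurable M" using assms(2,4) by (simp add: levy_process_def)
  have [measurable]: "\<Delta> i \<in> borel_measurable M" for i unfolding \<Delta>_def by measurable
  have ind: "indep_vars (\<lambda>_. borel) \<Delta> {..<n}"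
  proof -
    have "indep_vars (\<lambda>_. borel) (\<lambda>i \<omega>. Y (x (Suc i)) \<omega> - Y (x i) \<omega>) {..<n}"
      using assms(2)[unfolded levy_process_def, THEN conjunct2, THEN conjunct2, THEN conjunct1, rule_format, of x n] x(1,2)
      by simp
    then show ?thesis unfolding \<Delta>_def[abs_def] .
  qed
  have "prob (\<Inter>i\<in>{..<n}. \<Delta> i -` S \<inter> space M) = (\<Prod>i\<in>{..<n}. prob (\<Delta> i -` S \<inter> space M))"
    using False by (intro indep_varsD[OF ind]) auto
  also have "\<dots> = (\<Prod>i\<in>{..<n}. prob {\<omega>\<in>space M. Y h \<omega> \<in> S})"
  proof (intro prod.cong refl)
    fix i
    have "prob (\<Delta> i -` S \<inter> space M) = measure (distr M borel (\<Delta> i)) S" by (subst measure_distr) auto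
    also have "distr M borel (\<Delta> i) = distr M borel (Y h)"
      using assms(2,4) x(1)[of i] unfolding levy_process_def \<Delta>_def[abs_def] x(3) by simp
    also have "measure \<dots> S = prob {\<omega>\<in>space M. Y h \<omega> \<in> S}"
      by (subst measure_distr) (auto intro!: arg_cong[where f=prob])
    finally show "prob (\<Delta> i -` S \<inter> space M) = prob {\<omega>\<in>space M. Y h \<omega> \<in> S}" .
  qed
  also have "(\<Inter>i\<in>{..<n}. \<Delta> i -` S \<inter> space M) = {\<omega>\<in>space M. \<forall>i<n. Y (a + real (Suc i) * h) \<omega> - Y (a + real i * h) \<omega> \<in> S}"
    using False by (auto simp: \<Delta>_def x_def)
  finally show ?thesis by simp
qed

text \<open>\<open>Re (\<sigma> \<eta>)\<close> is the integral of
  \<open>1 - cos (\<eta> * u)\<close>. Averaging over \<open>\<eta>\<close> in \<open>{0..T}\<close>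
  suppresses the oscillation and leaves at least one half on a tail, so every tail has mass at most
  \<open>2 * C\<close>, uniformly in its left end.\<close>

lemma levy_measure_finite_if_exponent_bounded:
  assumes "has_drift_and_levy_measure \<sigma> 0 \<nu>" and bound: "\<And>\<eta>. Re (\<sigma> \<eta>) \<le> C"
  shows "emeasure \<nu> {0<..} < \<infinity>"
proof -
  have [measurable_cong]: "sets \<nu> = sets borel"
    and null: "emeasure \<nu> {..0} = 0"
    and fin: "(\<integral>\<^sup>+u. ennreal (min 1 u) \<partial>\<nu>) < \<infinity>"
    and \<sigma>: "\<And>\<eta>. \<sigma> \<eta> = (\<integral>u. 1 - iexp (\<eta> * u) \<partial>\<nu>)"
    using assms(1) by (auto simp: has_drift_and_levy_measure_def)
  have pos: "AE u in \<nu>. 0 < u"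
    by (rule AE_I[of _ _ "{..0}"]) (auto simp: null not_less)
  have bd: "cmod (1 - exp (\<i> * complex_of_real x)) \<le> min 2 \<bar>x\<bar>" for x
    using iexp_approx1[of x 0] norm_triangle_ineq4[of 1 "exp (\<i> * complex_of_real x)"]
    by (simp add: norm_minus_commute)
  \<comment> \<open>Without integrability the Bochner integral in the formula for
    \<open>\<sigma>\<close> would be 0 by default and carry no information on
    \<open>\<nu>\<close>.\<close>
  have int: "integrable \<nu> (\<lambda>u. 1 - iexp (\<eta> * u))" for \<eta>
  proof (rule integrableI_bounded)
    have "(\<integral>\<^sup>+u. ennreal (cmod (1 - iexp (\<eta> * u))) \<partial>\<nu>) \<le> (\<integral>\<^sup>+u. ennreal (2 + \<bar>\<eta>\<bar>) * ennreal (min 1 u) \<partial>\<nu>)"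
    proof (rule nn_integral_mono_AE)
      show "AE u in \<nu>. ennreal (cmod (1 - iexp (\<eta> * u))) \<le> ennreal (2 + \<bar>\<eta>\<bar>) * ennreal (min 1 u)"
        using pos
      proof eventually_elim
        case (elim u)
        have "min 2 (\<bar>\<eta>\<bar> * u) \<le> (2 + \<bar>\<eta>\<bar>) * min 1 u"
          using elim by (cases "u \<le> 1") (auto simp: min_def distrib_right)
        moreover have "cmod (1 - iexp (\<eta> * u)) \<le> min 2 (\<bar>\<eta>\<bar> * u)"
          using bd[of "\<eta> * u"] elim by (simp add: abs_mult)
        ultimately have "cmod (1 - iexp (\<eta> * u)) \<le> (2 + \<bar>\<eta>\<bar>) * min 1 u"
          by linarith
        then show ?case using elim by (subst ennreal_mult[symmetric]) (auto intro!: ennreal_leI simp del: ennreal_plus)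
      qed
    qed
    also have "\<dots> < \<infinity>" using fin by (subst nn_integral_cmult) (auto simp: ennreal_mult_less_top)
    finally show "(\<integral>\<^sup>+u. ennreal (cmod (1 - iexp (\<eta> * u))) \<partial>\<nu>) < \<infinity>" .
  qed measurable
  have Re_\<sigma>: "(\<integral>\<^sup>+u. ennreal (1 - cos (\<eta> * u)) \<partial>\<nu>) = ennreal (Re (\<sigma> \<eta>))" for \<eta>
  proof -
    have "(\<integral>\<^sup>+u. ennreal (1 - cos (\<eta> * u)) \<partial>\<nu>) = (\<integral>\<^sup>+u. ennreal (Re (1 - iexp (\<eta> * u))) \<partial>\<nu>)"
      by (simp add: Re_exp)
    also have "\<dots> = ennreal (\<integral>u. Re (1 - iexp (\<eta> * u)) \<partial>\<nu>)"
      using int[of \<eta>] by (intro nn_integral_eq_integral integrable_Re) (auto simp: Re_exp)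
    also have "(\<integral>u. Re (1 - iexp (\<eta> * u)) \<partial>\<nu>) = Re (\<sigma> \<eta>)"
      unfolding \<sigma> by (rule integral_Re[OF int])
    finally show ?thesis .
  qed
  have tail: "emeasure \<nu> {\<epsilon><..} \<le> ennreal (2 * C)" if \<epsilon>: "0 < \<epsilon>" for \<epsilon>
  proof -
    \<comment> \<open>Cut down to a tail, \<open>\<nu>\<close> is finite, so that the order of
      integration can be exchanged.\<close>
    define N where "N = density \<nu> (indicator {\<epsilon><..})"
    have [measurable_cong]: "sets N = sets borel" by (simp add: N_def \<open>sets \<nu> = sets borel\<close>)
    have tail_fin: "emeasure \<nu> {\<epsilon><..} < \<infinity>"
    proof -
      have "ennreal (min 1 \<epsilon>) * emeasure \<nu> {\<epsilon><..} = (\<integral>\<^sup>+u. ennreal (min 1 \<epsilon>) * indicator {\<epsilon><..} u \<partial>\<nu>)"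
        by (rule nn_integral_cmult_indicator[symmetric]) measurable
      also have "\<dots> \<le> (\<integral>\<^sup>+u. ennreal (min 1 u) \<partial>\<nu>)"
        by (intro nn_integral_mono) (auto split: split_indicator intro!: ennreal_leI)
      finally have "ennreal (min 1 \<epsilon>) * emeasure \<nu> {\<epsilon><..} < \<infinity>" using fin by (rule le_less_trans)
      then show ?thesis using \<epsilon> by (auto simp: ennreal_mult_less_top)
    qed
    have N_nn: "(\<integral>\<^sup>+u. f u \<partial>N) = (\<integral>\<^sup>+u. f u * indicator {\<epsilon><..} u \<partial>\<nu>)" if [measurable]: "f \<in> borel_measurable borel" for f
      unfolding N_def by (subst nn_integral_density) (auto simp: mult.commute)
    have N_space: "emeasure N (space N) = emeasure \<nu> {\<epsilon><..}"
      by (simp add: N_def emeasure_density \<open>sets \<nu> = sets borel\<close> sets_eq_imp_space_eq)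
    interpret N: finite_measure N using tail_fin by (intro finite_measureI) (simp add: N_space)
    interpret P: pair_sigma_finite lborel N ..
    \<comment> \<open>For this \<open>T\<close> one has
      \<open>sin (T * u) / u \<le> 1 / \<epsilon> = T / 2\<close> on the tail.\<close>
    define T where "T = 2 / \<epsilon>"
    have T: "0 < T" using \<epsilon> by (simp add: T_def)
    have "ennreal (T / 2) * emeasure \<nu> {\<epsilon><..} = (\<integral>\<^sup>+u. ennreal (T / 2) * indicator {\<epsilon><..} u \<partial>\<nu>)"
      by (rule nn_integral_cmult_indicator[symmetric]) measurable
    also have "\<dots> \<le> (\<integral>\<^sup>+u. ennreal (T - sin (T * u) / u) * indicator {\<epsilon><..} u \<partial>\<nu>)"
    proof (intro nn_integral_mono)
      fix u :: real
      have "T / 2 \<le> T - sin (T * u) / u" if "\<epsilon> < u"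
      proof -
        have "sin (T * u) / u \<le> 1 / \<epsilon>" using that \<epsilon> by (intro frac_le) auto
        then show ?thesis by (simp add: T_def)
      qed
      then show "ennreal (T / 2) * indicator {\<epsilon><..} u \<le> ennreal (T - sin (T * u) / u) * indicator {\<epsilon><..} u"
        by (auto split: split_indicator intro: ennreal_leI)
    qed
    also have "\<dots> = (\<integral>\<^sup>+u. ennreal (T - sin (T * u) / u) * indicator {\<epsilon><..} u \<partial>N)"
      by (subst N_nn) (auto intro!: nn_integral_cong split: split_indicator)
    also have "\<dots> \<le> (\<integral>\<^sup>+u. (\<integral>\<^sup>+\<eta>. ennreal (1 - cos (\<eta> * u)) * indicator {0..T} \<eta> \<partial>lborel) \<partial>N)"
    proof (intro nn_integral_mono)
      fix u :: real
      have "(\<integral>\<^sup>+\<eta>. ennreal (1 - cos (\<eta> * u)) * indicator {0..T} \<eta> \<partial>lborel) = ennreal ((T - sin (T * u) / u) - (0 - sin (0 * u) / u))" if "\<epsilon> < u"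
        using that \<epsilon> T by (intro nn_integral_FTC_Icc) (auto intro!: derivative_eq_intros)
      then show "ennreal (T - sin (T * u) / u) * indicator {\<epsilon><..} u \<le> (\<integral>\<^sup>+\<eta>. ennreal (1 - cos (\<eta> * u)) * indicator {0..T} \<eta> \<partial>lborel)"
        by (auto split: split_indicator)
    qed
    also have "\<dots> = (\<integral>\<^sup>+\<eta>. (\<integral>\<^sup>+u. ennreal (1 - cos (\<eta> * u)) * indicator {0..T} \<eta> \<partial>N) \<partial>lborel)"
      by (rule P.Fubini') measurable
    also have "\<dots> \<le> (\<integral>\<^sup>+\<eta>. ennreal C * indicator {0..T} \<eta> \<partial>lborel)"
    proof (intro nn_integral_mono)
      fix \<eta> :: real
      have "(\<integral>\<^sup>+u. ennreal (1 - cos (\<eta> * u)) \<partial>N) \<le> (\<integral>\<^sup>+u. ennreal (1 - cos (\<eta> * u)) \<partial>\<nu>)"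
        by (subst N_nn) (auto intro!: nn_integral_mono split: split_indicator)
      also have "\<dots> \<le> ennreal C" unfolding Re_\<sigma> by (intro ennreal_leI bound)
      finally show "(\<integral>\<^sup>+u. ennreal (1 - cos (\<eta> * u)) * indicator {0..T} \<eta> \<partial>N) \<le> ennreal C * indicator {0..T} \<eta>"
        by (auto split: split_indicator)
    qed
    also have "\<dots> = ennreal C * ennreal T" using T by (subst nn_integral_cmult_indicator) auto
    finally have "ennreal (T / 2) * emeasure \<nu> {\<epsilon><..} \<le> ennreal C * ennreal T" .
    then have "ennreal (2 / T) * (ennreal (T / 2) * emeasure \<nu> {\<epsilon><..}) \<le> ennreal (2 / T) * (ennreal C * ennreal T)"
      by (rule mult_left_mono) simp
    also have "ennreal (2 / T) * (ennreal (T / 2) * emeasure \<nu> {\<epsilon><..}) = emeasure \<nu> {\<epsilon><..}"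
      using T by (simp add: mult.assoc[symmetric] flip: ennreal_mult')
    also have "ennreal (2 / T) * (ennreal C * ennreal T) = ennreal (2 * C)"
      using T by (simp add: ennreal_mult''[symmetric] ennreal_mult'[symmetric] mult.commute)
    finally show ?thesis .
  qed
  have "{0<..} = (\<Union>k. {inverse (real (Suc k))<..})"
  proof (intro equalityI subsetI)
    fix x :: real assume "x \<in> {0<..}"
    then show "x \<in> (\<Union>k. {inverse (real (Suc k))<..})" using reals_Archimedean[of x] by auto
  next
    fix x :: real assume "x \<in> (\<Union>k. {inverse (real (Suc k))<..})"
    then obtain k where "inverse (real (Suc k)) < x" by auto
    moreover have "0 < inverse (real (Suc k))" by simp
    ultimately show "x \<in> {0<..}" unfolding greaterThan_iff by (rule less_trans[rotated])
  qed
  moreover have "incseq (\<lambda>k. {inverse (real (Suc k))<..})"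
    by (intro incseq_SucI) (auto simp: field_simps elim!: less_trans[rotated])
  ultimately have "emeasure \<nu> {0<..} = (SUP k. emeasure \<nu> {inverse (real (Suc k))<..})"
    by (subst SUP_emeasure_incseq) (auto simp: \<open>sets \<nu> = sets borel\<close>)
  also have "\<dots> \<le> ennreal (2 * C)" by (intro SUP_least tail) simp
  finally show ?thesis by (rule le_less_trans) simp
qed

text \<open>If \<open>D h = 0\<close> had probability \<open>p > 0\<close>, monotonicity would make
  all \<open>n\<close> increments over steps \<open>h / n\<close> vanish on that event, so a single
  one vanishes with probability at least \<open>1 - c / n\<close>, where \<open>c = - ln p\<close>.
  The characteristic function at time \<open>h / n\<close> is then within \<open>2 * (c / n)\<close>
  of 1, which bounds \<open>Re (\<sigma> \<eta>)\<close> by \<open>4 * c / h\<close> for all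
  \<open>\<eta>\<close>.\<close>

lemma subordinator_no_zero_increment:
  assumes "prob_space M" "subordinator M D" "has_char_exponent M D \<sigma>"
    and "has_drift_and_levy_measure \<sigma> 0 \<nu>" "emeasure \<nu> {0<..} = \<infinity>" "0 < h"
  shows "measure M {\<omega>\<in>space M. D h \<omega> = 0} = 0"
proof (rule ccontr)
  interpret prob_space M by fact
  have levy: "levy_process M D" and mono: "AE \<omega> in M. mono_on {0..} (\<lambda>x. D x \<omega>)"
    using assms(2) by (auto simp: subordinator_def)
  have zero: "AE \<omega> in M. D 0 \<omega> = 0" using levy by (simp add: levy_process_def)
  have D [measurable]: "D x \<in> borel_measurable M" if "0 \<le> x" for x using levy that by (simp add: levy_process_def)
  define p where "p = prob {\<omega>\<in>space M. D h \<omega> = 0}"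
  assume "measure M {\<omega>\<in>space M. D h \<omega> = 0} \<noteq> 0"
  then have p: "0 < p" "p \<le> 1" by (auto simp: p_def zero_less_measure_iff)
  define c where "c = - ln p"
  have c: "0 \<le> c" using p by (simp add: c_def)
  \<comment> \<open>\<open>4 * c < n\<close> keeps \<open>2 * (c / n)\<close> below one half, where
    \<open>ln (1 - x)\<close> is at least \<open>- 2 * x\<close>.\<close>
  obtain n :: nat where n: "max 1 (4 * c) < real n" using reals_Archimedean2 by blast
  then have n_pos: "0 < real n" by simp
  define k where "k = h / n"
  have k: "0 < k" using assms(6) n_pos by (simp add: k_def)
  have [measurable]: "D k \<in> borel_measurable M" "D h \<in> borel_measurable M" using k assms(6) by (auto intro: D)
  have [measurable]: "D (0 + real i * k) \<in> borel_measurable M" for i using k by (intro D) simp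
  define q where "q = prob {\<omega>\<in>space M. D k \<omega> = 0}"
  have "p \<le> prob {\<omega>\<in>space M. \<forall>i<n. D (0 + real (Suc i) * k) \<omega> - D (0 + real i * k) \<omega> \<in> {0}}"
    unfolding p_def
  proof (rule finite_measure_mono_AE)
    show "AE \<omega> in M. \<omega> \<in> {\<omega>\<in>space M. D h \<omega> = 0} \<longrightarrow>
      \<omega> \<in> {\<omega>\<in>space M. \<forall>i<n. D (0 + real (Suc i) * k) \<omega> - D (0 + real i * k) \<omega> \<in> {0}}"
      using mono zero
    proof eventually_elim
      case (elim \<omega>)
      have "D x \<omega> = 0" if "D h \<omega> = 0" "0 \<le> x" "x \<le> h" for x
        using mono_onD[OF elim(1), of 0 x] mono_onD[OF elim(1), of x h] elim(2) that by simp
      moreover have "real i * k \<le> h" if "i \<le> n" for i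
        using that n_pos assms(6) by (simp add: k_def field_simps)
      ultimately show ?case using k by (auto simp del: of_nat_Suc)
    qed
  qed measurable
  also have "\<dots> = q ^ n"
    using levy_process_increments_in[OF assms(1) levy, of 0 k "{0}" n] k by (simp add: q_def)
  finally have pq: "p \<le> q ^ n" .
  have q: "0 < q"
  proof (rule ccontr)
    assume "\<not> 0 < q"
    then have "q = 0" by (simp add: q_def zero_less_measure_iff)
    then show False using pq p n_pos by (simp add: power_0_left split: if_splits)
  qed
  have "ln p \<le> n * ln q" using pq p q by (simp flip: ln_realpow)
  then have "- c / n \<le> ln q" using n_pos by (simp add: c_def field_simps)
  also have "ln q \<le> q - 1" by (rule ln_le_minus_one[OF q])
  finally have q_ge: "1 - q \<le> c / n" by simp
  have "Re (\<sigma> \<eta>) \<le> 4 * c / h" for \<eta>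
  proof -
    define e where "e \<omega> = iexp (\<eta> \<bullet> D k \<omega>)" for \<omega>
    have [measurable]: "e \<in> borel_measurable M" unfolding e_def by measurable
    have norm_e: "cmod (e \<omega>) = 1" for \<omega> by (simp add: e_def)
    have "exp (- complex_of_real k * \<sigma> \<eta>) = (\<integral>\<omega>. e \<omega> \<partial>M)"
      using assms(3) k by (simp add: has_char_exponent_def e_def)
    moreover have int: "integrable M (\<lambda>\<omega>. e \<omega>)"
      by (rule integrable_const_bound[where B=1]) (auto simp: norm_e)
    ultimately have "1 - exp (- complex_of_real k * \<sigma> \<eta>) = (\<integral>\<omega>. 1 - e \<omega> \<partial>M)"
      by (simp add: prob_space)
    then have "cmod (1 - exp (- complex_of_real k * \<sigma> \<eta>)) \<le> (\<integral>\<omega>. cmod (1 - e \<omega>) \<partial>M)"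
      by simp
    also have "\<dots> \<le> (\<integral>\<omega>. 2 * indicator {\<omega>\<in>space M. D k \<omega> \<noteq> 0} \<omega> \<partial>M)"
    proof (rule integral_mono)
      show "integrable M (\<lambda>\<omega>. cmod (1 - e \<omega>))"
        using int by (intro integrable_norm Bochner_Integration.integrable_diff) auto
      show "integrable M (\<lambda>\<omega>. 2 * indicator {\<omega>\<in>space M. D k \<omega> \<noteq> 0} \<omega> :: real)"
        by (intro integrable_mult_right integrable_real_indicator) (auto simp: emeasure_eq_measure)
      fix \<omega> assume "\<omega> \<in> space M"
      have "cmod (1 - e \<omega>) \<le> 2"
        using norm_triangle_ineq4[of 1 "e \<omega>"] by (simp add: norm_e)
      then show "cmod (1 - e \<omega>) \<le> 2 * indicator {\<omega>\<in>space M. D k \<omega> \<noteq> 0} \<omega>"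
        using \<open>\<omega> \<in> space M\<close> by (cases "D k \<omega> = 0") (auto simp: e_def)
    qed
    also have "\<dots> = 2 * prob {\<omega>\<in>space M. D k \<omega> \<noteq> 0}" by simp
    also have "prob {\<omega>\<in>space M. D k \<omega> \<noteq> 0} = 1 - q"
      unfolding q_def by (subst prob_neg[symmetric]) auto
    finally have "1 - cmod (exp (- complex_of_real k * \<sigma> \<eta>)) \<le> 2 * (c / n)"
      using norm_triangle_ineq2[of 1 "exp (- complex_of_real k * \<sigma> \<eta>)"] q_ge by simp
    then have "1 - 2 * (c / n) \<le> exp (- (k * Re (\<sigma> \<eta>)))" by simp
    moreover have x: "0 \<le> 2 * (c / n)" "2 * (c / n) \<le> 1 / 2" using n c by (auto simp: field_simps)
    ultimately have "ln (1 - 2 * (c / n)) \<le> - (k * Re (\<sigma> \<eta>))"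
      by (subst ln_exp[symmetric], subst ln_le_cancel_iff) auto
    moreover have "- (2 * (2 * (c / n))) \<le> ln (1 - 2 * (c / n))"
    proof -
      have "(2 * (c / n))\<^sup>2 \<le> (1 / 2) * (2 * (c / n))"
        unfolding power2_eq_square using x by (intro mult_right_mono) auto
      then show ?thesis using ln_one_minus_pos_lower_bound[OF x] by linarith
    qed
    ultimately have "k * Re (\<sigma> \<eta>) \<le> 4 * (c / n)" by linarith
    then show ?thesis using n_pos assms(6) by (simp add: k_def field_simps)
  qed
  then have "emeasure \<nu> {0<..} < \<infinity>" by (rule levy_measure_finite_if_exponent_bounded[OF assms(4)])
  then show False using assms(5) by simp
qed

text \<open>Strict increase is checked for the countably many rational pairs; any two times have two
  rationals between them, and monotonicity transfers the strict inequality.\<close>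

lemma AE_increasing_clock:
  assumes "prob_space M" "subordinator M D"
    and no_zero: "\<And>h. 0 < h \<Longrightarrow> measure M {\<omega>\<in>space M. D h \<omega> = 0} = 0"
  shows "AE \<omega> in M. increasing_clock D \<omega>"
proof -
  interpret prob_space M by fact
  have levy: "levy_process M D" and mono: "AE \<omega> in M. mono_on {0..} (\<lambda>x. D x \<omega>)"
    using assms(2) by (auto simp: subordinator_def)
  have zero: "AE \<omega> in M. D 0 \<omega> = 0" and cadlag: "AE \<omega> in M. cadlag (\<lambda>x. D x \<omega>)"
    using levy by (auto simp: levy_process_def)
  have D [measurable]: "D x \<in> borel_measurable M" if "0 \<le> x" for x using levy that by (simp add: levy_process_def)
  have incr: "AE \<omega> in M. \<forall>a\<in>{a\<in>\<rat>. 0 \<le> a}. \<forall>b\<in>{b\<in>\<rat>. a < b}. D b \<omega> \<noteq> D a \<omega>"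
  proof (intro AE_ball_countable[THEN iffD2] ballI)
    fix a b :: real assume "a \<in> {a\<in>\<rat>. 0 \<le> a}" "b \<in> {b\<in>\<rat>. a < b}"
    then have ab: "0 \<le> a" "a < b" by auto
    have [measurable]: "D a \<in> borel_measurable M" "D b \<in> borel_measurable M" using ab by (auto intro: D)
    have "prob {\<omega>\<in>space M. D b \<omega> - D a \<omega> = 0} = 0"
      using levy_process_increments_in[OF assms(1) levy, of a "b - a" "{0}" 1] ab no_zero[of "b - a"] by simp
    then have "AE \<omega> in M. \<not> D b \<omega> - D a \<omega> = 0"
      by (subst (asm) prob_eq_0) auto
    then show "AE \<omega> in M. D b \<omega> \<noteq> D a \<omega>" by simp
  qed (auto intro: countable_subset[OF _ countable_rat])
  \<comment> \<open>Source of unboundedness: since \<open>D 1\<close> is not almost surely 0, some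
    \<open>\<epsilon>\<close> is exceeded with positive probability, and by independence infinitely
    many unit increments exceed it.\<close>
  have "\<exists>\<epsilon>>0. AE \<omega> in M. \<forall>m::nat. \<exists>k\<ge>m. \<epsilon> < D (real (Suc k)) \<omega> - D (real k) \<omega>"
  proof -
    have [measurable]: "D 1 \<in> borel_measurable M" by (rule D) simp
    have [measurable]: "D (real k) \<in> borel_measurable M" for k by (rule D) simp
    have "\<exists>j::nat. prob {\<omega>\<in>space M. D 1 \<omega> \<in> {..inverse (real (Suc j))}} < 1"
    proof (rule ccontr)
      assume "\<not> ?thesis"
      then have *: "prob {\<omega>\<in>space M. D 1 \<omega> \<le> inverse (real (Suc j))} = 1" for j
        using prob_le_1 by (auto simp: not_less intro: antisym)
      have "AE \<omega> in M. \<forall>j. D 1 \<omega> \<le> inverse (real (Suc j))"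
        unfolding AE_all_countable
      proof
        fix j show "AE \<omega> in M. D 1 \<omega> \<le> inverse (real (Suc j))"
          using *[of j] by (subst (asm) prob_Collect_eq_1) auto
      qed
      then have "AE \<omega> in M. D 1 \<omega> = 0"
        using mono zero
      proof eventually_elim
        case (elim \<omega>)
        have "\<not> 0 < D 1 \<omega>" using elim(1) reals_Archimedean[of "D 1 \<omega>"] by (auto simp: not_less[symmetric] simp del: not_less)
        then show ?case using mono_onD[OF elim(2), of 0 1] elim(3) by simp
      qed
      then have "prob {\<omega>\<in>space M. D 1 \<omega> = 0} = 1" by (subst prob_Collect_eq_1) auto
      then show False using no_zero[of 1] by simp
    qed
    then obtain j :: nat where j: "prob {\<omega>\<in>space M. D 1 \<omega> \<in> {..inverse (real (Suc j))}} < 1" by blast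
    define \<epsilon> where "\<epsilon> = inverse (real (Suc j))"
    define q where "q = prob {\<omega>\<in>space M. D 1 \<omega> \<in> {..\<epsilon>}}"
    have q: "0 \<le> q" "q < 1" using j by (auto simp: q_def \<epsilon>_def)
    have "AE \<omega> in M. \<exists>k\<ge>m. \<epsilon> < D (real (Suc k)) \<omega> - D (real k) \<omega>" for m :: nat
    proof -
      let ?B = "{\<omega>\<in>space M. \<forall>k\<ge>m. D (real (Suc k)) \<omega> - D (real k) \<omega> \<le> \<epsilon>}"
      have "prob ?B \<le> q ^ n" for n
      proof -
        have "prob ?B \<le> prob {\<omega>\<in>space M. \<forall>i<n. D (real m + real (Suc i) * 1) \<omega> - D (real m + real i * 1) \<omega> \<in> {..\<epsilon>}}"
        proof (rule finite_measure_mono)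
          show "?B \<subseteq> {\<omega>\<in>space M. \<forall>i<n. D (real m + real (Suc i) * 1) \<omega> - D (real m + real i * 1) \<omega> \<in> {..\<epsilon>}}"
          proof (intro subsetI CollectI conjI allI impI)
            fix \<omega> i assume B: "\<omega> \<in> ?B"
            then show "\<omega> \<in> space M" by simp
            from B have *: "\<forall>k\<ge>m. D (real (Suc k)) \<omega> - D (real k) \<omega> \<le> \<epsilon>" by simp
            from *[rule_format, of "m + i"] show "D (real m + real (Suc i) * 1) \<omega> - D (real m + real i * 1) \<omega> \<in> {..\<epsilon>}"
              by (simp add: ac_simps)
          qed
          have "D (real m + real i * 1) \<in> borel_measurable M" for i by (rule D) simp
          note this[measurable]
          show "{\<omega>\<in>space M. \<forall>i<n. D (real m + real (Suc i) * 1) \<omega> - D (real m + real i * 1) \<omega> \<in> {..\<epsilon>}} \<in> events"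
            by measurable
        qed
        also have "\<dots> = q ^ n"
          unfolding q_def by (rule levy_process_increments_in[OF assms(1) levy]) auto
        finally show ?thesis .
      qed
      then have "prob ?B \<le> 0"
        using LIMSEQ_power_zero[of q] q by (intro tendsto_lowerbound[of "\<lambda>n. q ^ n" 0 sequentially]) auto
      then have "prob ?B = 0" by (simp add: measure_le_0_iff)
      then have "AE \<omega> in M. \<not> (\<forall>k\<ge>m. D (real (Suc k)) \<omega> - D (real k) \<omega> \<le> \<epsilon>)"
        by (subst (asm) prob_eq_0) auto
      then show ?thesis by (simp add: not_le)
    qed
    then have "AE \<omega> in M. \<forall>m. \<exists>k\<ge>m. \<epsilon> < D (real (Suc k)) \<omega> - D (real k) \<omega>"
      unfolding AE_all_countable by blast
    then show ?thesis by (intro exI[of _ \<epsilon>]) (simp add: \<epsilon>_def)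
  qed
  then obtain \<epsilon> where \<epsilon>: "0 < \<epsilon>" "AE \<omega> in M. \<forall>m::nat. \<exists>k\<ge>m. \<epsilon> < D (real (Suc k)) \<omega> - D (real k) \<omega>" by blast
  show ?thesis
    using incr \<epsilon>(2) mono zero cadlag
  proof eventually_elim
    case (elim \<omega>)
    have le: "D x \<omega> \<le> D y \<omega>" if "0 \<le> x" "x \<le> y" for x y
      using mono_onD[OF elim(3), of x y] that by simp
    show ?case
    proof
      show "D 0 \<omega> = 0" by fact
      show "((\<lambda>x. D x \<omega>) \<longlongrightarrow> D x \<omega>) (at_right x)" if "0 \<le> x" for x
        using elim(5) that by (simp add: cadlag_def)
      show "D x \<omega> < D y \<omega>" if xy: "0 \<le> x" "x < y" for x y
      proof -
        obtain a where a: "a \<in> \<rat>" "x < a" "a < y" using Rats_dense_in_real[OF xy(2)] by blast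
        obtain b where b: "b \<in> \<rat>" "a < b" "b < y" using Rats_dense_in_real[OF a(3)] by blast
        have "D b \<omega> \<noteq> D a \<omega>" using elim(1) a b xy by auto
        then show ?thesis using le[of x a] le[of a b] le[of b y] a b xy by auto
      qed
      have grow: "\<exists>k::nat. real j * \<epsilon> \<le> D (real k) \<omega>" for j :: nat
      proof (induction j)
        case 0
        then show ?case using le[of 0 0] elim(4) by (intro exI[of _ 0]) simp
      next
        case (Suc j)
        then obtain k where k: "real j * \<epsilon> \<le> D (real k) \<omega>" by blast
        obtain l where l: "k \<le> l" "\<epsilon> < D (real (Suc l)) \<omega> - D (real l) \<omega>" using elim(2) by blast
        have "D (real k) \<omega> \<le> D (real l) \<omega>" using l(1) by (intro le) auto
        then show ?case using k l(2) by (intro exI[of _ "Suc l"]) (simp add: distrib_right)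
      qed
      show "\<exists>x\<ge>0. c < D x \<omega>" for c
      proof -
        obtain j :: nat where "c / \<epsilon> < real j" using reals_Archimedean2 by blast
        then have "c < real j * \<epsilon>" using \<epsilon>(1) by (simp add: field_simps)
        then show ?thesis using grow[of j] by (meson less_le_trans of_nat_0_le_iff)
      qed
    qed
  qed
qed

section \<open>Comparison of exponents and the graph\<close>

lemma borel_measurable_inverse_one_plus_char_exponent:
  fixes Y :: "real \<Rightarrow> 'w \<Rightarrow> 'a::euclidean_space"
  assumes "prob_space M" "levy_process M Y" "has_char_exponent M Y \<Psi>"
  shows "(\<lambda>\<xi>. 1 / (1 + \<Psi> \<xi>)) \<in> borel_measurable borel"
proof -
  obtain W where "(\<lambda>(t, \<omega>). W t \<omega>) \<in> borel_measurable (borel \<Otimes>\<^sub>M M)" "AE \<omega> in M. \<forall>t\<ge>0. W t \<omega> = Y t \<omega>"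
    using levy_process_jointly_measurable_version[OF assms(2)] .
  with assms interpret levy_potential M Y W
    by (simp add: levy_potential_def levy_potential_axioms_def)
  show ?thesis by (rule borel_measurable_inverse_one_plus_exponent[OF assms(3)])
qed

text \<open>The two norms differ by a factor of at most 2 and the comparison holds far out; on a
  bounded region both integrands are at most 1. Measurability is assumed for \<open>v\<close> alone,
  so the integral of \<open>w\<close> is only compared by monotonicity and never split.\<close>

lemma weighted_integral_finite_iff:
  fixes v w :: "real \<times> 'b::euclidean_space \<Rightarrow> real" and \<kappa> K R :: real
  assumes [measurable]: "v \<in> borel_measurable borel"
    and v: "\<And>z. 0 \<le> v z" "\<And>z. v z \<le> 1" and w: "\<And>z. 0 \<le> w z" "\<And>z. w z \<le> 1"
    and K: "1 \<le> K" and "0 < \<kappa>"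
    and comp: "\<And>z. R \<le> \<bar>fst z\<bar> + norm (snd z) \<Longrightarrow> inverse K * w z \<le> v z \<and> v z \<le> K * w z"
  shows "(\<integral>\<^sup>+z\<in>{z. 1 \<le> norm z}. ennreal (v z / norm z powr \<kappa>) \<partial>lborel) < \<infinity> \<longleftrightarrow>
    (\<integral>\<^sup>+z\<in>{z. 1 \<le> \<bar>fst z\<bar> + norm (snd z)}. ennreal (w z / (\<bar>fst z\<bar> + norm (snd z)) powr \<kappa>) \<partial>lborel) < \<infinity>"
    (is "?A < \<infinity> \<longleftrightarrow> ?B < \<infinity>")
proof -
  define N where "N z = \<bar>fst z\<bar> + norm (snd z)" for z :: "real \<times> 'b"
  have N: "norm z \<le> N z" "N z \<le> 2 * norm z" for z
    using norm_Pair_le[of "fst z" "snd z"] norm_fst_le[of "fst z" "snd z"]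
      norm_snd_le[of "snd z" "fst z"] by (auto simp: N_def)
  \<comment> \<open>From norm \<open>\<rho>\<close> on, a point lies in both domains of integration
    and in the range of the comparison.\<close>
  define \<rho> where "\<rho> = max 1 R"
  have \<rho>: "1 \<le> \<rho>" "R \<le> \<rho>" by (auto simp: \<rho>_def)
  have ball: "emeasure lborel {z :: real \<times> 'b. norm z < r} < \<infinity>" for r
    using emeasure_lborel_ball_finite[of "0 :: real \<times> 'b" r] by (simp add: ball_def)
  let ?V = "emeasure lborel {z :: real \<times> 'b. norm z < \<rho>}"
  let ?A' = "\<integral>\<^sup>+z\<in>{z. \<rho> \<le> norm z}. ennreal (v z / norm z powr \<kappa>) \<partial>lborel"
  have A: "?A \<le> ?V + ?A'"
  proof -
    have "?A \<le> (\<integral>\<^sup>+z. indicator {z :: real \<times> 'b. norm z < \<rho>} z + ennreal (v z / norm z powr \<kappa>) * indicator {z. \<rho> \<le> norm z} z \<partial>lborel)"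
    proof (intro nn_integral_mono)
      fix z :: "real \<times> 'b"
      have "v z / norm z powr \<kappa> \<le> 1" if "1 \<le> norm z"
        using that v(2)[of z] assms(7) ge_one_powr_ge_zero[of "norm z" \<kappa>] by (simp add: divide_le_eq)
      then show "ennreal (v z / norm z powr \<kappa>) * indicator {z. 1 \<le> norm z} z
        \<le> indicator {z. norm z < \<rho>} z + ennreal (v z / norm z powr \<kappa>) * indicator {z. \<rho> \<le> norm z} z"
        by (auto split: split_indicator simp: ennreal_le_1)
    qed
    also have "\<dots> = ?V + ?A'"
      by (subst nn_integral_add) auto
    finally show ?thesis .
  qed
  have A'_B: "ennreal (1 / (K * 2 powr \<kappa>)) * ?A' \<le> ?B"
  proof -
    have "ennreal (1 / (K * 2 powr \<kappa>)) * ?A' = (\<integral>\<^sup>+z. ennreal (1 / (K * 2 powr \<kappa>)) * (ennreal (v z / norm z powr \<kappa>) * indicator {z. \<rho> \<le> norm z} z) \<partial>lborel)"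
      by (rule nn_integral_cmult[symmetric]) measurable
    also have "\<dots> \<le> ?B"
    proof (intro nn_integral_mono)
      fix z :: "real \<times> 'b"
      have "1 / (K * 2 powr \<kappa>) * (v z / norm z powr \<kappa>) \<le> w z / N z powr \<kappa>" if z: "\<rho> \<le> norm z"
      proof -
        have pos: "0 < norm z" "0 < N z" using z \<rho> N(1)[of z] by linarith+
        have "R \<le> N z" using z \<rho> N(1)[of z] by linarith
        then have "v z \<le> K * w z" using comp[of z] by (simp add: N_def)
        moreover have "N z powr \<kappa> \<le> (2 * norm z) powr \<kappa>"
          using N(2)[of z] pos assms(7) by (intro powr_mono2) auto
        ultimately have "v z * N z powr \<kappa> \<le> (K * w z) * (2 * norm z) powr \<kappa>"
          using K w(1)[of z] by (intro mult_mono) auto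
        then show ?thesis using pos K by (simp add: powr_mult field_simps)
      qed
      moreover have "1 \<le> N z" if "\<rho> \<le> norm z" using that \<rho> N(1)[of z] by linarith
      ultimately show "ennreal (1 / (K * 2 powr \<kappa>)) * (ennreal (v z / norm z powr \<kappa>) * indicator {z. \<rho> \<le> norm z} z)
        \<le> ennreal (w z / (\<bar>fst z\<bar> + norm (snd z)) powr \<kappa>) * indicator {z. 1 \<le> \<bar>fst z\<bar> + norm (snd z)} z"
        using K v(1)[of z] unfolding N_def[symmetric]
        by (auto split: split_indicator intro!: ennreal_leI simp flip: ennreal_mult')
    qed
    finally show ?thesis .
  qed
  have B_A: "?B \<le> ?V + ennreal K * ?A"
  proof -
    have "?B \<le> (\<integral>\<^sup>+z. indicator {z :: real \<times> 'b. norm z < \<rho>} z + ennreal K * (ennreal (v z / norm z powr \<kappa>) * indicator {z. 1 \<le> norm z} z) \<partial>lborel)"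
    proof (intro nn_integral_mono)
      fix z :: "real \<times> 'b"
      have 1: "w z / N z powr \<kappa> \<le> 1" if "1 \<le> N z"
        using that w(2)[of z] assms(7) ge_one_powr_ge_zero[of "N z" \<kappa>] by (simp add: divide_le_eq)
      have 2: "w z / N z powr \<kappa> \<le> K * (v z / norm z powr \<kappa>)" if z: "\<rho> \<le> norm z"
      proof -
        have pos: "0 < norm z" using z \<rho> by linarith
        have "R \<le> N z" using z \<rho> N(1)[of z] by linarith
        then have "w z \<le> K * v z" using comp[of z] K by (simp add: N_def field_simps)
        moreover have "norm z powr \<kappa> \<le> N z powr \<kappa>" using N(1)[of z] pos assms(7) by (intro powr_mono2) auto
        ultimately have "w z / N z powr \<kappa> \<le> (K * v z) / norm z powr \<kappa>"
          using pos w(1)[of z] by (intro frac_le) auto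
        then show ?thesis by simp
      qed
      have "ennreal (w z / N z powr \<kappa>) * indicator {z. 1 \<le> N z} z
        \<le> indicator {z. norm z < \<rho>} z + ennreal K * (ennreal (v z / norm z powr \<kappa>) * indicator {z. 1 \<le> norm z} z)"
      proof (cases "norm z < \<rho>")
        case True
        then show ?thesis using 1 by (auto split: split_indicator simp: ennreal_le_1 intro: add_increasing2)
      next
        case False
        then have "1 \<le> norm z" using \<rho> by linarith
        then show ?thesis
          using 2 False K v(1)[of z]
          by (auto split: split_indicator simp: ennreal_leI simp flip: ennreal_mult')
      qed
      then show "ennreal (w z / (\<bar>fst z\<bar> + norm (snd z)) powr \<kappa>) * indicator {z. 1 \<le> \<bar>fst z\<bar> + norm (snd z)} z
        \<le> indicator {z. norm z < \<rho>} z + ennreal K * (ennreal (v z / norm z powr \<kappa>) * indicator {z. 1 \<le> norm z} z)"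
        by (simp add: N_def)
    qed
    also have "\<dots> = ?V + ennreal K * ?A"
      by (subst nn_integral_add) (auto simp: nn_integral_cmult)
    finally show ?thesis .
  qed
  show ?thesis
  proof
    assume "?A < \<infinity>"
    then have "?V + ennreal K * ?A < \<infinity>"
      using ball by (simp add: ennreal_mult_less_top)
    then show "?B < \<infinity>" using B_A by (rule le_less_trans[rotated])
  next
    assume "?B < \<infinity>"
    then have "ennreal (1 / (K * 2 powr \<kappa>)) * ?A' < \<infinity>" using A'_B by (rule le_less_trans[rotated])
    then have "?A' < \<infinity>" using K by (auto simp: ennreal_mult_less_top)
    then have "?V + ?A' < \<infinity>" using ball by simp
    then show "?A < \<infinity>" using A by (rule le_less_trans[rotated])
  qed
qed

lemma (in increasing_clock) hausdorff_dim_graph: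
  fixes y :: "real \<Rightarrow> 'a::metric_space"
  assumes dim: "\<And>T. 0 < T \<Longrightarrow> hausdorff_dim ((\<lambda>x. (D x \<omega>, y x)) ` {0..T}) = ereal s"
  shows "hausdorff_dim ((\<lambda>t. (t, y (E t))) ` {0..1}) = ereal (max 1 s)"
proof (rule antisym)
  let ?G = "(\<lambda>t. (t, y (E t))) ` {0..1}"
  show "hausdorff_dim ?G \<le> ereal (max 1 s)"
  proof (rule hausdorff_dim_leI)
    fix u assume u: "max 1 s < u"
    have "hausdorff_measure u ((\<lambda>x. (D x \<omega>, y x)) ` {0..E 1}) = 0"
      using dim[OF E_1_pos] u by (intro hausdorff_dim_leD[of _ s]) auto
    moreover have "hausdorff_measure u (\<Union>q\<in>\<rat>. {0..1::real} \<times> {y (E q)}) = 0"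
      using u by (intro hausdorff_null_UN_countable countable_rat hausdorff_null_segment) auto
    ultimately have "hausdorff_measure u ((\<lambda>x. (D x \<omega>, y x)) ` {0..E 1} \<union> (\<Union>q\<in>\<rat>. {0..1} \<times> {y (E q)})) = 0"
      using hausdorff_null_UN_countable[of UNIV u "\<lambda>b. if b then (\<lambda>x. (D x \<omega>, y x)) ` {0..E 1} else (\<Union>q\<in>\<rat>. {0..1} \<times> {y (E q)})"]
      by (simp add: UNIV_bool Un_commute)
    then show "hausdorff_measure u ?G = 0" by (rule hausdorff_null_subset[OF graph_subset])
  qed simp
  have "ereal 1 \<le> hausdorff_dim ?G"
  proof (rule hausdorff_dim_geI, rule notI)
    fix u :: real assume u: "0 \<le> u" "u < 1" "hausdorff_measure u ?G = 0"
    then have "hausdorff_measure 1 ?G = 0" using hausdorff_null_antimono_exponent[of u 1 ?G] by simp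
    then have "hausdorff_measure 1 (fst ` ?G) = 0"
      by (rule hausdorff_null_image_nonexpansive[rotated 2]) (auto simp: dist_fst_le)
    moreover have "fst ` ?G = {0..1}" by (auto simp: image_image)
    ultimately show False using hausdorff_measure_unit_interval by simp
  qed
  moreover have "ereal s \<le> hausdorff_dim ?G"
  proof -
    obtain x0 where x0: "0 < x0" "D x0 \<omega> \<le> 1" using ex_pos_D_le_1 by auto
    show ?thesis
      using hausdorff_dim_mono[OF range_subset_graph[OF x0(2)], of y] dim[OF x0(1)] by simp
  qed
  ultimately show "ereal (max 1 s) \<le> hausdorff_dim ?G" by (simp add: max_def)
qed

theorem proposition3p2:
  fixes M :: "'w measure"
    and Y :: "real \<Rightarrow> 'w \<Rightarrow> real ^ 'd"
    and D :: "real \<Rightarrow> 'w \<Rightarrow> real"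
    and \<psi> :: "real ^ 'd \<Rightarrow> complex"
    and \<sigma> :: "real \<Rightarrow> complex"
    and \<Phi> :: "real \<times> (real ^ 'd) \<Rightarrow> complex"
    and \<nu>\<^sub>D :: "real measure"
    and K :: real
  assumes "prob_space M"
    and "levy_process M Y" and "has_char_exponent M Y \<psi>"
    and "subordinator M D" and "has_char_exponent M D \<sigma>"
    and "has_drift_and_levy_measure \<sigma> 0 \<nu>\<^sub>D" and "emeasure \<nu>\<^sub>D {0<..} = \<infinity>"
    and "levy_process M (\<lambda>x \<omega>. (D x \<omega>, Y x \<omega>))"
    and "has_char_exponent M (\<lambda>x \<omega>. (D x \<omega>, Y x \<omega>)) \<Phi>"
    and "K \<ge> 1"
    and "\<exists>R. \<forall>\<eta> \<xi>. \<bar>\<eta>\<bar> + norm \<xi> \<ge> R \<longrightarrow>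
           inverse K * Re (1 / (1 + \<sigma> \<eta> + \<psi> \<xi>)) \<le> Re (1 / (1 + \<Phi> (\<eta>, \<xi>))) \<and>
           Re (1 / (1 + \<Phi> (\<eta>, \<xi>))) \<le> K * Re (1 / (1 + \<sigma> \<eta> + \<psi> \<xi>))"
  shows "(AE \<omega> in M.
            hausdorff_dim ((\<lambda>t. time_changed Y D t \<omega>) ` {0..1}) =
            ereal (Sup {\<gamma>. \<gamma> < real CARD('d) \<and>
              (\<integral>\<^sup>+ \<xi> \<in> {\<xi>. norm \<xi> \<ge> 1}.
                 ennreal (Re (1 / (1 + \<psi> \<xi>)) / norm \<xi> powr (real CARD('d) - \<gamma>)) \<partial>lborel) < \<infinity>}))
       \<and> (AE \<omega> in M.
            hausdorff_dim ((\<lambda>t. (t, time_changed Y D t \<omega>)) ` {0..1}) =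
            ereal (max 1 (Sup {\<gamma>. \<gamma> < 1 + real CARD('d) \<and>
              (\<integral>\<^sup>+ (\<eta>, \<xi>) \<in> {(\<eta>, \<xi>). \<bar>\<eta>\<bar> + norm \<xi> \<ge> 1}.
                 ennreal (Re (1 / (1 + \<sigma> \<eta> + \<psi> \<xi>))
                          / (\<bar>\<eta>\<bar> + norm \<xi>) powr (1 + real CARD('d) - \<gamma>)) \<partial>lborel) < \<infinity>})))"
proof -
  have clock: "AE \<omega> in M. increasing_clock D \<omega>"
    using assms(1,4) subordinator_no_zero_increment[OF assms(1,4-7)] by (rule AE_increasing_clock)
  show ?thesis
  proof (intro conjI, goal_cases)
    case 1
    show ?case
      using clock AE_hausdorff_dim_levy_range[OF assms(1-3)]
    proof eventually_elim
      case (elim \<omega>)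
      interpret increasing_clock D \<omega> by (rule elim(1))
      have "(\<lambda>t. time_changed Y D t \<omega>) ` {0..1} = (\<lambda>x. Y x \<omega>) ` (E ` {0..1})"
        by (simp add: time_changed_def image_image)
      \<comment> \<open>The range statement, valid for all \<open>T\<close> at once, is used at the
        random time \<open>T = E 1\<close> of this path.\<close>
      then show ?case using elim(2) E_1_pos by (simp add: E_image exponent_integral_def)
    qed
  next
    case 2
    obtain R where R: "\<And>z. \<bar>fst z\<bar> + norm (snd z) \<ge> R \<Longrightarrow>
             inverse K * Re (1 / (1 + \<sigma> (fst z) + \<psi> (snd z))) \<le> Re (1 / (1 + \<Phi> z)) \<and>
             Re (1 / (1 + \<Phi> z)) \<le> K * Re (1 / (1 + \<sigma> (fst z) + \<psi> (snd z)))"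
      using assms(11) by force
    have \<Phi>: "0 \<le> Re (\<Phi> z)" for z by (rule has_char_exponent_Re_nonneg[OF assms(1,9,8)])
    have levy_D: "levy_process M D" using assms(4) by (simp add: subordinator_def)
    have \<sigma>\<psi>: "0 \<le> Re (\<sigma> (fst z) + \<psi> (snd z))" for z
      using has_char_exponent_Re_nonneg[OF assms(1,5) levy_D, of "fst z"]
        has_char_exponent_Re_nonneg[OF assms(1,3,2), of "snd z"] by simp
    note [measurable] = borel_measurable_inverse_one_plus_char_exponent[OF assms(1,8,9)]
    have set_eq: "{(\<eta>, \<xi>). 1 \<le> \<bar>\<eta>\<bar> + norm \<xi>} = {z :: real \<times> (real ^ 'd). 1 \<le> \<bar>fst z\<bar> + norm (snd z)}"
      by auto
    let ?B = "\<lambda>\<gamma>. \<integral>\<^sup>+ (\<eta>, \<xi>) \<in> {(\<eta>, \<xi>). \<bar>\<eta>\<bar> + norm \<xi> \<ge> 1}.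
                   ennreal (Re (1 / (1 + \<sigma> \<eta> + \<psi> \<xi>))
                            / (\<bar>\<eta>\<bar> + norm \<xi>) powr (1 + real CARD('d) - \<gamma>)) \<partial>lborel"
    \<comment> \<open>The bound on \<open>\<gamma>\<close> makes the exponent of the weight
      positive, as the comparison of the two norms requires.\<close>
    have index: "exponent_integral \<Phi> \<gamma> < \<infinity> \<longleftrightarrow> ?B \<gamma> < \<infinity>"
      if "\<gamma> < 1 + real CARD('d)" for \<gamma>
      using weighted_integral_finite_iff[of "\<lambda>z. Re (1 / (1 + \<Phi> z))" "\<lambda>z. Re (1 / (1 + \<sigma> (fst z) + \<psi> (snd z)))" K "1 + real CARD('d) - \<gamma>" R]
        Re_inverse_one_plus[OF \<Phi>] Re_inverse_one_plus[OF \<sigma>\<psi>] R assms(10) that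
      by (simp add: split_beta less_imp_le add.assoc set_eq exponent_integral_def)
    have DIM: "real DIM(real \<times> (real ^ 'd)) = 1 + real CARD('d)" by simp
    have sets: "{\<gamma>. \<gamma> < 1 + real CARD('d) \<and> exponent_integral \<Phi> \<gamma> < \<infinity>} = {\<gamma>. \<gamma> < 1 + real CARD('d) \<and> ?B \<gamma> < \<infinity>}"
      by (intro Collect_cong conj_cong refl index)
    show ?case
      using clock AE_hausdorff_dim_levy_range[OF assms(1,8,9)]
    proof eventually_elim
      case (elim \<omega>)
      interpret increasing_clock D \<omega> by (rule elim(1))
      show ?case
        unfolding time_changed_def
      proof (rule hausdorff_dim_graph)
        fix T :: real assume "0 < T"
        then show "hausdorff_dim ((\<lambda>x. (D x \<omega>, Y x \<omega>)) ` {0..T}) =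
          ereal (Sup {\<gamma>. \<gamma> < 1 + real CARD('d) \<and> ?B \<gamma> < \<infinity>})"
          using elim(2) unfolding DIM sets by blast
      qed
    qed
  qed
qed

end
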